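(* Let $(X^\delta,Y^\delta)_{\delta\in\Delta}$ be a family of pairs of subspaces as described in the context, and assume that $$\gamma_\Delta:=\inf_{\delta\in\Delta}\ \inf_{\{z\in X^\delta\colon \mathrm{d}_tz\ne0\}}\frac{\|\mathrm{d}_t^\delta z\|_{(Y^\delta)'}}{\|\mathrm{d}_tE_X^\delta z\|_{Y'}}>0.$$ Let $(f,g)\in Y'\times X'$, and for $\delta\in\Delta$ let $(\theta,u)\in Y\times X$ and $(\theta^\delta,u^\delta)\in Y^\delta\times X^\delta$ be the solutions of $$N(\theta,u)=(f,g),\qquad N^\delta(\theta^\delta,u^\delta)=\big((E_Y^\delta)'f,(E_X^\delta)'g\big).$$ Then $$\|\theta-E_Y^\delta\theta^\delta\|_Y+\|u-E_X^\delta u^\delta\|_X\le\Big(1+\tfrac{L_{N^{-1}}L_N}{\gamma_\Delta^2}\Big)\inf_{(\bar\theta^\delta,\bar u^\delta)\in Y^\delta\times X^\delta}\big(\|\theta-E_Y^\delta\bar\theta^\delta\|_Y+\|u-E_X^\delta\bar u^\delta\|_X\big).$$ If, for some $(\ell,u_0)\in Y'\times H$, $(f,g)=(\ell,-(\ell+\gamma_0'u_0))$ (i.e. $\mathrm{d}_tu+Au=\ell$, $\gamma_0u=u_0$), and $X^\delta\subset Y^\delta$, then $$\|u-E_X^\delta u^\delta\|_X\le2\Big(1+\tfrac{L_{N^{-1}}L_N}{\gamma_\Delta^2}\Big)\inf_{\bar u^\delta\in X^\delta}\|u-E_X^\delta\bar u^\delta\|_X.$$ Here $L_N:=L_A+1$,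 $L_{N^{-1}}:=\tfrac1{m_A}+\max(1,\tfrac1{m_A})\tfrac1{m_S}(1+\tfrac1{m_A})$ and $m_S:=\min(1,m_A,\tfrac{m_A}{L_A^2})$.
   Context: All linear spaces are over $\mathbb R$. $V\hookrightarrow H\simeq H'\hookrightarrow V'$ is a Gelfand triple of Hilbert spaces, $T>0$, $\Xi:=(0,T)$. Set $Y:=L_2(\Xi;V)$ and $X:=L_2(\Xi;V)\cap H^1(\Xi;V')$. It is known that $X\hookrightarrow C(\overline\Xi;H)$, and $\gamma_t\colon X\to H$ denotes the trace $w\mapsto w(t)$. Define $\mathrm{d}_t\colon X\to Y'$ by $(\mathrm{d}_t w)(v):=\int_\Xi (\tfrac{\mathrm{d}w}{\mathrm{d}t}(t))(v(t))\,\mathrm{d}t$. $X$ is equipped with the norm $\|w\|_X:=\sqrt{\|w\|_Y^2+\|\mathrm{d}_tw\|_{Y'}^2+\|\gamma_Tw\|_H^2}$. For a.e. $t\in\Xi$, $A(t)\colon V\to V'$ is a possibly nonlinear operator, and $A\colon Y\to Y'$ is defined by $(Aw)(v):=\int_\Xi (A(t)w(t))(v(t))\,\mathrm{d}t$. It is assumed that $A\colon Y\to Y'$ is Lipschitz continuous, $\|Aw-Av\|_{Y'}\le L_A\|w-v\|_Y$, and strongly monotone, $(Aw-Av)(w-v)\ge m_A\|w-v\|_Y^2$, for all $w,v\in Y$, with constants $L_A,m_A>0$. Primes denote duals/adjoints, and functionals in $Y'$ are viewed in $X'$ by restriction. $(X^\delta)_{\delta\in\Delta}$ and $(Y^\delta)_{\delta\in\Delta}$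 are families of closed non-trivial subspaces of $X$ and $Y$; the index set contains $\delta_*$ with $X^{\delta_*}=X$, $Y^{\delta_*}=Y$, and for $\delta\ne\delta_*$ the spaces $X^\delta$, $Y^\delta$ are finite dimensional. $E_X^\delta\colon X^\delta\to X$ and $E_Y^\delta\colon Y^\delta\to Y$ are the trivial embeddings (so $(E_Y^\delta)'$, $(E_X^\delta)'$ restrict functionals to $Y^\delta$, $X^\delta$). $Y^\delta$ is equipped with $\|\cdot\|_{Y^\delta}:=\|E_Y^\delta\cdot\|_Y$ and $(Y^\delta)'$ with the dual norm. Set $A_Y^\delta:=(E_Y^\delta)'AE_Y^\delta$, $A_X^\delta:=(E_X^\delta)'AE_X^\delta$, $\mathrm{d}_t^\delta:=(E_Y^\delta)'\mathrm{d}_tE_X^\delta$, $\gamma_t^\delta:=\gamma_tE_X^\delta$, and define $N^\delta\colon Y^\delta\times X^\delta\to(Y^\delta)'\times(X^\delta)'$ by $$N^\delta(\theta,u):=\big(A_Y^\delta\theta+\mathrm{d}_t^\delta u,\ (\mathrm{d}_t^\delta)'\theta-(A_X^\delta u+(\gamma_T^\delta)'\gamma_T^\delta u)\big),$$ and $N:=N^{\delta_*}\colon Y\times X\to Y'\times X'$, i.e. $N(\theta,u)=(A\theta+\mathrm{d}_tu,\ \mathrm{d}_t'\theta-(Au+\gamma_T'\gamma_Tu))$. These operators are invertible. *)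

theory Defs
  imports "HOL-Analysis.Analysis" "HOL-Library.Function_Algebras"
begin

text \<open>
  Conventions. The Hilbert spaces \<open>V\<close> and \<open>H\<close> are types of class \<open>real_inner\<close>, \<open>complete_space\<close>; they
  are not assumed separable. \<open>V'\<close> is the type of bounded linear functionals on \<open>V\<close> with its operator
  norm. Elements of the Bochner spaces over \<open>(0,T)\<close> are represented by functions on the reals, of
  which only the values on \<open>(0,T)\<close> up to null sets matter: the spaces below are sets of functions
  carrying a seminorm whose kernel is equality almost everywhere on \<open>(0,T)\<close>. Functionals
  on such a space are functions of which only the values on that space matter, so restriction of
  functionals to a subspace is \<open>restrict\<close>.
\<close>

instantiation "fun" :: (type, real_vector) real_vector
begin

definition scaleR_fun :: "real \<Rightarrow> ('a \<Rightarrow> 'b) \<Rightarrow> 'a \<Rightarrow> 'b" where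
  "scaleR_fun c f = (\<lambda>x. c *\<^sub>R f x)"

instance
  by standard (simp_all add: scaleR_fun_def fun_eq_iff plus_fun_def scaleR_add_right scaleR_add_left)

end

subsection \<open>Spaces of functionals\<close>

definition dual :: "'a::real_vector set \<Rightarrow> ('a \<Rightarrow> real) \<Rightarrow> ('a \<Rightarrow> real) set" where
  "dual S N = {F. (\<forall>x\<in>S. \<forall>y\<in>S. F (x + y) = F x + F y) \<and>
                  (\<forall>c. \<forall>x\<in>S. F (c *\<^sub>R x) = c * F x) \<and>
                  (\<exists>C. \<forall>x\<in>S. \<bar>F x\<bar> \<le> C * N x)}"

text \<open>As for \<open>onorm\<close>, elements of seminorm zero contribute \<open>\<bar>F x\<bar> / 0 = 0\<close> to the supremum.\<close>

definition dual_norm :: "'a set \<Rightarrow> ('a \<Rightarrow> real) \<Rightarrow> ('a \<Rightarrow> real) \<Rightarrow> real" where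
  "dual_norm S N F = (SUP x\<in>S. \<bar>F x\<bar> / N x)"

text \<open>
  Since the limit in the last conjunct is arbitrary in \<open>X\<close>, a closed subspace contains with each
  function all functions of \<open>X\<close> that agree with it almost everywhere.
\<close>

definition closed_subspace :: "'a::real_vector set \<Rightarrow> ('a \<Rightarrow> real) \<Rightarrow> 'a set \<Rightarrow> bool" where
  "closed_subspace X N S \<longleftrightarrow> subspace S \<and> S \<subseteq> X \<and>
     (\<forall>s x. (\<forall>n. s n \<in> S) \<and> x \<in> X \<and> (\<lambda>n. N (s n - x)) \<longlonglongrightarrow> 0 \<longrightarrow> x \<in> S)"

subsection \<open>Bochner spaces\<close>

definition gelfand_triple :: "('v::real_inner \<Rightarrow>\<^sub>L 'h::real_inner) \<Rightarrow> bool" where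
  "gelfand_triple \<iota> \<longleftrightarrow> inj (blinfun_apply \<iota>) \<and> closure (range (blinfun_apply \<iota>)) = UNIV"

text \<open>The embedding \<open>V \<hookrightarrow> H \<simeq> H' \<hookrightarrow> V'\<close> sends \<open>v\<close> to \<open>x \<mapsto> \<langle>\<iota> v, \<iota> x\<rangle>\<close>.\<close>

definition emb_dual :: "('v::real_inner \<Rightarrow>\<^sub>L 'h::real_inner) \<Rightarrow> 'v \<Rightarrow> 'v \<Rightarrow>\<^sub>L real" where
  "emb_dual \<iota> v = blinfun_inner_right (\<iota> v) o\<^sub>L \<iota>"

abbreviation Xi :: "real \<Rightarrow> real measure" where
  "Xi T \<equiv> lebesgue_on {0<..<T}"

text \<open>Bochner measurability, without the separability required by \<open>borel_measurable\<close>-based notions.\<close>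

definition strongly_measurable :: "'a measure \<Rightarrow> ('a \<Rightarrow> 'b::topological_space) \<Rightarrow> bool" where
  "strongly_measurable M f \<longleftrightarrow>
     (\<exists>s. (\<forall>i::nat. simple_function M (s i)) \<and> (AE t in M. (\<lambda>i. s i t) \<longlonglongrightarrow> f t))"

definition L2 :: "real \<Rightarrow> (real \<Rightarrow> 'b::real_normed_vector) set" where
  "L2 T = {w. strongly_measurable (Xi T) w \<and> integrable (Xi T) (\<lambda>t. (norm (w t))\<^sup>2)}"

definition L2_norm :: "real \<Rightarrow> (real \<Rightarrow> 'b::real_normed_vector) \<Rightarrow> real" where
  "L2_norm T w = sqrt (\<integral>t. (norm (w t))\<^sup>2 \<partial>Xi T)"

definition test_function :: "real \<Rightarrow> (real \<Rightarrow> real) \<Rightarrow> bool" where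
  "test_function T \<phi> \<longleftrightarrow> \<phi> C1_differentiable_on UNIV \<and>
     compact (closure {t. \<phi> t \<noteq> 0}) \<and> closure {t. \<phi> t \<noteq> 0} \<subseteq> {0<..<T}"

text \<open>
  \<open>G\<close> is the weak derivative of \<open>F\<close>: \<open>\<integral> \<phi>' F = - \<integral> \<phi> G\<close> in \<open>V'\<close> for all test functions. This
  identity of Bochner integrals is evaluated at each \<open>v\<close> in \<open>V\<close>, which commutes with integration.
\<close>

definition weak_derivative ::
    "real \<Rightarrow> (real \<Rightarrow> 'v::real_normed_vector \<Rightarrow>\<^sub>L real) \<Rightarrow> (real \<Rightarrow> 'v \<Rightarrow>\<^sub>L real) \<Rightarrow> bool" where
  "weak_derivative T F G \<longleftrightarrow>
     (\<forall>\<phi>. test_function T \<phi> \<longrightarrow>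
       (\<forall>v. (\<integral>t. deriv \<phi> t * F t v \<partial>Xi T) = - (\<integral>t. \<phi> t * G t v \<partial>Xi T)))"

definition H1 :: "real \<Rightarrow> (real \<Rightarrow> 'v::real_normed_vector \<Rightarrow>\<^sub>L real) set" where
  "H1 T = {F \<in> L2 T. \<exists>G \<in> L2 T. weak_derivative T F G}"

abbreviation Yspace :: "real \<Rightarrow> (real \<Rightarrow> 'v::real_inner) set" where
  "Yspace T \<equiv> L2 T"

definition Xspace :: "real \<Rightarrow> ('v::real_inner \<Rightarrow>\<^sub>L 'h::real_inner) \<Rightarrow> (real \<Rightarrow> 'v) set" where
  "Xspace T \<iota> = {w \<in> L2 T. (\<lambda>t. emb_dual \<iota> (w t)) \<in> H1 T}"

text \<open>The time derivative with values in \<open>V'\<close>; it is determined up to a null set.\<close>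

definition ddt ::
    "real \<Rightarrow> ('v::real_inner \<Rightarrow>\<^sub>L 'h::real_inner) \<Rightarrow> (real \<Rightarrow> 'v) \<Rightarrow> real \<Rightarrow> 'v \<Rightarrow>\<^sub>L real" where
  "ddt T \<iota> w = (SOME G. G \<in> L2 T \<and> weak_derivative T (\<lambda>t. emb_dual \<iota> (w t)) G)"

definition dt ::
    "real \<Rightarrow> ('v::real_inner \<Rightarrow>\<^sub>L 'h::real_inner) \<Rightarrow> (real \<Rightarrow> 'v) \<Rightarrow> (real \<Rightarrow> 'v) \<Rightarrow> real" where
  "dt T \<iota> w v = (\<integral>t. ddt T \<iota> w t (v t) \<partial>Xi T)"

text \<open>The value at \<open>t\<close> in \<open>[0,T]\<close> of the representative in \<open>C([0,T]; H)\<close>.\<close>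

definition time_trace ::
    "real \<Rightarrow> ('v::real_inner \<Rightarrow>\<^sub>L 'h::real_inner) \<Rightarrow> real \<Rightarrow> (real \<Rightarrow> 'v) \<Rightarrow> 'h" where
  "time_trace T \<iota> t w =
     (THE h. \<exists>c. continuous_on {0..T} c \<and> (AE s in Xi T. \<iota> (w s) = c s) \<and> c t = h)"

abbreviation Ynorm :: "real \<Rightarrow> (real \<Rightarrow> 'v::real_inner) \<Rightarrow> real" where
  "Ynorm T \<equiv> L2_norm T"

definition Xnorm :: "real \<Rightarrow> ('v::real_inner \<Rightarrow>\<^sub>L 'h::real_inner) \<Rightarrow> (real \<Rightarrow> 'v) \<Rightarrow> real" where
  "Xnorm T \<iota> w = sqrt ((Ynorm T w)\<^sup>2 + (dual_norm (Yspace T) (Ynorm T) (dt T \<iota> w))\<^sup>2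
                        + (norm (time_trace T \<iota> T w))\<^sup>2)"

text \<open>Finite dimension of the space of equivalence classes of elements of \<open>S\<close>.\<close>

definition finite_dim_ae :: "real \<Rightarrow> (real \<Rightarrow> 'b::real_vector) set \<Rightarrow> bool" where
  "finite_dim_ae T S \<longleftrightarrow>
     (\<exists>B. finite B \<and> (\<forall>x\<in>S. \<exists>b\<in>span B. AE t in Xi T. x t = b t))"

subsection \<open>Operators\<close>

definition op_A ::
    "real \<Rightarrow> (real \<Rightarrow> 'v::real_inner \<Rightarrow> 'v \<Rightarrow>\<^sub>L real) \<Rightarrow> (real \<Rightarrow> 'v) \<Rightarrow> (real \<Rightarrow> 'v) \<Rightarrow> real" where
  "op_A T A w v = (\<integral>t. A t (w t) (v t) \<partial>Xi T)"

text \<open>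
  \<open>A\<close> maps \<open>Y\<close> to \<open>Y'\<close> (including existence of the defining integrals), is Lipschitz continuous with
  constant \<open>LA\<close> and strongly monotone with constant \<open>mA\<close>.
\<close>

definition lipschitz_monotone ::
    "real \<Rightarrow> (real \<Rightarrow> 'v::real_inner \<Rightarrow> 'v \<Rightarrow>\<^sub>L real) \<Rightarrow> real \<Rightarrow> real \<Rightarrow> bool" where
  "lipschitz_monotone T A LA mA \<longleftrightarrow>
     (\<forall>w\<in>Yspace T. \<forall>v\<in>Yspace T. integrable (Xi T) (\<lambda>t. A t (w t) (v t))) \<and>
     (\<forall>w\<in>Yspace T. op_A T A w \<in> dual (Yspace T) (Ynorm T)) \<and>
     (\<forall>w\<in>Yspace T. \<forall>v\<in>Yspace T.
        dual_norm (Yspace T) (Ynorm T) (op_A T A w - op_A T A v) \<le> LA * Ynorm T (w - v)) \<and>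
     (\<forall>w\<in>Yspace T. \<forall>v\<in>Yspace T.
        (op_A T A w - op_A T A v) (w - v) \<ge> mA * (Ynorm T (w - v))\<^sup>2)"

text \<open>The adjoint \<open>\<gamma>\<^sub>t' : H \<simeq> H' \<rightarrow> X'\<close> of the trace.\<close>

definition trace_adj ::
    "real \<Rightarrow> ('v::real_inner \<Rightarrow>\<^sub>L 'h::real_inner) \<Rightarrow> real \<Rightarrow> 'h \<Rightarrow> (real \<Rightarrow> 'v) \<Rightarrow> real" where
  "trace_adj T \<iota> t h z = h \<bullet> time_trace T \<iota> t z"

definition dt_adj ::
    "real \<Rightarrow> ('v::real_inner \<Rightarrow>\<^sub>L 'h::real_inner) \<Rightarrow> (real \<Rightarrow> 'v) \<Rightarrow> (real \<Rightarrow> 'v) \<Rightarrow> real" where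
  "dt_adj T \<iota> \<theta> z = dt T \<iota> z \<theta>"

text \<open>The operator \<open>N\<^sup>\<delta>\<close> for \<open>YS = Y\<^sup>\<delta>\<close> and \<open>XS = X\<^sup>\<delta>\<close>; \<open>YS = Y\<close> and \<open>XS = X\<close> yield \<open>N\<close>.\<close>

definition op_N ::
    "real \<Rightarrow> ('v::real_inner \<Rightarrow>\<^sub>L 'h::real_inner) \<Rightarrow> (real \<Rightarrow> 'v \<Rightarrow> 'v \<Rightarrow>\<^sub>L real) \<Rightarrow>
     (real \<Rightarrow> 'v) set \<Rightarrow> (real \<Rightarrow> 'v) set \<Rightarrow> (real \<Rightarrow> 'v) \<times> (real \<Rightarrow> 'v) \<Rightarrow>
     ((real \<Rightarrow> 'v) \<Rightarrow> real) \<times> ((real \<Rightarrow> 'v) \<Rightarrow> real)" where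
  "op_N T \<iota> A YS XS = (\<lambda>(\<theta>, u).
     (restrict (op_A T A \<theta> + dt T \<iota> u) YS,
      restrict (dt_adj T \<iota> \<theta> - (op_A T A u + trace_adj T \<iota> T (time_trace T \<iota> T u))) XS))"

subsection \<open>Families of trial and test spaces\<close>

definition space_family ::
    "real \<Rightarrow> ('v::real_inner \<Rightarrow>\<^sub>L 'h::real_inner) \<Rightarrow> 'd set \<Rightarrow> 'd \<Rightarrow>
     ('d \<Rightarrow> (real \<Rightarrow> 'v) set) \<Rightarrow> ('d \<Rightarrow> (real \<Rightarrow> 'v) set) \<Rightarrow> bool" where
  "space_family T \<iota> \<Delta> \<delta>s X Y \<longleftrightarrow>
     \<delta>s \<in> \<Delta> \<and> X \<delta>s = Xspace T \<iota> \<and> Y \<delta>s = Yspace T \<and>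
     (\<forall>\<delta>\<in>\<Delta>. closed_subspace (Xspace T \<iota>) (Xnorm T \<iota>) (X \<delta>) \<and> (\<exists>z\<in>X \<delta>. Xnorm T \<iota> z \<noteq> 0) \<and>
             closed_subspace (Yspace T) (Ynorm T) (Y \<delta>) \<and> (\<exists>v\<in>Y \<delta>. Ynorm T v \<noteq> 0)) \<and>
     (\<forall>\<delta>\<in>\<Delta> - {\<delta>s}. finite_dim_ae T (X \<delta>) \<and> finite_dim_ae T (Y \<delta>))"

text \<open>
  Extended reals make the inner infimum \<open>\<infinity>\<close> when \<open>dt\<close> vanishes on \<open>X \<delta>\<close>.
\<close>

definition gamma_Delta ::
    "real \<Rightarrow> ('v::real_inner \<Rightarrow>\<^sub>L 'h::real_inner) \<Rightarrow> 'd set \<Rightarrow>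
     ('d \<Rightarrow> (real \<Rightarrow> 'v) set) \<Rightarrow> ('d \<Rightarrow> (real \<Rightarrow> 'v) set) \<Rightarrow> ereal" where
  "gamma_Delta T \<iota> \<Delta> X Y =
     (INF \<delta>\<in>\<Delta>. INF z\<in>{z \<in> X \<delta>. \<exists>v\<in>Yspace T. dt T \<iota> z v \<noteq> 0}.
        ereal (dual_norm (Y \<delta>) (Ynorm T) (dt T \<iota> z) /
               dual_norm (Yspace T) (Ynorm T) (dt T \<iota> z)))"

definition L_N :: "real \<Rightarrow> real" where
  "L_N LA = LA + 1"

definition m_S :: "real \<Rightarrow> real \<Rightarrow> real" where
  "m_S LA mA = min 1 (min mA (mA / LA\<^sup>2))"

definition L_Ninv :: "real \<Rightarrow> real \<Rightarrow> real" where
  "L_Ninv LA mA = 1 / mA + max 1 (1 / mA) * (1 / m_S LA mA) * (1 + 1 / mA)"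

end

theory Submission
  imports Defs
begin

text \<open>
  The system \<open>N(\<theta>, u) = (f, g)\<close> is a saddle point problem with a monotone first block. Its stability
  rests on eliminating \<open>\<theta>\<close>: with the inverse of \<open>A\<close>, which is Lipschitz with constant \<open>1 / m\<close> and
  strongly monotone with constant \<open>m / L\<^sup>2\<close>, the second equation becomes a strongly monotone equation
  for \<open>u\<close> whose energy consists of \<open>m / L\<^sup>2\<close> times the squared dual norm of the derivative of \<open>u\<close>,
  \<open>m\<close> times its squared norm in \<open>Y\<close> and the squared norm of its final value. The same computation in
  discrete spaces yields the dual norm of the derivative over the discrete test space, and the inf-sup
  constant compares it with the full dual norm, once on either side of the stability estimate.
  Quasi-optimality is this stability applied to the discrete solution and an arbitrary discrete pair:
  by Galerkin orthogonality the residual of that pair is a difference of values of \<open>N\<close> at the pair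
  and at \<open>(\<theta>, u)\<close>.

  The elimination is carried out for a single difference of two states. The lemma
  \<open>monotone_residual_pairing\<close> states what the inverse of \<open>A\<close> would yield; it follows from an
  inequality between dual norms (\<open>dual_norm_inversion\<close>) that is an identity in Hilbert spaces. The error
  estimate for given discrete spaces is \<open>galerkin_quasi_optimal\<close>. That the constant of the statement
  suffices for small Lipschitz constants also, where \<open>N\<close> need not be Lipschitz with constant
  \<open>L + 1\<close> in the sum norms, is \<open>quasi_optimality_constant\<close>.

  For the second claim one needs \<open>\<theta> = u\<close>. Adding the two equations shows that \<open>\<eta> = \<theta> - u\<close> solves a
  homogeneous backward parabolic problem in a very weak sense. Testing with exponential averages of
  \<open>\<eta>\<close> from the past, which vanish at time \<open>0\<close>, and letting the averaging width tend to zero gives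
  \<open>\<eta> = 0\<close> (\<open>parabolic_uniqueness\<close>). Then the best approximation of \<open>u\<close> serves both components,
  which explains the factor \<open>2\<close>.

  All of this presupposes that time derivative and traces are well-defined and linear on \<open>X\<close>, and
  integration by parts. These facts are derived for spaces that need not be separable, using scalar
  integrals only: functions with values in \<open>V\<close> are approximated by finite sums of products of
  differentiable functions with vectors (\<open>L2_dense\<close>). An element of \<open>X\<close> is smoothed by solving a
  Neumann problem in time; by duality with a Dirichlet problem the derivatives of the approximations
  stay bounded in \<open>Y'\<close> (\<open>neumann_derivative_bound\<close>), and an energy estimate turns convergence in
  \<open>Y\<close> into uniform convergence in \<open>H\<close> (\<open>trace_approximation\<close>, \<open>integration_by_parts_Xspace\<close>).
\<close>

section \<open>Dual norms on semi-inner product spaces\<close>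

lemma dualI:
  assumes "\<And>x y. x \<in> S \<Longrightarrow> y \<in> S \<Longrightarrow> F (x + y) = F x + F y"
    and "\<And>c x. x \<in> S \<Longrightarrow> F (c *\<^sub>R x) = c * F x"
    and "\<And>x. x \<in> S \<Longrightarrow> \<bar>F x\<bar> \<le> C * N x"
  shows "F \<in> dual S N"
  unfolding dual_def mem_Collect_eq by (intro conjI exI[of _ C]) (simp_all add: assms)

lemma dualD:
  assumes "F \<in> dual S N" "x \<in> S" "y \<in> S"
  shows "F (x + y) = F x + F y" "F (c *\<^sub>R x) = c * F x"
  using assms by (auto simp: dual_def)

lemma dual_norm_bdd:
  assumes F: "F \<in> dual S N" and N: "\<And>x. x \<in> S \<Longrightarrow> 0 \<le> N x"
  shows "bdd_above ((\<lambda>x. \<bar>F x\<bar> / N x) ` S)"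
proof -
  have "\<exists>C. \<forall>x\<in>S. \<bar>F x\<bar> \<le> C * N x" using F by (simp add: dual_def)
  then obtain C where C: "\<And>x. x \<in> S \<Longrightarrow> \<bar>F x\<bar> \<le> C * N x" by blast
  have "\<bar>F x\<bar> / N x \<le> \<bar>C\<bar>" if "x \<in> S" for x
  proof (cases "N x = 0")
    case False
    then have "0 < N x" using N[OF that] by simp
    moreover have "C * N x \<le> \<bar>C\<bar> * N x"
      using N[OF that] by (simp add: mult_right_mono)
    ultimately show ?thesis using order_trans[OF C[OF that]] by (simp only: divide_le_eq if_True)
  qed simp
  then show ?thesis by (intro bdd_aboveI[of _ "\<bar>C\<bar>"]) auto
qed

lemma dual_norm_bound:
  assumes F: "F \<in> dual S N" and N: "\<And>x. x \<in> S \<Longrightarrow> 0 \<le> N x" and x: "x \<in> S"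
  shows "\<bar>F x\<bar> \<le> dual_norm S N F * N x"
proof (cases "N x = 0")
  case True
  have "\<exists>C. \<forall>x\<in>S. \<bar>F x\<bar> \<le> C * N x" using F by (simp add: dual_def)
  then show ?thesis using x True by force
next
  case False
  then have "0 < N x" using N[OF x] by simp
  moreover have "\<bar>F x\<bar> / N x \<le> dual_norm S N F"
    unfolding dual_norm_def by (rule cSUP_upper[OF x dual_norm_bdd[OF F N]])
  ultimately show ?thesis by (simp add: divide_le_eq)
qed

lemma dual_norm_least:
  assumes "S \<noteq> {}" and "0 \<le> C" and "\<And>x. x \<in> S \<Longrightarrow> 0 \<le> N x"
    and "\<And>x. x \<in> S \<Longrightarrow> \<bar>F x\<bar> \<le> C * N x"
  shows "dual_norm S N F \<le> C"
  unfolding dual_norm_def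
proof (rule cSUP_least[OF assms(1)])
  fix x assume x: "x \<in> S"
  show "\<bar>F x\<bar> / N x \<le> C"
    using assms(2) assms(3)[OF x] assms(4)[OF x] by (cases "N x = 0") (auto simp: divide_le_eq)
qed

locale semi_inner_space =
  fixes S :: "'a::real_vector set" and ip :: "'a \<Rightarrow> 'a \<Rightarrow> real"
  assumes subspace: "subspace S"
    and ip_sym: "x \<in> S \<Longrightarrow> y \<in> S \<Longrightarrow> ip x y = ip y x"
    and ip_add: "x \<in> S \<Longrightarrow> y \<in> S \<Longrightarrow> z \<in> S \<Longrightarrow> ip (x + y) z = ip x z + ip y z"
    and ip_scale: "x \<in> S \<Longrightarrow> y \<in> S \<Longrightarrow> ip (c *\<^sub>R x) y = c * ip x y"
    and ip_nonneg: "x \<in> S \<Longrightarrow> 0 \<le> ip x x"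
begin

definition N :: "'a \<Rightarrow> real" where "N x = sqrt (ip x x)"

lemma N_nonneg: "x \<in> S \<Longrightarrow> 0 \<le> N x"
  by (simp add: N_def ip_nonneg)

lemma N_sq: "x \<in> S \<Longrightarrow> (N x)\<^sup>2 = ip x x"
  by (simp add: N_def ip_nonneg)

lemma S_closed [intro, simp]:
  "x \<in> S \<Longrightarrow> y \<in> S \<Longrightarrow> x + y \<in> S" "x \<in> S \<Longrightarrow> y \<in> S \<Longrightarrow> x - y \<in> S" "x \<in> S \<Longrightarrow> c *\<^sub>R x \<in> S" "0 \<in> S"
  using subspace by (auto simp: subspace_add subspace_diff subspace_scale subspace_0)

lemma N_sq_combination:
  assumes "x \<in> S" "y \<in> S"
  shows "(N (x + c *\<^sub>R y))\<^sup>2 = (N x)\<^sup>2 + 2 * c * ip x y + c\<^sup>2 * (N y)\<^sup>2"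
proof -
  have "ip (x + c *\<^sub>R y) (x + c *\<^sub>R y) = ip x (x + c *\<^sub>R y) + c * ip y (x + c *\<^sub>R y)"
    using assms by (simp add: ip_add ip_scale)
  also have "\<dots> = ip (x + c *\<^sub>R y) x + c * ip (x + c *\<^sub>R y) y"
    using assms by (simp add: ip_sym)
  also have "\<dots> = ip x x + 2 * c * ip x y + c\<^sup>2 * ip y y"
    using assms by (simp add: ip_add ip_scale ip_sym[of y x] power2_eq_square algebra_simps)
  finally show ?thesis using assms by (simp add: N_sq)
qed

lemma N_scale: "x \<in> S \<Longrightarrow> N (c *\<^sub>R x) = \<bar>c\<bar> * N x"
proof -
  assume x: "x \<in> S"
  have "ip (c *\<^sub>R x) (c *\<^sub>R x) = c\<^sup>2 * ip x x"
    using x by (simp add: ip_scale ip_sym[of x "c *\<^sub>R x"] power2_eq_square)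
  then show ?thesis by (simp add: N_def real_sqrt_mult)
qed

lemma cauchy_schwarz:
  assumes x: "x \<in> S" and y: "y \<in> S"
  shows "\<bar>ip x y\<bar> \<le> N x * N y"
proof -
  have *: "0 \<le> (N x)\<^sup>2 + 2 * c * ip x y + c\<^sup>2 * (N y)\<^sup>2" for c
    using N_sq_combination[OF x y, of c] by (metis zero_le_power2)
  have "(ip x y)\<^sup>2 \<le> (N x * N y)\<^sup>2"
  proof (cases "N y = 0")
    case True
    have "ip x y = 0"
    proof (rule ccontr)
      assume ne: "ip x y \<noteq> 0"
      define c where "c = - ((N x)\<^sup>2 + 1) / (2 * ip x y)"
      have "2 * c * ip x y = - ((N x)\<^sup>2 + 1)" using ne by (simp add: c_def)
      then show False using *[of c] True by simp
    qed
    then show ?thesis by simp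
  next
    case False
    define c where "c = - ip x y / (N y)\<^sup>2"
    have "(N x)\<^sup>2 + 2 * c * ip x y + c\<^sup>2 * (N y)\<^sup>2 = (N x)\<^sup>2 - (ip x y)\<^sup>2 / (N y)\<^sup>2"
      using False by (simp add: c_def power2_eq_square)
    then have "(ip x y)\<^sup>2 / (N y)\<^sup>2 \<le> (N x)\<^sup>2" using *[of c] by simp
    then show ?thesis using False by (simp add: divide_le_eq power_mult_distrib)
  qed
  then have "\<bar>ip x y\<bar> \<le> \<bar>N x * N y\<bar>" by (simp add: abs_le_square_iff)
  then show ?thesis using x y N_nonneg by (simp add: abs_mult)
qed

lemma N_triangle:
  assumes x: "x \<in> S" and y: "y \<in> S"
  shows "N (x + y) \<le> N x + N y"
proof (rule power2_le_imp_le)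
  have "(N (x + y))\<^sup>2 = (N x)\<^sup>2 + 2 * ip x y + (N y)\<^sup>2"
    using N_sq_combination[OF x y, of 1] by simp
  then show "(N (x + y))\<^sup>2 \<le> (N x + N y)\<^sup>2"
    using cauchy_schwarz[OF x y] by (simp add: power2_sum)
qed (use x y N_nonneg in simp)

lemma N_minus_commute: "x \<in> S \<Longrightarrow> y \<in> S \<Longrightarrow> N (x - y) = N (y - x)"
  using N_scale[of "y - x" "-1"] by simp

lemma dual_0: "F \<in> dual S N \<Longrightarrow> F 0 = 0"
  using dualD(2)[of F S N 0 0 0] by simp

lemma dual_lin:
  assumes "F \<in> dual S N" "x \<in> S" "y \<in> S"
  shows "F (x + c *\<^sub>R y) = F x + c * F y" "F (x - y) = F x - F y"
proof -
  show *: "F (x + c *\<^sub>R y) = F x + c * F y" for c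
    using dualD[OF assms(1), of x "c *\<^sub>R y"] dualD(2)[OF assms(1) assms(3), of y c] assms by simp
  show "F (x - y) = F x - F y" using *[of "-1"] by simp
qed

lemma bounded_dual: "F \<in> dual S N \<Longrightarrow> x \<in> S \<Longrightarrow> \<bar>F x\<bar> \<le> dual_norm S N F * N x"
  by (rule dual_norm_bound) (auto simp: N_nonneg)

lemma dual_norm_nonneg: "F \<in> dual S N \<Longrightarrow> 0 \<le> dual_norm S N F"
  unfolding dual_norm_def
  by (rule cSUP_upper2[OF dual_norm_bdd, where x=0]) (auto simp: N_nonneg dual_0)

lemma dual_norm_le:
  assumes "0 \<le> C" and "\<And>x. x \<in> S \<Longrightarrow> \<bar>F x\<bar> \<le> C * N x"
  shows "dual_norm S N F \<le> C"
  using assms S_closed(4) by (intro dual_norm_least) (auto simp: N_nonneg)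

lemma dual_combination:
  assumes F: "F \<in> dual S N" and G: "G \<in> dual S N"
  shows "(\<lambda>x. a * F x + b * G x) \<in> dual S N"
proof -
  have "\<bar>a * F x + b * G x\<bar> \<le> (\<bar>a\<bar> * dual_norm S N F + \<bar>b\<bar> * dual_norm S N G) * N x" if "x \<in> S" for x
  proof -
    have "\<bar>a * F x + b * G x\<bar> \<le> \<bar>a\<bar> * \<bar>F x\<bar> + \<bar>b\<bar> * \<bar>G x\<bar>"
      using abs_triangle_ineq[of "a * F x" "b * G x"] by (simp add: abs_mult)
    also have "\<dots> \<le> \<bar>a\<bar> * (dual_norm S N F * N x) + \<bar>b\<bar> * (dual_norm S N G * N x)"
      using bounded_dual[OF F that] bounded_dual[OF G that]
      by (intro add_mono mult_left_mono) auto
    finally show ?thesis by (simp add: algebra_simps)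
  qed
  moreover have "a * F (x + y) + b * G (x + y) = (a * F x + b * G x) + (a * F y + b * G y)"
    if "x \<in> S" "y \<in> S" for x y
    using dualD(1)[OF F that] dualD(1)[OF G that] by (simp add: algebra_simps)
  moreover have "a * F (c *\<^sub>R x) + b * G (c *\<^sub>R x) = c * (a * F x + b * G x)" if "x \<in> S" for c x
    using dualD(2)[OF F that that] dualD(2)[OF G that that] by (simp add: algebra_simps)
  ultimately show ?thesis by (intro dualI)
qed

lemma dual_norm_sq_upper:
  assumes F: "F \<in> dual S N" and x: "x \<in> S"
  shows "2 * F x - (N x)\<^sup>2 \<le> (dual_norm S N F)\<^sup>2"
proof -
  have "2 * F x \<le> 2 * (dual_norm S N F * N x)" using bounded_dual[OF F x] by simp
  also have "\<dots> \<le> (dual_norm S N F)\<^sup>2 + (N x)\<^sup>2"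
    using sum_squares_bound[of "dual_norm S N F" "N x"] by simp
  finally show ?thesis by simp
qed

text \<open>
  Together with the previous lemma this says that the squared dual norm is the supremum of
  \<open>2 F x - (N x)\<^sup>2\<close>. In this form the square of a dual norm is a supremum of functions
  that are affine in \<open>F\<close>, so inequalities between dual norms follow from identities in \<open>S\<close>,
  which may be an incomplete space.
\<close>

lemma dual_norm_sq_approx:
  assumes F: "F \<in> dual S N" and "0 < \<epsilon>"
  obtains x where "x \<in> S" "(dual_norm S N F)\<^sup>2 - \<epsilon> \<le> 2 * F x - (N x)\<^sup>2"
proof (cases "dual_norm S N F = 0")
  case True
  have "N 0 = 0" using N_scale[of 0 0] by simp
  then show ?thesis using that[of 0] True \<open>0 < \<epsilon>\<close> by (simp add: dual_0[OF F])
next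
  case False
  define n where "n = dual_norm S N F"
  have n: "0 < n" using False dual_norm_nonneg[OF F] by (simp add: n_def)
  define \<eta> where "\<eta> = min n (\<epsilon> / (2 * n))"
  have \<eta>: "0 < \<eta>" "\<eta> \<le> n" "2 * n * \<eta> \<le> \<epsilon>"
  proof -
    show "0 < \<eta>" "\<eta> \<le> n" using n \<open>0 < \<epsilon>\<close> by (auto simp: \<eta>_def)
    have "2 * n * \<eta> \<le> 2 * n * (\<epsilon> / (2 * n))" using n by (intro mult_left_mono) (auto simp: \<eta>_def)
    then show "2 * n * \<eta> \<le> \<epsilon>" using n by simp
  qed
  have "n - \<eta> < dual_norm S N F" using \<eta> by (simp add: n_def)
  then obtain x where x: "x \<in> S" "n - \<eta> < \<bar>F x\<bar> / N x"
    unfolding dual_norm_def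
    using S_closed(4) by (subst (asm) less_cSUP_iff[OF _ dual_norm_bdd[OF F N_nonneg]]) auto
  then have ne: "N x \<noteq> 0" using \<eta> by auto
  define c where "c = F x / (N x)\<^sup>2"
  have "(n - \<eta>)\<^sup>2 \<le> (\<bar>F x\<bar> / N x)\<^sup>2" using x \<eta> by (intro power_mono) auto
  moreover have "(\<bar>F x\<bar> / N x)\<^sup>2 = 2 * (c * F x) - c\<^sup>2 * (N x)\<^sup>2"
    using ne by (simp add: c_def power2_eq_square)
  moreover have "n\<^sup>2 - \<epsilon> \<le> (n - \<eta>)\<^sup>2"
    using \<eta>(3) zero_le_power2[of \<eta>] unfolding power2_diff by linarith
  ultimately have "n\<^sup>2 - \<epsilon> \<le> 2 * F (c *\<^sub>R x) - (N (c *\<^sub>R x))\<^sup>2"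
    using x dualD(2)[OF F x(1) x(1)] by (simp add: N_scale power_mult_distrib)
  then show ?thesis using that[of "c *\<^sub>R x"] x by (simp add: n_def)
qed

text \<open>
  For a Hilbert space norm this is Stewart's identity. Only this inequality has to be proved: take
  near-maximizers \<open>x\<close> and \<open>y\<close> for the two functionals on the left. The vectors
  \<open>(x + t y) / (s + t)\<close> and \<open>(x - s y) / (s + t)\<close> then test \<open>F\<close> and \<open>G\<close> on the right,
  and their weighted squared norms add up to those of \<open>x\<close> and \<open>y\<close>.
\<close>

lemma dual_norm_stewart:
  assumes F: "F \<in> dual S N" and G: "G \<in> dual S N" and s: "0 < s" and t: "0 < t"
  shows "(dual_norm S N (\<lambda>x. s * F x + t * G x))\<^sup>2 + s * t * (dual_norm S N (\<lambda>x. F x - G x))\<^sup>2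
     \<le> (s + t) * (s * (dual_norm S N F)\<^sup>2 + t * (dual_norm S N G)\<^sup>2)"
proof (rule field_le_epsilon)
  fix \<epsilon> :: real assume e: "0 < \<epsilon>"
  let ?P = "\<lambda>x. s * F x + t * G x" and ?M = "\<lambda>x. F x - G x"
  have P: "?P \<in> dual S N" by (rule dual_combination[OF F G])
  have M: "?M \<in> dual S N" using dual_combination[OF F G, of 1 "-1"] by simp
  obtain x where x: "x \<in> S" "(dual_norm S N ?P)\<^sup>2 - \<epsilon> / 2 \<le> 2 * ?P x - (N x)\<^sup>2"
    using dual_norm_sq_approx[OF P, of "\<epsilon> / 2"] e by auto
  obtain y where y: "y \<in> S" "(dual_norm S N ?M)\<^sup>2 - \<epsilon> / (2 * s * t) \<le> 2 * ?M y - (N y)\<^sup>2"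
    using dual_norm_sq_approx[OF M, of "\<epsilon> / (2 * s * t)"] e s t by auto
  have y': "s * t * (dual_norm S N ?M)\<^sup>2 - \<epsilon> / 2 \<le> s * t * (2 * ?M y - (N y)\<^sup>2)"
  proof -
    have "s * t * ((dual_norm S N ?M)\<^sup>2 - \<epsilon> / (2 * s * t)) \<le> s * t * (2 * ?M y - (N y)\<^sup>2)"
      using y s t by (intro mult_left_mono) auto
    moreover have "s * t * (\<epsilon> / (2 * s * t)) = \<epsilon> / 2" using s t by simp
    ultimately show ?thesis by (simp only: right_diff_distrib)
  qed
  define a where "a = (1 / (s + t)) *\<^sub>R (x + t *\<^sub>R y)"
  define b where "b = (1 / (s + t)) *\<^sub>R (x + (- s) *\<^sub>R y)"
  have ab: "a \<in> S" "b \<in> S" using x y by (simp_all add: a_def b_def del: scaleR_minus_left)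
  have st: "s + t > 0" using s t by simp
  have xty: "x + t *\<^sub>R y \<in> S" "x + (- s) *\<^sub>R y \<in> S" using x y by (simp_all del: scaleR_minus_left)
  have Fa: "F a = (F x + t * F y) / (s + t)"
    using dualD(2)[OF F xty(1) xty(1)] dual_lin(1)[OF F x(1) y(1)] by (simp add: a_def)
  have Gb: "G b = (G x - s * G y) / (s + t)"
    using dualD(2)[OF G xty(2) xty(2)] dual_lin(1)[OF G x(1) y(1), of "- s"]
    by (simp add: b_def del: scaleR_minus_left)
  have Na: "(N a)\<^sup>2 = ((N x)\<^sup>2 + 2 * t * ip x y + t\<^sup>2 * (N y)\<^sup>2) / (s + t)\<^sup>2"
    using N_sq_combination[OF x(1) y(1), of t] xty st
    by (simp add: a_def N_scale power_divide)
  have Nb: "(N b)\<^sup>2 = ((N x)\<^sup>2 - 2 * s * ip x y + s\<^sup>2 * (N y)\<^sup>2) / (s + t)\<^sup>2"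
    using N_sq_combination[OF x(1) y(1), of "- s"] xty st
    by (simp add: b_def N_scale power_divide del: scaleR_minus_left)
  have A: "(s + t) * (s * (2 * F a) + t * (2 * G b)) = 2 * ?P x + s * t * (2 * ?M y)"
  proof -
    have "(s + t) * F a = F x + t * F y" "(s + t) * G b = G x - s * G y"
      using st by (simp_all add: Fa Gb)
    then have "2 * s * ((s + t) * F a) + 2 * t * ((s + t) * G b)
        = 2 * s * (F x + t * F y) + 2 * t * (G x - s * G y)" by simp
    then show ?thesis by (simp add: algebra_simps)
  qed
  have B: "(s + t) * (s * (N a)\<^sup>2 + t * (N b)\<^sup>2) = (N x)\<^sup>2 + s * t * (N y)\<^sup>2"
  proof -
    have "s * (N a)\<^sup>2 + t * (N b)\<^sup>2 = ((s + t) * ((N x)\<^sup>2 + s * t * (N y)\<^sup>2)) / (s + t)\<^sup>2"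
      unfolding Na Nb by (simp add: add_divide_distrib[symmetric] algebra_simps power2_eq_square)
    then show ?thesis using st by (simp add: power2_eq_square)
  qed
  have "(dual_norm S N ?P)\<^sup>2 + s * t * (dual_norm S N ?M)\<^sup>2 - \<epsilon>
      \<le> 2 * ?P x + s * t * (2 * ?M y) - ((N x)\<^sup>2 + s * t * (N y)\<^sup>2)"
    using x(2) y' by (simp add: algebra_simps)
  also have "\<dots> = (s + t) * (s * (2 * F a - (N a)\<^sup>2) + t * (2 * G b - (N b)\<^sup>2))"
    unfolding A[symmetric] B[symmetric] by (simp add: algebra_simps)
  also have "\<dots> \<le> (s + t) * (s * (dual_norm S N F)\<^sup>2 + t * (dual_norm S N G)\<^sup>2)"
    using dual_norm_sq_upper[OF F ab(1)] dual_norm_sq_upper[OF G ab(2)] s t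
    by (intro mult_left_mono add_mono) auto
  finally show "(dual_norm S N ?P)\<^sup>2 + s * t * (dual_norm S N ?M)\<^sup>2
      \<le> (s + t) * (s * (dual_norm S N F)\<^sup>2 + t * (dual_norm S N G)\<^sup>2) + \<epsilon>" by simp
qed

lemma dual_norm_double:
  assumes F: "F \<in> dual S N"
  shows "2 * dual_norm S N F \<le> dual_norm S N (\<lambda>x. 2 * F x)"
proof -
  have F2: "(\<lambda>x. 2 * F x) \<in> dual S N" using dual_combination[OF F F, of 1 1] by simp
  have "dual_norm S N F \<le> dual_norm S N (\<lambda>x. 2 * F x) / 2"
  proof (rule dual_norm_le)
    show "\<bar>F x\<bar> \<le> dual_norm S N (\<lambda>x. 2 * F x) / 2 * N x" if "x \<in> S" for x
      using bounded_dual[OF F2 that] by simp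
  qed (simp add: dual_norm_nonneg[OF F2])
  then show ?thesis by simp
qed

text \<open>
  The case \<open>s = t = 1\<close> of Stewart's inequality is one half of the parallelogram law. Applied to
  \<open>F + G\<close> and \<open>F - G\<close> it gives this other half.
\<close>

lemma dual_norm_parallelogram:
  assumes F: "F \<in> dual S N" and G: "G \<in> dual S N"
  shows "2 * (dual_norm S N F)\<^sup>2 + 2 * (dual_norm S N G)\<^sup>2
     \<le> (dual_norm S N (\<lambda>x. F x + G x))\<^sup>2 + (dual_norm S N (\<lambda>x. F x - G x))\<^sup>2"
proof -
  let ?P = "\<lambda>x. F x + G x" and ?M = "\<lambda>x. F x - G x"
  have P: "?P \<in> dual S N" using dual_combination[OF F G, of 1 1] by simp
  have M: "?M \<in> dual S N" using dual_combination[OF F G, of 1 "-1"] by simp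
  have "(dual_norm S N (\<lambda>x. 2 * F x))\<^sup>2 + (dual_norm S N (\<lambda>x. 2 * G x))\<^sup>2
     \<le> 2 * ((dual_norm S N ?P)\<^sup>2 + (dual_norm S N ?M)\<^sup>2)"
    using dual_norm_stewart[OF P M, of 1 1] by simp
  moreover have "(2 * dual_norm S N F)\<^sup>2 \<le> (dual_norm S N (\<lambda>x. 2 * F x))\<^sup>2"
    using dual_norm_double[OF F] dual_norm_nonneg[OF F] by (intro power_mono) auto
  moreover have "(2 * dual_norm S N G)\<^sup>2 \<le> (dual_norm S N (\<lambda>x. 2 * G x))\<^sup>2"
    using dual_norm_double[OF G] dual_norm_nonneg[OF G] by (intro power_mono) auto
  ultimately show ?thesis by (simp add: power_mult_distrib)
qed

text \<open>
  In an inner product space \<open>\<bar>b\<bar>\<^sup>2 a + \<bar>a\<bar>\<^sup>2 b\<close> has length \<open>\<bar>a\<bar> \<bar>b\<bar> \<bar>a + b\<bar>\<close>, because after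
  division by \<open>\<bar>a\<bar> \<bar>b\<bar>\<close> it is the sum of two vectors of lengths \<open>\<bar>b\<bar>\<close> and \<open>\<bar>a\<bar>\<close> that enclose the
  same angle as \<open>a\<close> and \<open>b\<close>. For dual norms, Stewart's inequality with the weights
  \<open>b\<^sup>2\<close>, \<open>a\<^sup>2\<close> and the parallelogram law give the inequality that is used below.
\<close>

lemma dual_norm_inversion:
  assumes F: "F \<in> dual S N" and G: "G \<in> dual S N"
  defines "a \<equiv> dual_norm S N F" and "b \<equiv> dual_norm S N G"
  shows "dual_norm S N (\<lambda>x. b\<^sup>2 * F x + a\<^sup>2 * G x) \<le> a * b * dual_norm S N (\<lambda>x. F x + G x)"
proof -
  let ?P = "\<lambda>x. F x + G x" and ?M = "\<lambda>x. F x - G x"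
  have P: "?P \<in> dual S N" using dual_combination[OF F G, of 1 1] by simp
  have ab0: "0 \<le> a" "0 \<le> b" using F G by (simp_all add: a_def b_def dual_norm_nonneg)
  show ?thesis
  proof (cases "a = 0 \<or> b = 0")
    case True
    have "dual_norm S N (\<lambda>x. b\<^sup>2 * F x + a\<^sup>2 * G x) \<le> 0"
    proof (rule dual_norm_le)
      fix x assume x: "x \<in> S"
      from True show "\<bar>b\<^sup>2 * F x + a\<^sup>2 * G x\<bar> \<le> 0 * N x"
      proof
        assume "a = 0"
        then show ?thesis using bounded_dual[OF F x] by (simp add: a_def[symmetric])
      next
        assume "b = 0"
        then show ?thesis using bounded_dual[OF G x] by (simp add: b_def[symmetric])
      qed
    qed simp
    then show ?thesis using True by auto
  next
    case False
    then have ab: "0 < a\<^sup>2" "0 < b\<^sup>2" by simp_all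
    have "(dual_norm S N (\<lambda>x. b\<^sup>2 * F x + a\<^sup>2 * G x))\<^sup>2
        \<le> (b\<^sup>2 + a\<^sup>2) * (b\<^sup>2 * a\<^sup>2 + a\<^sup>2 * b\<^sup>2) - b\<^sup>2 * a\<^sup>2 * (dual_norm S N ?M)\<^sup>2"
      using dual_norm_stewart[OF F G ab(2,1)] by (simp add: a_def b_def)
    also have "\<dots> = b\<^sup>2 * a\<^sup>2 * (2 * a\<^sup>2 + 2 * b\<^sup>2 - (dual_norm S N ?M)\<^sup>2)" by (simp add: algebra_simps)
    also have "\<dots> \<le> b\<^sup>2 * a\<^sup>2 * (dual_norm S N ?P)\<^sup>2"
      using dual_norm_parallelogram[OF F G] by (intro mult_left_mono) (auto simp: a_def b_def)
    also have "\<dots> = (a * b * dual_norm S N ?P)\<^sup>2" by (simp add: power_mult_distrib)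
    finally show ?thesis
      by (rule power2_le_imp_le) (use ab0 dual_norm_nonneg[OF P] in simp)
  qed
qed

text \<open>
  Here \<open>F\<close> stands for a difference of values of the monotone operator, \<open>e\<close> for the difference of
  its arguments and \<open>G\<close> for the time derivative. If \<open>F = B e\<close> with a linear \<open>B\<close>, then
  \<open>e = B\<^sup>-\<^sup>1 (F + G) - B\<^sup>-\<^sup>1 G\<close>, and the claim combines the bound \<open>1 / m\<close> for \<open>B\<^sup>-\<^sup>1\<close> with its
  strong monotonicity, whose constant is \<open>m / L\<^sup>2\<close>. For a nonlinear operator the pair \<open>(e, F)\<close>
  lies in a plane on which such a \<open>B\<close>, a rotation followed by a scaling, exists; the inversion
  inequality evaluated at \<open>e\<close> is the resulting estimate.
\<close>

lemma monotone_residual_pairing: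
  assumes F: "F \<in> dual S N" and G: "G \<in> dual S N" and e: "e \<in> S"
    and m: "0 < m" "m \<le> L"
    and lip: "dual_norm S N F \<le> L * N e" and mono: "m * (N e)\<^sup>2 \<le> F e"
  shows "G e \<le> dual_norm S N G * dual_norm S N (\<lambda>x. F x + G x) / m
            - m / L\<^sup>2 * (dual_norm S N G)\<^sup>2"
proof -
  let ?P = "\<lambda>x. F x + G x"
  define a b p where "a = dual_norm S N F" and "b = dual_norm S N G" and "p = dual_norm S N ?P"
  have P: "?P \<in> dual S N" using dual_combination[OF F G, of 1 1] by simp
  have nn: "0 \<le> a" "0 \<le> b" "0 \<le> p" using F G P by (simp_all add: a_def b_def p_def dual_norm_nonneg)
  have L: "0 < L" using m by simp
  have Ne: "0 \<le> N e" by (rule N_nonneg[OF e])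
  have ma: "m * N e \<le> a"
  proof (cases "N e = 0")
    case False
    have "m * (N e)\<^sup>2 \<le> a * N e" using mono bounded_dual[OF F e] by (simp add: a_def)
    then show ?thesis using False Ne by (simp add: power2_eq_square)
  qed (use nn in simp)
  have "G e \<le> b * p / m - m / L\<^sup>2 * b\<^sup>2"
  proof (cases "N e = 0")
    case True
    then have "a = 0" using lip nn by (simp add: a_def)
    have "G e \<le> 0" using bounded_dual[OF G e] True by simp
    have "b \<le> p" unfolding b_def
    proof (rule dual_norm_le)
      fix x assume x: "x \<in> S"
      have "F x = 0" using bounded_dual[OF F x] \<open>a = 0\<close> by (simp add: a_def)
      then show "\<bar>G x\<bar> \<le> p * N x" using bounded_dual[OF P x] by (simp add: p_def)
    qed (rule nn)
    have "m / L\<^sup>2 \<le> m / m\<^sup>2" using m by (intro divide_left_mono power_mono) auto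
    then have "m / L\<^sup>2 \<le> 1 / m" using m by (simp add: power2_eq_square)
    then have "m / L\<^sup>2 * b\<^sup>2 \<le> 1 / m * b\<^sup>2" by (intro mult_right_mono) auto
    also have "\<dots> \<le> b * p / m"
      using mult_left_mono[OF \<open>b \<le> p\<close> nn(2)] m by (simp add: power2_eq_square divide_right_mono)
    finally show ?thesis using \<open>G e \<le> 0\<close> by simp
  next
    case False
    then have Ne: "0 < N e" using Ne by simp
    have a: "0 < a" using ma m Ne by (meson mult_pos_pos order_less_le_trans)
    have Q: "(\<lambda>x. b\<^sup>2 * F x + a\<^sup>2 * G x) \<in> dual S N" by (rule dual_combination[OF F G])
    \<comment> \<open>The inversion inequality bounds this functional by \<open>a b p\<close>; solve for \<open>G e\<close> afterwards.\<close>
    have "b\<^sup>2 * F e + a\<^sup>2 * G e \<le> a * b * p * N e"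
    proof -
      have "b\<^sup>2 * F e + a\<^sup>2 * G e \<le> dual_norm S N (\<lambda>x. b\<^sup>2 * F x + a\<^sup>2 * G x) * N e"
        using bounded_dual[OF Q e] by simp
      also have "\<dots> \<le> a * b * p * N e"
        using dual_norm_inversion[OF F G] Ne by (intro mult_right_mono) (auto simp: a_def b_def p_def)
      finally show ?thesis .
    qed
    moreover have "b\<^sup>2 * (m * (N e)\<^sup>2) \<le> b\<^sup>2 * F e" using mono by (intro mult_left_mono) auto
    ultimately have "a\<^sup>2 * G e \<le> a * b * p * N e - b\<^sup>2 * (m * (N e)\<^sup>2)" by simp
    then have "G e \<le> (a * b * p * N e - b\<^sup>2 * (m * (N e)\<^sup>2)) / a\<^sup>2"
      using a by (simp add: pos_le_divide_eq mult.commute)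
    also have "\<dots> = b * p * (N e / a) - m * b\<^sup>2 * (N e / a)\<^sup>2"
    proof -
      have "a * b * p * N e / a\<^sup>2 = b * p * (N e / a)" using a by (simp add: power2_eq_square)
      then show ?thesis by (simp add: diff_divide_distrib power_divide)
    qed
    also have "\<dots> \<le> b * p * (1 / m) - m * b\<^sup>2 * (1 / L)\<^sup>2"
    proof (intro diff_mono mult_left_mono power_mono)
      show "N e / a \<le> 1 / m" using ma a m by (simp add: divide_simps mult.commute)
      show "1 / L \<le> N e / a" using lip a L by (simp add: divide_simps mult.commute a_def)
    qed (use nn m L in auto)
    finally show ?thesis by (simp add: power_divide)
  qed
  then show ?thesis by (simp add: a_def b_def p_def)
qed

end

section \<open>Square integrable functions with values in normed spaces\<close>

lemma strongly_measurable_compose2: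
  fixes f :: "'a \<Rightarrow> 'b::t2_space" and g :: "'a \<Rightarrow> 'c::t2_space"
    and h :: "'b \<Rightarrow> 'c \<Rightarrow> 'd::topological_space"
  assumes f: "strongly_measurable M f" and g: "strongly_measurable M g"
    and h: "\<And>x y. isCont (\<lambda>p. h (fst p) (snd p)) (x, y)"
  shows "strongly_measurable M (\<lambda>t. h (f t) (g t))"
proof -
  obtain r where r: "\<And>i::nat. simple_function M (r i)" "AE t in M. (\<lambda>i. r i t) \<longlonglongrightarrow> f t"
    using f by (auto simp: strongly_measurable_def)
  obtain s where s: "\<And>i::nat. simple_function M (s i)" "AE t in M. (\<lambda>i. s i t) \<longlonglongrightarrow> g t"
    using g by (auto simp: strongly_measurable_def)
  have "AE t in M. (\<lambda>i. h (r i t) (s i t)) \<longlonglongrightarrow> h (f t) (g t)"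
    using r(2) s(2)
  proof eventually_elim
    fix t assume "(\<lambda>i. r i t) \<longlonglongrightarrow> f t" "(\<lambda>i. s i t) \<longlonglongrightarrow> g t"
    then have "(\<lambda>i. (r i t, s i t)) \<longlonglongrightarrow> (f t, g t)" by (rule tendsto_Pair)
    from isCont_tendsto_compose[OF h this]
    show "(\<lambda>i. h (r i t) (s i t)) \<longlonglongrightarrow> h (f t) (g t)" by simp
  qed
  moreover have "simple_function M (\<lambda>t. h (r i t) (s i t))" for i
    using r(1) s(1) by (rule simple_function_compose2)
  ultimately show ?thesis unfolding strongly_measurable_def
    by (intro exI[of _ "\<lambda>i t. h (r i t) (s i t)"]) auto
qed

lemma strongly_measurable_compose:
  fixes f :: "'a \<Rightarrow> 'b::t2_space" and h :: "'b \<Rightarrow> 'd::topological_space"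
  assumes "strongly_measurable M f" "\<And>x. isCont h x"
  shows "strongly_measurable M (\<lambda>t. h (f t))"
proof -
  have "isCont (\<lambda>p. h (fst p)) (x, y)" for x y :: 'b
    by (rule isCont_o2[of _ fst h]) (use assms(2) in \<open>auto intro!: continuous_intros\<close>)
  from strongly_measurable_compose2[OF assms(1,1) this] show ?thesis .
qed

lemma strongly_measurable_simple: "simple_function M f \<Longrightarrow> strongly_measurable M f"
  unfolding strongly_measurable_def by (intro exI[of _ "\<lambda>i. f"]) auto

text \<open>
  The simple functions converge only almost everywhere; completeness of Lebesgue measure makes the
  limit measurable all the same.
\<close>

lemma borel_measurable_strongly_measurable:
  fixes f :: "real \<Rightarrow> real"
  assumes "strongly_measurable (Xi T) f"
  shows "f \<in> borel_measurable (Xi T)"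
proof -
  obtain s where s: "\<And>i::nat. simple_function (Xi T) (s i)" "AE t in Xi T. (\<lambda>i. s i t) \<longlonglongrightarrow> f t"
    using assms by (auto simp: strongly_measurable_def)
  let ?S = "{0<..<T}"
  define F where "F i t = (if t \<in> ?S then s i t else 0)" for i t
  have F: "F i \<in> borel_measurable lebesgue" for i
    unfolding F_def using borel_measurable_simple_function[OF s(1)[of i]]
    by (subst borel_measurable_if) auto
  then have L: "(\<lambda>t. lim (\<lambda>i. F i t)) \<in> borel_measurable lebesgue"
    by (rule borel_measurable_lim_metric)
  have "AE t in lebesgue. t \<in> ?S \<longrightarrow> (\<lambda>i. s i t) \<longlonglongrightarrow> f t"
    using s(2) by (subst (asm) AE_restrict_space_iff) auto
  then have "AE t in lebesgue. lim (\<lambda>i. F i t) = (if t \<in> ?S then f t else 0)"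
    by eventually_elim (auto simp: F_def intro: limI)
  then have "(\<lambda>t. if t \<in> ?S then f t else 0) \<in> borel_measurable lebesgue"
    by (rule borel_measurable_AE[OF L])
  then show ?thesis by (subst (asm) borel_measurable_if) auto
qed

text \<open>
  The grid functions \<open>c (\<lfloor>i t\<rfloor> / i)\<close> take finitely many values on a bounded interval and converge
  pointwise to \<open>c\<close>.
\<close>

lemma strongly_measurable_continuous:
  fixes c :: "real \<Rightarrow> 'b::topological_space"
  assumes c: "continuous_on UNIV c"
  shows "strongly_measurable (Xi T) c"
  unfolding strongly_measurable_def
proof (intro exI conjI allI)
  fix i :: nat
  let ?r = "\<lambda>t::real. \<lfloor>real (Suc i) * t\<rfloor>"
  let ?g = "\<lambda>t::real. c (of_int (?r t) / real (Suc i))"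
  have sub: "?r ` {0<..<T} \<subseteq> {0..\<lceil>real (Suc i) * T\<rceil>}"
  proof (rule image_subsetI)
    fix t assume t: "t \<in> {0<..<T}"
    then have "real (Suc i) * t \<le> real (Suc i) * T" by (intro mult_left_mono) auto
    then have "\<lfloor>real (Suc i) * t\<rfloor> \<le> \<lfloor>real (Suc i) * T\<rfloor>" by (rule floor_mono)
    also have "\<dots> \<le> \<lceil>real (Suc i) * T\<rceil>" by (rule floor_le_ceiling)
    finally have "\<lfloor>real (Suc i) * t\<rfloor> \<le> \<lceil>real (Suc i) * T\<rceil>" .
    moreover have "0 \<le> real (Suc i) * t" using t by (intro mult_nonneg_nonneg) auto
    ultimately show "\<lfloor>real (Suc i) * t\<rfloor> \<in> {0..\<lceil>real (Suc i) * T\<rceil>}"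
      by (simp only: atLeastAtMost_iff zero_le_floor)
  qed
  then have fin: "finite (?r ` {0<..<T})" by (rule finite_subset) simp
  have m: "?r \<in> measurable (Xi T) (count_space UNIV)"
  proof -
    have "?r \<in> measurable borel (count_space UNIV)" by measurable
    then have "?r \<in> measurable lebesgue (count_space UNIV)" by (intro measurable_completion) simp
    then show ?thesis by (rule measurable_restrict_space1)
  qed
  have "simple_function (Xi T) ?r"
    unfolding simple_function_def
    using fin measurable_sets[OF m] by auto
  then show "simple_function (Xi T) ?g"
    by (rule simple_function_compose1[where g="\<lambda>k. c (of_int k / real (Suc i))"])
next
  show "AE t in Xi T. (\<lambda>i. c (of_int \<lfloor>real (Suc i) * t\<rfloor> / real (Suc i))) \<longlonglongrightarrow> c t"
  proof (intro AE_I2)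
    fix t :: real
    have "(\<lambda>i. of_int \<lfloor>real (Suc i) * t\<rfloor> / real (Suc i)) \<longlonglongrightarrow> t"
    proof (rule tendsto_sandwich[OF _ _ _ tendsto_const])
      show "\<forall>\<^sub>F i in sequentially. t - 1 / real (Suc i) \<le> of_int \<lfloor>real (Suc i) * t\<rfloor> / real (Suc i)"
      proof (intro always_eventually allI)
        fix i :: nat
        have "real (Suc i) * t - 1 \<le> of_int \<lfloor>real (Suc i) * t\<rfloor>" by linarith
        then have "(real (Suc i) * t - 1) / real (Suc i) \<le> of_int \<lfloor>real (Suc i) * t\<rfloor> / real (Suc i)"
          by (rule divide_right_mono) simp
        then show "t - 1 / real (Suc i) \<le> of_int \<lfloor>real (Suc i) * t\<rfloor> / real (Suc i)"
          by (simp add: diff_divide_distrib del: of_nat_Suc)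
      qed
      show "\<forall>\<^sub>F i in sequentially. of_int \<lfloor>real (Suc i) * t\<rfloor> / real (Suc i) \<le> t"
      proof (intro always_eventually allI)
        fix i :: nat
        have "of_int \<lfloor>real (Suc i) * t\<rfloor> / real (Suc i) \<le> (real (Suc i) * t) / real (Suc i)"
          by (rule divide_right_mono) simp_all
        then show "of_int \<lfloor>real (Suc i) * t\<rfloor> / real (Suc i) \<le> t" by (simp del: of_nat_Suc)
      qed
      have "(\<lambda>i. t - 1 / real (Suc i)) \<longlonglongrightarrow> t - 0"
        using LIMSEQ_inverse_real_of_nat by (intro tendsto_intros) (simp add: inverse_eq_divide)
      then show "(\<lambda>i. t - 1 / real (Suc i)) \<longlonglongrightarrow> t" by simp
    qed
    then show "(\<lambda>i. c (of_int \<lfloor>real (Suc i) * t\<rfloor> / real (Suc i))) \<longlonglongrightarrow> c t"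
      using c by (intro isCont_tendsto_compose[of _ c]) (auto simp: continuous_on_eq_continuous_at)
  qed
qed

lemma finite_measure_Xi [simp]: "finite_measure (Xi T)"
  by (rule finite_measureI)
     (cases "0 \<le> T", auto simp: emeasure_restrict_space space_restrict_space)

lemma integrable_const_Xi [simp]: "integrable (Xi T) (\<lambda>t. c::real)"
  by (rule finite_measure.integrable_const) simp

lemma borel_measurable_norm_sm:
  fixes f :: "real \<Rightarrow> 'b::real_normed_vector"
  assumes "strongly_measurable (Xi T) f"
  shows "(\<lambda>t. norm (f t)) \<in> borel_measurable (Xi T)"
  by (intro borel_measurable_strongly_measurable strongly_measurable_compose[OF assms])
     (intro continuous_intros)

lemma L2I:
  fixes w :: "real \<Rightarrow> 'b::real_normed_vector"
  assumes w: "strongly_measurable (Xi T) w" and h: "integrable (Xi T) h"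
    and le: "AE t in Xi T. (norm (w t))\<^sup>2 \<le> h t"
  shows "w \<in> L2 T"
  unfolding L2_def
proof (intro CollectI conjI w)
  show "integrable (Xi T) (\<lambda>t. (norm (w t))\<^sup>2)"
  proof (rule Bochner_Integration.integrable_bound[OF h])
    show "(\<lambda>t. (norm (w t))\<^sup>2) \<in> borel_measurable (Xi T)"
      using borel_measurable_norm_sm[OF w] by measurable
    show "AE t in Xi T. norm ((norm (w t))\<^sup>2) \<le> norm (h t)"
      using le by eventually_elim simp
  qed
qed

lemma L2D:
  assumes "w \<in> L2 T"
  shows "strongly_measurable (Xi T) w" "integrable (Xi T) (\<lambda>t. (norm (w t))\<^sup>2)"
    "(\<lambda>t. norm (w t)) \<in> borel_measurable (Xi T)"
  using assms by (auto simp: L2_def intro: borel_measurable_norm_sm)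

lemma L2_continuous:
  fixes c :: "real \<Rightarrow> 'b::real_normed_vector"
  assumes c: "continuous_on UNIV c"
  shows "c \<in> L2 T"
proof -
  have "compact (c ` {0..T})"
    by (rule compact_continuous_image[OF continuous_on_subset[OF c]]) auto
  then have "bounded (c ` {0..T})" by (rule compact_imp_bounded)
  then obtain B where "\<forall>x\<in>c ` {0..T}. norm x \<le> B" unfolding bounded_iff ..
  then have B: "norm (c t) \<le> B" if "t \<in> {0..T}" for t using that by simp
  show ?thesis
  proof (rule L2I[OF strongly_measurable_continuous[OF c] integrable_const_Xi[of T "B\<^sup>2"]])
    show "AE t in Xi T. (norm (c t))\<^sup>2 \<le> B\<^sup>2"
      by (intro AE_I2) (auto intro!: power_mono B)
  qed
qed

lemma two_square_bound: "(a + b)\<^sup>2 \<le> 2 * a\<^sup>2 + 2 * (b\<^sup>2 :: real)"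
  using zero_le_power2[of "a - b"] by (simp add: power2_eq_square algebra_simps)

lemma L2_add:
  fixes w v :: "real \<Rightarrow> 'b::real_normed_vector"
  assumes w: "w \<in> L2 T" and v: "v \<in> L2 T"
  shows "w + v \<in> L2 T"
proof (rule L2I)
  show "strongly_measurable (Xi T) (w + v)" unfolding plus_fun_def
    by (intro strongly_measurable_compose2[OF L2D(1)[OF w] L2D(1)[OF v]] continuous_intros)
  show "integrable (Xi T) (\<lambda>t. 2 * (norm (w t))\<^sup>2 + 2 * (norm (v t))\<^sup>2)"
    using L2D(2)[OF w] L2D(2)[OF v] by simp
  show "AE t in Xi T. (norm ((w + v) t))\<^sup>2 \<le> 2 * (norm (w t))\<^sup>2 + 2 * (norm (v t))\<^sup>2"
  proof (intro AE_I2)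
    fix t
    have "(norm ((w + v) t))\<^sup>2 \<le> (norm (w t) + norm (v t))\<^sup>2"
      by (intro power_mono) (simp_all add: norm_triangle_ineq)
    also have "\<dots> \<le> 2 * (norm (w t))\<^sup>2 + 2 * (norm (v t))\<^sup>2" by (rule two_square_bound)
    finally show "(norm ((w + v) t))\<^sup>2 \<le> 2 * (norm (w t))\<^sup>2 + 2 * (norm (v t))\<^sup>2" .
  qed
qed

lemma L2_linear:
  assumes w: "w \<in> L2 T" and f: "bounded_linear f"
  shows "(\<lambda>t. f (w t)) \<in> L2 T"
proof -
  interpret bounded_linear f by (rule f)
  obtain K where K: "\<And>x. norm (f x) \<le> norm x * K" using nonneg_bounded by blast
  show ?thesis
  proof (rule L2I)
    show "strongly_measurable (Xi T) (\<lambda>t. f (w t))"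
      by (rule strongly_measurable_compose[OF L2D(1)[OF w] linear_continuous_at[OF f]])
    show "integrable (Xi T) (\<lambda>t. K\<^sup>2 * (norm (w t))\<^sup>2)" using L2D(2)[OF w] by simp
    show "AE t in Xi T. (norm (f (w t)))\<^sup>2 \<le> K\<^sup>2 * (norm (w t))\<^sup>2"
    proof (intro AE_I2)
      fix t
      have "(norm (f (w t)))\<^sup>2 \<le> (norm (w t) * K)\<^sup>2" using K by (intro power_mono) auto
      then show "(norm (f (w t)))\<^sup>2 \<le> K\<^sup>2 * (norm (w t))\<^sup>2" by (simp add: power_mult_distrib mult.commute)
    qed
  qed
qed

lemma subspace_L2: "subspace (L2 T :: (real \<Rightarrow> 'b::real_normed_vector) set)"
proof (rule subspaceI)
  show "(0 :: real \<Rightarrow> 'b) \<in> L2 T" unfolding zero_fun_def by (intro L2_continuous continuous_intros)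
  show "c *\<^sub>R w \<in> L2 T" if "w \<in> L2 T" for c and w :: "real \<Rightarrow> 'b"
    unfolding scaleR_fun_def by (rule L2_linear[OF that bounded_linear_scaleR_right])
qed (rule L2_add)

lemma L2_bilinear_integrable:
  assumes B: "bounded_bilinear (B :: 'b::real_normed_vector \<Rightarrow> 'c::real_normed_vector \<Rightarrow> real)"
    and w: "w \<in> L2 T" and v: "v \<in> L2 T"
  shows "integrable (Xi T) (\<lambda>t. B (w t) (v t))"
proof -
  interpret bounded_bilinear B by (rule B)
  obtain K where K: "\<And>x y. norm (B x y) \<le> norm x * norm y * K" "0 \<le> K" using nonneg_bounded by blast
  show ?thesis
  proof (rule Bochner_Integration.integrable_bound)
    show "integrable (Xi T) (\<lambda>t. ((norm (w t))\<^sup>2 + (norm (v t))\<^sup>2) * K)"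
      using L2D(2)[OF w] L2D(2)[OF v] by simp
    show "(\<lambda>t. B (w t) (v t)) \<in> borel_measurable (Xi T)"
    proof (rule borel_measurable_strongly_measurable,
        rule strongly_measurable_compose2[OF L2D(1)[OF w] L2D(1)[OF v]])
      fix x y show "isCont (\<lambda>p. B (fst p) (snd p)) (x, y)"
        unfolding isCont_def by (rule tendsto) (intro tendsto_intros)+
    qed
    show "AE t in Xi T. norm (B (w t) (v t)) \<le> norm (((norm (w t))\<^sup>2 + (norm (v t))\<^sup>2) * K)"
    proof (intro AE_I2)
      fix t
      have "2 * (norm (w t) * norm (v t)) \<le> (norm (w t))\<^sup>2 + (norm (v t))\<^sup>2"
        using sum_squares_bound[of "norm (w t)" "norm (v t)"] by simp
      then have "norm (w t) * norm (v t) \<le> (norm (w t))\<^sup>2 + (norm (v t))\<^sup>2"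
        using mult_nonneg_nonneg[OF norm_ge_zero norm_ge_zero, of "w t" "v t"] by linarith
      then have "norm (w t) * norm (v t) * K \<le> ((norm (w t))\<^sup>2 + (norm (v t))\<^sup>2) * K"
        using K(2) by (rule mult_right_mono)
      then show "norm (B (w t) (v t)) \<le> norm (((norm (w t))\<^sup>2 + (norm (v t))\<^sup>2) * K)"
        using K(1)[of "w t" "v t"] K(2) by simp
    qed
  qed
qed

definition L2_ip :: "real \<Rightarrow> (real \<Rightarrow> 'b::real_inner) \<Rightarrow> (real \<Rightarrow> 'b) \<Rightarrow> real" where
  "L2_ip T w v = (\<integral>t. w t \<bullet> v t \<partial>Xi T)"

lemma L2_inner_integrable:
  fixes w v :: "real \<Rightarrow> 'b::real_inner"
  shows "w \<in> L2 T \<Longrightarrow> v \<in> L2 T \<Longrightarrow> integrable (Xi T) (\<lambda>t. w t \<bullet> v t)"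
  by (rule L2_bilinear_integrable[OF bounded_bilinear_inner])

lemma semi_inner_L2:
  "semi_inner_space (L2 T :: (real \<Rightarrow> 'b::real_inner) set) (L2_ip T)"
proof
  fix x y z :: "real \<Rightarrow> 'b" and c :: real
  show "subspace (L2 T :: (real \<Rightarrow> 'b) set)" by (rule subspace_L2)
  show "L2_ip T x y = L2_ip T y x" by (simp add: L2_ip_def inner_commute)
  show "L2_ip T (c *\<^sub>R x) y = c * L2_ip T x y" by (simp add: L2_ip_def scaleR_fun_def)
  show "0 \<le> L2_ip T x x" unfolding L2_ip_def by (intro integral_nonneg_AE) simp
  assume x: "x \<in> L2 T" and y: "y \<in> L2 T" and z: "z \<in> L2 T"
  show "L2_ip T (x + y) z = L2_ip T x z + L2_ip T y z"
    using L2_inner_integrable[OF x z] L2_inner_integrable[OF y z]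
    by (simp add: L2_ip_def inner_add_left)
qed

lemma L2_norm_eq: "semi_inner_space.N (L2_ip T) = L2_norm T"
  by (rule ext) (simp add: semi_inner_space.N_def[OF semi_inner_L2] L2_norm_def L2_ip_def power2_norm_eq_inner)

interpretation L2: semi_inner_space "L2 T" "L2_ip T"
  rewrites "semi_inner_space.N (L2_ip T) = L2_norm T"
  for T
  by (rule semi_inner_L2, rule L2_norm_eq)

lemma L2_norm_norm: "L2_norm T (\<lambda>t. norm (w t)) = L2_norm T w"
  by (simp add: L2_norm_def)

lemma L2_norm_real: "w \<in> L2 T \<Longrightarrow> (\<lambda>t. norm (w t)) \<in> L2 T"
proof (rule L2I)
  assume w: "w \<in> L2 T"
  show "strongly_measurable (Xi T) (\<lambda>t. norm (w t))"
    by (rule strongly_measurable_compose[OF L2D(1)[OF w]]) (intro continuous_intros)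
  show "integrable (Xi T) (\<lambda>t. (norm (w t))\<^sup>2)" by (rule L2D(2)[OF w])
qed simp

lemma L2_norm_nonneg [simp]: "0 \<le> L2_norm T w"
  by (simp add: L2_norm_def)

lemma L2_norm_sq: "(L2_norm T w)\<^sup>2 = (\<integral>t. (norm (w t))\<^sup>2 \<partial>Xi T)"
  by (simp add: L2_norm_def)

lemma L2_bilinear_bound:
  assumes B: "bounded_bilinear (B :: 'b::real_normed_vector \<Rightarrow> 'c::real_normed_vector \<Rightarrow> real)"
    and K: "\<And>x y. \<bar>B x y\<bar> \<le> K * (norm x * norm y)" "0 \<le> K"
    and w: "w \<in> L2 T" and v: "v \<in> L2 T"
  shows "\<bar>\<integral>t. B (w t) (v t) \<partial>Xi T\<bar> \<le> K * (L2_norm T w * L2_norm T v)"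
proof -
  let ?w = "\<lambda>t. norm (w t)" and ?v = "\<lambda>t. norm (v t)"
  have i: "integrable (Xi T) (\<lambda>t. norm (w t) * norm (v t))"
    using L2_inner_integrable[OF L2_norm_real[OF w] L2_norm_real[OF v]] by simp
  have "\<bar>\<integral>t. B (w t) (v t) \<partial>Xi T\<bar> \<le> (\<integral>t. \<bar>B (w t) (v t)\<bar> \<partial>Xi T)"
    using integral_norm_bound[of "Xi T" "\<lambda>t. B (w t) (v t)"] by simp
  also have "\<dots> \<le> (\<integral>t. K * (norm (w t) * norm (v t)) \<partial>Xi T)"
    by (rule integral_mono) (use L2_bilinear_integrable[OF B w v] i K in auto)
  also have "\<dots> = K * L2_ip T ?w ?v" by (simp add: L2_ip_def)
  also have "\<dots> \<le> K * (L2_norm T w * L2_norm T v)"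
    using L2.cauchy_schwarz[OF L2_norm_real[OF w] L2_norm_real[OF v]] K(2)
    by (intro mult_left_mono) (auto simp: L2_norm_norm)
  finally show ?thesis .
qed

lemma L2_norm_linear_le:
  assumes w: "w \<in> L2 T" and f: "bounded_linear f" and K: "\<And>x. norm (f x) \<le> K * norm x" "0 \<le> K"
  shows "L2_norm T (\<lambda>t. f (w t)) \<le> K * L2_norm T w"
proof (rule power2_le_imp_le)
  have "(\<integral>t. (norm (f (w t)))\<^sup>2 \<partial>Xi T) \<le> (\<integral>t. K\<^sup>2 * (norm (w t))\<^sup>2 \<partial>Xi T)"
    using L2D(2)[OF L2_linear[OF w f]] L2D(2)[OF w]
  proof (intro integral_mono)
    fix t
    have "(norm (f (w t)))\<^sup>2 \<le> (K * norm (w t))\<^sup>2" by (intro power_mono K) simp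
    then show "(norm (f (w t)))\<^sup>2 \<le> K\<^sup>2 * (norm (w t))\<^sup>2" by (simp add: power_mult_distrib)
  qed simp_all
  then show "(L2_norm T (\<lambda>t. f (w t)))\<^sup>2 \<le> (K * L2_norm T w)\<^sup>2"
    by (simp add: power_mult_distrib L2_norm_sq)
qed (use K in simp)

lemma L2_norm_triangle:
  fixes w v :: "real \<Rightarrow> 'b::real_normed_vector"
  assumes w: "w \<in> L2 T" and v: "v \<in> L2 T"
  shows "L2_norm T (w + v) \<le> L2_norm T w + L2_norm T v"
proof -
  let ?w = "\<lambda>t. norm (w t)" and ?v = "\<lambda>t. norm (v t)"
  note wv = L2_norm_real[OF w] L2_norm_real[OF v]
  have "L2_norm T (w + v) \<le> L2_norm T (?w + ?v)"
    unfolding L2_norm_def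
    using L2D(2)[OF L2_add[OF w v]] L2D(2)[OF L2_add[OF wv]]
    by (intro real_sqrt_le_mono integral_mono)
       (auto intro!: power_mono norm_triangle_ineq)
  also have "\<dots> \<le> L2_norm T w + L2_norm T v"
    using L2.N_triangle[OF wv] by (simp add: L2_norm_norm)
  finally show ?thesis .
qed

lemma L2_norm_scale: "L2_norm T (c *\<^sub>R w) = \<bar>c\<bar> * L2_norm T w"
  by (simp add: L2_norm_def scaleR_fun_def power_mult_distrib real_sqrt_mult)

lemma L2_norm_eq_0_AE:
  assumes w: "w \<in> L2 T" and "L2_norm T w = 0"
  shows "AE t in Xi T. w t = 0"
proof -
  have "(\<integral>t. (norm (w t))\<^sup>2 \<partial>Xi T) = 0" using assms(2) by (simp add: L2_norm_def)
  then have "AE t in Xi T. (norm (w t))\<^sup>2 = 0"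
    by (subst (asm) integral_nonneg_eq_0_iff_AE[OF L2D(2)[OF w]]) auto
  then show ?thesis by eventually_elim simp
qed

lemma L2_dominated_convergence:
  fixes s :: "nat \<Rightarrow> real \<Rightarrow> 'b::real_normed_vector"
  assumes w: "w \<in> L2 T" and s: "\<And>n. s n \<in> L2 T" and h: "integrable (Xi T) h"
    and lim: "AE t in Xi T. (\<lambda>n. s n t) \<longlonglongrightarrow> w t"
    and le: "\<And>n. AE t in Xi T. (norm (s n t))\<^sup>2 \<le> h t"
  shows "(\<lambda>n. L2_norm T (w - s n)) \<longlonglongrightarrow> 0"
proof -
  have ws: "w - s n \<in> L2 T" for n using subspace_diff[OF subspace_L2 w s] .
  have "(\<lambda>n. \<integral>t. (norm (w t - s n t))\<^sup>2 \<partial>Xi T) \<longlonglongrightarrow> (\<integral>t. 0 \<partial>Xi T)"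
  proof (rule integral_dominated_convergence)
    show "(\<lambda>t. (norm (w t - s n t))\<^sup>2) \<in> borel_measurable (Xi T)" for n
      using borel_measurable_integrable[OF L2D(2)[OF ws[of n]]] by simp
    show "integrable (Xi T) (\<lambda>t. 2 * (norm (w t))\<^sup>2 + 2 * h t)" using L2D(2)[OF w] h by simp
    show "AE t in Xi T. (\<lambda>n. (norm (w t - s n t))\<^sup>2) \<longlonglongrightarrow> 0"
      using lim
    proof eventually_elim
      fix t assume "(\<lambda>n. s n t) \<longlonglongrightarrow> w t"
      then have "(\<lambda>n. (norm (w t - s n t))\<^sup>2) \<longlonglongrightarrow> (norm (w t - w t))\<^sup>2" by (intro tendsto_intros)
      then show "(\<lambda>n. (norm (w t - s n t))\<^sup>2) \<longlonglongrightarrow> 0" by simp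
    qed
    show "AE t in Xi T. norm ((norm (w t - s n t))\<^sup>2) \<le> 2 * (norm (w t))\<^sup>2 + 2 * h t" for n
      using le[of n]
    proof eventually_elim
      fix t assume "(norm (s n t))\<^sup>2 \<le> h t"
      moreover have "(norm (w t - s n t))\<^sup>2 \<le> (norm (w t) + norm (s n t))\<^sup>2"
        by (intro power_mono norm_triangle_ineq4) simp
      ultimately have "(norm (w t - s n t))\<^sup>2 \<le> 2 * (norm (w t))\<^sup>2 + 2 * h t"
        using two_square_bound[of "norm (w t)" "norm (s n t)"] by linarith
      then show "norm ((norm (w t - s n t))\<^sup>2) \<le> 2 * (norm (w t))\<^sup>2 + 2 * h t" by simp
    qed
  qed simp
  then have "(\<lambda>n. sqrt (\<integral>t. (norm (w t - s n t))\<^sup>2 \<partial>Xi T)) \<longlonglongrightarrow> sqrt 0"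
    by (intro tendsto_real_sqrt) simp
  then show ?thesis by (simp add: L2_norm_def)
qed

section \<open>Density of smooth functions vanishing at both end points\<close>

text \<open>
  Continuously differentiable functions are defined on the whole line and carry their derivative, so
  that they can be tested, differentiated and integrated without choosing one-sided derivatives at
  the end points.
\<close>

definition C1_pair :: "(real \<Rightarrow> 'b::real_normed_vector) \<Rightarrow> (real \<Rightarrow> 'b) \<Rightarrow> bool" where
  "C1_pair z z' \<longleftrightarrow> (\<forall>t. (z has_vector_derivative z' t) (at t)) \<and> continuous_on UNIV z'"

lemma C1_pairD:
  assumes "C1_pair z z'"
  shows "(z has_vector_derivative z' t) (at t)" "continuous_on UNIV z'" "continuous_on UNIV z"
    "z \<in> L2 T" "z' \<in> L2 T"
proof -
  show d: "(z has_vector_derivative z' t) (at t)" for t using assms by (auto simp: C1_pair_def)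
  show z': "continuous_on UNIV z'" using assms by (auto simp: C1_pair_def)
  show z: "continuous_on UNIV z"
    using has_vector_derivative_continuous[OF d] by (auto simp: continuous_on_eq_continuous_at)
  show "z \<in> L2 T" "z' \<in> L2 T" using z z' by (auto intro: L2_continuous)
qed

lemma C1_pair_real:
  fixes y :: "real \<Rightarrow> real"
  shows "C1_pair y y' \<longleftrightarrow> (\<forall>t. (y has_real_derivative y' t) (at t)) \<and> continuous_on UNIV y'"
  by (simp add: C1_pair_def has_real_derivative_iff_has_vector_derivative)

lemma C1_pair_bilinear:
  assumes B: "bounded_bilinear B" and z: "C1_pair z z'" and w: "C1_pair w w'"
  shows "C1_pair (\<lambda>t. B (z t) (w t)) (\<lambda>t. B (z t) (w' t) + B (z' t) (w t))"
  unfolding C1_pair_def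
proof (intro conjI allI)
  interpret bounded_bilinear B by (rule B)
  show "((\<lambda>t. B (z t) (w t)) has_vector_derivative B (z t) (w' t) + B (z' t) (w t)) (at t)" for t
    by (rule has_vector_derivative[OF C1_pairD(1)[OF z] C1_pairD(1)[OF w]])
  show "continuous_on UNIV (\<lambda>t. B (z t) (w' t) + B (z' t) (w t))"
    by (intro continuous_on_add continuous_on C1_pairD(2,3)[OF z] C1_pairD(2,3)[OF w])
qed

lemma C1_pair_linear:
  assumes "bounded_linear f" and z: "C1_pair z z'"
  shows "C1_pair (\<lambda>t. f (z t)) (\<lambda>t. f (z' t))"
  unfolding C1_pair_def
proof (intro conjI allI)
  show "((\<lambda>t. f (z t)) has_vector_derivative f (z' t)) (at t)" for t
    by (rule bounded_linear.has_vector_derivative[OF assms(1) C1_pairD(1)[OF z]])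
  show "continuous_on UNIV (\<lambda>t. f (z' t))"
    by (rule bounded_linear.continuous_on[OF assms(1) C1_pairD(2)[OF z]])
qed

lemma C1_pair_const: "C1_pair (\<lambda>t. c) (\<lambda>t. 0)"
  by (simp add: C1_pair_def)

lemma C1_pair_add: "C1_pair z z' \<Longrightarrow> C1_pair w w' \<Longrightarrow> C1_pair (z + w) (z' + w')"
  unfolding C1_pair_def plus_fun_def by (auto intro!: derivative_intros continuous_intros)

lemma C1_pair_scale: "C1_pair z z' \<Longrightarrow> C1_pair (c *\<^sub>R z) (c *\<^sub>R z')"
  unfolding scaleR_fun_def by (rule C1_pair_linear[OF bounded_linear_scaleR_right])

lemma C1_pair_diff: "C1_pair z z' \<Longrightarrow> C1_pair w w' \<Longrightarrow> C1_pair (z - w) (z' - w')"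
  using C1_pair_add[of z z' "(-1) *\<^sub>R w" "(-1) *\<^sub>R w'"] C1_pair_scale[of w w' "-1"] by simp

lemma C1_pair_0: "C1_pair 0 0"
  unfolding zero_fun_def by (rule C1_pair_const)

lemma C1_pair_scaleR_vec: "C1_pair y y' \<Longrightarrow> C1_pair (\<lambda>t. y t *\<^sub>R v) (\<lambda>t. y' t *\<^sub>R v)"
  by (rule C1_pair_linear[OF bounded_linear_scaleR_left])

text \<open>
  A substitute for test functions with values in a vector space: multiples of a fixed vector whose
  coefficient vanishes at \<open>0\<close> and \<open>T\<close>. Compact support in \<open>(0,T)\<close> is not imposed, because the
  solutions of the Dirichlet problem below have none; finite rank keeps every integral scalar, which
  matters as the spaces need not be separable.
\<close>

definition D0 :: "real \<Rightarrow> (real \<Rightarrow> 'b::real_normed_vector) set" where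
  "D0 T = {(\<lambda>t. y t *\<^sub>R v) | y y' v. C1_pair y y' \<and> y 0 = 0 \<and> y T = 0}"

lemma D0I:
  assumes "C1_pair y y'" "y 0 = 0" "y T = 0"
  shows "(\<lambda>t. y t *\<^sub>R v) \<in> D0 T"
  unfolding D0_def mem_Collect_eq
  by (intro exI[of _ y] exI[of _ y'] exI[of _ v] conjI refl assms)

lemma span_D0_C1:
  assumes "s \<in> span (D0 T)"
  shows "\<exists>s'. C1_pair s s' \<and> s 0 = 0 \<and> s T = 0"
  using assms
proof (induction rule: span_induct_alt)
  case base
  show ?case using C1_pair_0 by (auto simp: zero_fun_def)
next
  case (step c x y)
  obtain y' where y': "C1_pair y y'" "y 0 = 0" "y T = 0" using step.IH by auto
  from step.hyps obtain \<phi> \<phi>' v where x: "x = (\<lambda>t. \<phi> t *\<^sub>R v)" "C1_pair \<phi> \<phi>'" "\<phi> 0 = 0" "\<phi> T = 0"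
    by (auto simp: D0_def)
  have "C1_pair (c *\<^sub>R x + y) (c *\<^sub>R (\<lambda>t. \<phi>' t *\<^sub>R v) + y')"
    unfolding x(1) by (intro C1_pair_add C1_pair_scale C1_pair_scaleR_vec x(2) y')
  moreover have "(c *\<^sub>R x + y) 0 = 0" "(c *\<^sub>R x + y) T = 0"
    using x y' by (auto simp: scaleR_fun_def)
  ultimately show ?case by blast
qed

lemma span_D0_L2: "s \<in> span (D0 T) \<Longrightarrow> s \<in> L2 T"
  using span_D0_C1 C1_pairD(4) by blast

text \<open>
  Membership in the closure of the span of \<open>D0 T\<close>.
\<close>

definition approximable :: "real \<Rightarrow> (real \<Rightarrow> 'b::real_normed_vector) \<Rightarrow> bool" where
  "approximable T w \<longleftrightarrow> w \<in> L2 T \<and> (\<forall>\<epsilon>>0. \<exists>s\<in>span (D0 T). L2_norm T (w - s) < \<epsilon>)"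

lemma L2_diff: "w \<in> L2 T \<Longrightarrow> v \<in> L2 T \<Longrightarrow> w - v \<in> L2 T"
  by (rule subspace_diff[OF subspace_L2])

lemma L2_norm_triangle_diff:
  assumes "w \<in> L2 T" "v \<in> L2 T" "x \<in> L2 T"
  shows "L2_norm T (w - x) \<le> L2_norm T (w - v) + L2_norm T (v - x)"
  using L2_norm_triangle[OF L2_diff[OF assms(1,2)] L2_diff[OF assms(2,3)]] by simp

lemma approximable_limit:
  assumes w: "w \<in> L2 T" and "\<And>\<epsilon>. 0 < \<epsilon> \<Longrightarrow> \<exists>v. approximable T v \<and> L2_norm T (w - v) < \<epsilon>"
  shows "approximable T w"
  unfolding approximable_def
proof (intro conjI allI impI w)
  fix \<epsilon> :: real assume "0 < \<epsilon>"
  then obtain v where v: "approximable T v" "L2_norm T (w - v) < \<epsilon> / 2"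
    using assms(2)[of "\<epsilon> / 2"] by auto
  then obtain s where s: "s \<in> span (D0 T)" "L2_norm T (v - s) < \<epsilon> / 2"
    using \<open>0 < \<epsilon>\<close> unfolding approximable_def by (meson half_gt_zero)
  have "v \<in> L2 T" using v(1) by (simp add: approximable_def)
  from L2_norm_triangle_diff[OF w this span_D0_L2[OF s(1)]] v(2) s(2)
  have "L2_norm T (w - s) < \<epsilon>" by simp
  with s(1) show "\<exists>s\<in>span (D0 T). L2_norm T (w - s) < \<epsilon>" by blast
qed

lemma approximable_limit_seq:
  assumes w: "w \<in> L2 T" and s: "\<And>n. approximable T (s n)"
    and lim: "(\<lambda>n. L2_norm T (w - s n)) \<longlonglongrightarrow> 0"
  shows "approximable T w"
proof (rule approximable_limit[OF w])
  fix \<epsilon> :: real assume "0 < \<epsilon>"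
  then have "\<forall>\<^sub>F n in sequentially. L2_norm T (w - s n) < \<epsilon>" by (rule order_tendstoD(2)[OF lim])
  then obtain n where "L2_norm T (w - s n) < \<epsilon>" unfolding eventually_sequentially by blast
  with s show "\<exists>v. approximable T v \<and> L2_norm T (w - v) < \<epsilon>" by blast
qed

lemma approximable_span:
  assumes "s \<in> span (D0 T)"
  shows "approximable T s"
proof -
  have "L2_norm T (s - s) = 0" by (simp add: L2_norm_def)
  then show ?thesis
    using assms span_D0_L2[OF assms] unfolding approximable_def by (metis)
qed

lemma approximable_add:
  assumes w: "approximable T w" and v: "approximable T v"
  shows "approximable T (w + v)"
  unfolding approximable_def
proof (intro conjI allI impI)
  have wL: "w \<in> L2 T" and vL: "v \<in> L2 T" using w v by (auto simp: approximable_def)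
  show "w + v \<in> L2 T" by (rule L2_add[OF wL vL])
  fix \<epsilon> :: real assume e: "0 < \<epsilon>"
  obtain r where r: "r \<in> span (D0 T)" "L2_norm T (w - r) < \<epsilon> / 2"
    using w e unfolding approximable_def by (meson half_gt_zero)
  obtain s where s: "s \<in> span (D0 T)" "L2_norm T (v - s) < \<epsilon> / 2"
    using v e unfolding approximable_def by (meson half_gt_zero)
  have eq: "(w + v) - (r + s) = (w - r) + (v - s)" by simp
  have "L2_norm T ((w + v) - (r + s)) \<le> L2_norm T (w - r) + L2_norm T (v - s)"
    unfolding eq
    by (rule L2_norm_triangle[OF L2_diff[OF wL span_D0_L2[OF r(1)]] L2_diff[OF vL span_D0_L2[OF s(1)]]])
  then have "L2_norm T ((w + v) - (r + s)) < \<epsilon>" using r(2) s(2) by simp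
  then show "\<exists>s\<in>span (D0 T). L2_norm T (w + v - s) < \<epsilon>"
    using span_add[OF r(1) s(1)] by blast
qed

lemma L2_cong:
  assumes v: "v \<in> L2 T" and eq: "\<And>t. 0 < t \<Longrightarrow> t < T \<Longrightarrow> w t = v t"
  shows "w \<in> L2 T"
proof (rule L2I)
  obtain s where s: "\<And>i::nat. simple_function (Xi T) (s i)" "AE t in Xi T. (\<lambda>i. s i t) \<longlonglongrightarrow> v t"
    using L2D(1)[OF v] by (auto simp: strongly_measurable_def)
  have eqA: "AE t in Xi T. w t = v t" by (rule AE_I2) (auto intro: eq)
  with s(2) have "AE t in Xi T. (\<lambda>i. s i t) \<longlonglongrightarrow> w t" by eventually_elim simp
  with s(1) show "strongly_measurable (Xi T) w" unfolding strongly_measurable_def by blast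
  show "integrable (Xi T) (\<lambda>t. (norm (v t))\<^sup>2)" by (rule L2D(2)[OF v])
  show "AE t in Xi T. (norm (w t))\<^sup>2 \<le> (norm (v t))\<^sup>2" using eqA by eventually_elim simp
qed

lemma L2_norm_cong:
  assumes "\<And>t. 0 < t \<Longrightarrow> t < T \<Longrightarrow> w t = v t"
  shows "L2_norm T w = L2_norm T v"
proof -
  have "(\<integral>t. (norm (w t))\<^sup>2 \<partial>Xi T) = (\<integral>t. (norm (v t))\<^sup>2 \<partial>Xi T)"
    by (rule Bochner_Integration.integral_cong) (use assms in auto)
  then show ?thesis by (simp add: L2_norm_def)
qed

lemma approximable_cong:
  assumes v: "approximable T v" and eq: "\<And>t. 0 < t \<Longrightarrow> t < T \<Longrightarrow> w t = v t"
  shows "approximable T w"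
proof -
  have "L2_norm T (w - s) = L2_norm T (v - s)" for s by (rule L2_norm_cong) (simp add: eq)
  then show ?thesis using v L2_cong[of v T w] eq by (auto simp: approximable_def)
qed

lemma integrable_continuous_Xi:
  fixes f :: "real \<Rightarrow> real"
  assumes "continuous_on UNIV f"
  shows "integrable (Xi T) f"
  using L2_inner_integrable[OF L2_continuous[OF assms] L2_continuous[OF continuous_on_const[of UNIV "1::real"]]]
  by simp

text \<open>
  A polynomial approximation of \<open>g\<close> is multiplied by \<open>n q\<^sup>2 / (1 + n q\<^sup>2)\<close> with \<open>q = t (T - t)\<close>.
  This cut-off is smooth on the whole line, vanishes at both end points and tends to \<open>1\<close> in between.
\<close>

lemma approximable_continuous:
  fixes g :: "real \<Rightarrow> real"
  assumes g: "continuous_on UNIV g"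
  shows "approximable T (\<lambda>t. g t *\<^sub>R v)"
proof -
  have "\<exists>p. real_polynomial_function p \<and> (\<forall>t\<in>{0..T}. \<bar>g t - p t\<bar> < inverse (real (Suc n)))" for n
    using Stone_Weierstrass_real_polynomial_function[OF compact_Icc continuous_on_subset[OF g subset_UNIV],
        of "inverse (real (Suc n))" 0 T] by (metis inverse_positive_iff_positive of_nat_0_less_iff zero_less_Suc)
  then obtain p where p: "\<And>n. real_polynomial_function (p n)"
    and pg: "\<And>n t. t \<in> {0..T} \<Longrightarrow> \<bar>g t - p n t\<bar> < inverse (real (Suc n))" by metis
  define q where "q n t = real (Suc n) * (t * (T - t))\<^sup>2" for n t
  define q' where "q' n t = real (Suc n) * (2 * (t * (T - t)) * (T - 2 * t))" for n t
  define cut where "cut n t = q n t / (1 + q n t)" for n t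
  have q0: "0 \<le> q n t" for n t by (simp add: q_def)
  have cutC1: "C1_pair (cut n) (\<lambda>t. q' n t / (1 + q n t)\<^sup>2)" for n
    unfolding C1_pair_real
  proof (intro conjI allI)
    fix t
    have "(q n has_real_derivative q' n t) (at t)"
      unfolding q_def q'_def by (auto intro!: derivative_eq_intros simp: algebra_simps power2_eq_square)
    moreover have "1 + q n t \<noteq> 0" using q0[of n t] by simp
    ultimately show "(cut n has_real_derivative q' n t / (1 + q n t)\<^sup>2) (at t)"
      unfolding cut_def by (auto intro!: derivative_eq_intros simp: algebra_simps power2_eq_square)
    have "1 + q n t \<noteq> 0" for t using q0[of n t] by simp
    then have "(1 + real (Suc n) * (t * (T - t))\<^sup>2)\<^sup>2 \<noteq> 0" for t by (auto simp: q_def)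
    then show "continuous_on UNIV (\<lambda>t. q' n t / (1 + q n t)\<^sup>2)"
      unfolding q_def q'_def by (intro continuous_intros) auto
  qed
  have pC1: "\<exists>p'. C1_pair (p n) p'" for n
    using has_real_derivative_polynomial_function[OF p[of n]] continuous_real_polymonial_function
    unfolding C1_pair_real continuous_on_eq_continuous_at[OF open_UNIV] by blast
  have cut01: "0 \<le> cut n t" "cut n t \<le> 1" for n t
    using q0[of n t] by (auto simp: cut_def divide_le_eq)
  have cutlim: "(\<lambda>n. cut n t) \<longlonglongrightarrow> 1" if t: "0 < t" "t < T" for t
  proof -
    define c where "c = (t * (T - t))\<^sup>2"
    have c: "0 < c" using t by (simp add: c_def)
    have "1 - cut n t = 1 / (1 + q n t)" for n using q0[of n t] by (simp add: cut_def field_simps)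
    moreover have "1 / (1 + q n t) \<le> inverse (real (Suc n)) * (1 / c)" for n
    proof -
      have "1 / (1 + q n t) \<le> 1 / (real (Suc n) * c)"
      proof (rule frac_le)
        show "0 < real (Suc n) * c" using c by simp
        show "real (Suc n) * c \<le> 1 + q n t" by (simp add: q_def c_def)
      qed simp_all
      then show ?thesis by (simp add: inverse_eq_divide)
    qed
    ultimately have "1 - cut n t \<le> inverse (real (Suc n)) * (1 / c)" for n by metis
    then have le: "\<bar>1 - cut n t\<bar> \<le> inverse (real (Suc n)) * (1 / c)" for n
      using cut01(2)[of n t] by (simp only: abs_of_nonneg diff_ge_0_iff_ge)
    have "(\<lambda>n. inverse (real (Suc n)) * (1 / c)) \<longlonglongrightarrow> 0"
      by (rule tendsto_mult_left_zero[OF LIMSEQ_inverse_real_of_nat])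
    then have "(\<lambda>n. 1 - cut n t) \<longlonglongrightarrow> 0"
      by (rule Lim_null_comparison[rotated]) (use le in simp)
    from tendsto_diff[OF tendsto_const[of 1] this] show ?thesis by simp
  qed
  define s where "s n t = (cut n t * p n t) *\<^sub>R v" for n t
  have s: "s n \<in> span (D0 T)" for n
  proof (rule span_base)
    obtain p' where p': "C1_pair (p n) p'" using pC1 by blast
    have "cut n 0 * p n 0 = 0" "cut n T * p n T = 0" by (simp_all add: cut_def q_def)
    then show "s n \<in> D0 T"
      unfolding s_def by (rule D0I[OF C1_pair_bilinear[OF bounded_bilinear_mult cutC1[of n] p']])
  qed
  have wL: "(\<lambda>t. g t *\<^sub>R v) \<in> L2 T" by (intro L2_continuous continuous_intros g)
  show ?thesis
  proof (rule approximable_limit_seq[OF wL approximable_span[OF s]])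
    show "(\<lambda>n. L2_norm T ((\<lambda>t. g t *\<^sub>R v) - s n)) \<longlonglongrightarrow> 0"
    proof (rule L2_dominated_convergence[OF wL span_D0_L2[OF s]])
      show "integrable (Xi T) (\<lambda>t. ((\<bar>g t\<bar> + 1) * norm v)\<^sup>2)"
        by (intro integrable_continuous_Xi continuous_intros g)
      show "AE t in Xi T. (\<lambda>n. s n t) \<longlonglongrightarrow> g t *\<^sub>R v"
      proof (intro AE_I2)
        fix t assume "t \<in> space (Xi T)"
        then have t: "0 < t" "t < T" by auto
        have "(\<lambda>n. g t - p n t) \<longlonglongrightarrow> 0"
        proof (rule Lim_null_comparison[OF _ LIMSEQ_inverse_real_of_nat])
          have "norm (g t - p n t) \<le> inverse (real (Suc n))" for n
            using pg[of t n] t by simp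
          then show "\<forall>\<^sub>F n in sequentially. norm (g t - p n t) \<le> inverse (real (Suc n))" by simp
        qed
        from tendsto_diff[OF tendsto_const[of "g t"] this] have "(\<lambda>n. p n t) \<longlonglongrightarrow> g t" by simp
        from tendsto_mult[OF cutlim[OF t] this] have "(\<lambda>n. cut n t * p n t) \<longlonglongrightarrow> g t" by simp
        then show "(\<lambda>n. s n t) \<longlonglongrightarrow> g t *\<^sub>R v" unfolding s_def by (intro tendsto_intros)
      qed
      show "AE t in Xi T. (norm (s n t))\<^sup>2 \<le> ((\<bar>g t\<bar> + 1) * norm v)\<^sup>2" for n
      proof (intro AE_I2 power_mono)
        fix t assume "t \<in> space (Xi T)"
        then have "\<bar>g t - p n t\<bar> < inverse (real (Suc n))" by (intro pg) auto
        moreover have "inverse (real (Suc n)) \<le> 1" by (simp add: inverse_le_1_iff)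
        ultimately have "\<bar>p n t\<bar> \<le> \<bar>g t\<bar> + 1" by linarith
        then have "cut n t * \<bar>p n t\<bar> \<le> 1 * (\<bar>g t\<bar> + 1)" using cut01 by (intro mult_mono) auto
        then show "norm (s n t) \<le> (\<bar>g t\<bar> + 1) * norm v"
          using cut01[of n t] by (simp add: s_def abs_mult mult_right_mono)
      qed simp
    qed
  qed
qed

text \<open>
  A measurable function is an almost everywhere limit of continuous functions; clipping these to
  \<open>[0,1]\<close> provides the dominating function.
\<close>

lemma approximable_indicator:
  assumes E: "E \<in> sets lebesgue"
  shows "approximable T (\<lambda>t. indicat_real E t *\<^sub>R v)"
proof -
  have "indicat_real E \<in> borel_measurable (lebesgue_on UNIV)"
    using E by (simp add: lebesgue_on_UNIV_eq)
  then have "indicat_real E measurable_on UNIV" by (subst measurable_on_iff_borel_measurable) auto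
  then obtain N g where *: "negligible N \<and> (\<forall>n. continuous_on UNIV (g n)) \<and>
      (\<forall>t. t \<notin> N \<longrightarrow> (\<lambda>n. g n t) \<longlonglongrightarrow> (if t \<in> UNIV then indicat_real E t else 0))"
    unfolding measurable_on_def by blast
  from * have N: "negligible N" by (elim conjE)
  from * have g: "continuous_on UNIV (g n)" for n by (elim conjE allE)
  from * have lim: "(\<lambda>n. g n t) \<longlonglongrightarrow> indicat_real E t" if "t \<notin> N" for t
    using that by simp
  define s where "s n t = max 0 (min 1 (g n t)) *\<^sub>R v" for n :: nat and t
  have s: "approximable T (s n)" for n
    unfolding s_def by (intro approximable_continuous continuous_intros g)
  then have sL: "s n \<in> L2 T" for n by (simp add: approximable_def)
  have wL: "(\<lambda>t. indicat_real E t *\<^sub>R v) \<in> L2 T"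
  proof (rule L2I)
    have "E \<inter> {0<..<T} \<in> sets (Xi T)" using E by (auto simp: sets_restrict_space)
    then have "simple_function (Xi T) (indicat_real (E \<inter> {0<..<T}))" by (rule simple_function_indicator)
    then have "simple_function (Xi T) (\<lambda>t. indicat_real (E \<inter> {0<..<T}) t *\<^sub>R v)"
      by (rule simple_function_compose1)
    then have "simple_function (Xi T) (\<lambda>t. indicat_real E t *\<^sub>R v)"
      by (subst simple_function_cong[of _ _ "\<lambda>t. indicat_real (E \<inter> {0<..<T}) t *\<^sub>R v"]) (auto simp: indicator_def)
    then show "strongly_measurable (Xi T) (\<lambda>t. indicat_real E t *\<^sub>R v)" by (rule strongly_measurable_simple)
    show "integrable (Xi T) (\<lambda>t. (norm v)\<^sup>2)" by simp
    show "AE t in Xi T. (norm (indicat_real E t *\<^sub>R v))\<^sup>2 \<le> (norm v)\<^sup>2"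
      by (intro AE_I2 power_mono) (auto simp: indicator_def)
  qed
  show ?thesis
  proof (rule approximable_limit_seq[OF wL s], rule L2_dominated_convergence[OF wL sL])
    show "integrable (Xi T) (\<lambda>t. (norm v)\<^sup>2)" by simp
    show "AE t in Xi T. (norm (s n t))\<^sup>2 \<le> (norm v)\<^sup>2" for n
    proof (intro AE_I2 power_mono)
      show "norm (s n t) \<le> norm v" for t
        using mult_right_mono[of "max 0 (min 1 (g n t))" 1 "norm v"] by (simp add: s_def)
    qed simp
    have "AE t in lebesgue. t \<notin> N" using N by (simp add: negligible_iff_null_sets AE_not_in)
    then have "AE t in Xi T. t \<notin> N" by (subst AE_restrict_space_iff) auto
    then show "AE t in Xi T. (\<lambda>n. s n t) \<longlonglongrightarrow> indicat_real E t *\<^sub>R v"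
    proof eventually_elim
      fix t assume "t \<notin> N"
      from lim[OF this] have "(\<lambda>n. s n t) \<longlonglongrightarrow> max 0 (min 1 (indicat_real E t)) *\<^sub>R v"
        unfolding s_def by (intro tendsto_intros)
      then show "(\<lambda>n. s n t) \<longlonglongrightarrow> indicat_real E t *\<^sub>R v" by (simp add: indicator_def split: if_splits)
    qed
  qed
qed

lemma approximable_simple:
  assumes s: "simple_function (Xi T) s"
  shows "approximable T s"
proof -
  let ?S = "{0<..<T}"
  define E where "E x = s -` {x} \<inter> ?S" for x
  have fin: "finite (s ` ?S)" using s by (simp add: simple_function_def)
  have E: "E x \<in> sets lebesgue" if "x \<in> s ` ?S" for x
  proof -
    have "E x \<in> sets (Xi T)" using s that by (auto simp: simple_function_def E_def)
    then show ?thesis by (subst (asm) sets_restrict_space_iff) auto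
  qed
  have "approximable T (\<lambda>t. \<Sum>x\<in>F. indicat_real (E x) t *\<^sub>R x)" if "finite F" "F \<subseteq> s ` ?S" for F
    using that
  proof (induction F rule: finite_induct)
    case empty
    show ?case using approximable_span[OF span_zero[of "D0 T"]] by (simp add: zero_fun_def)
  next
    case (insert x F)
    have "approximable T ((\<lambda>t. indicat_real (E x) t *\<^sub>R x) + (\<lambda>t. \<Sum>x\<in>F. indicat_real (E x) t *\<^sub>R x))"
      using insert by (intro approximable_add approximable_indicator E) auto
    moreover have "(\<lambda>t. indicat_real (E x) t *\<^sub>R x) + (\<lambda>t. \<Sum>x\<in>F. indicat_real (E x) t *\<^sub>R x)
        = (\<lambda>t. \<Sum>x\<in>insert x F. indicat_real (E x) t *\<^sub>R x)"
      by (rule ext) (simp only: plus_fun_apply sum.insert[OF insert.hyps(1,2)])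
    ultimately show ?case by (simp only:)
  qed
  from this[OF fin subset_refl] show ?thesis
  proof (rule approximable_cong)
    fix t assume t: "0 < t" "t < T"
    have "(\<Sum>x\<in>s ` ?S. indicat_real (E x) t *\<^sub>R x) = (\<Sum>x\<in>s ` ?S. if x = s t then x else 0)"
      using t by (intro sum.cong) (auto simp: E_def indicator_def)
    also have "\<dots> = s t" using fin t by (subst sum.delta) auto
    finally show "s t = (\<Sum>x\<in>s ` ?S. indicat_real (E x) t *\<^sub>R x)" by simp
  qed
qed

text \<open>
  The simple functions in the definition of strong measurability need not be dominated. Cutting them
  off where their norm exceeds \<open>2 \<bar>w t\<bar>\<close> leaves them simple, and does not disturb the convergence.
\<close>

theorem L2_approximable:
  fixes w :: "real \<Rightarrow> 'b::real_normed_vector"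
  assumes w: "w \<in> L2 T"
  shows "approximable T w"
proof -
  obtain s where s: "\<And>i::nat. simple_function (Xi T) (s i)" "AE t in Xi T. (\<lambda>i. s i t) \<longlonglongrightarrow> w t"
    using L2D(1)[OF w] by (auto simp: strongly_measurable_def)
  define E where "E i = {t \<in> space (Xi T). norm (s i t) \<le> 2 * norm (w t)}" for i
  have E: "E i \<in> sets (Xi T)" for i
    unfolding E_def
    by (intro borel_measurable_le borel_measurable_norm_sm strongly_measurable_simple s
        borel_measurable_times borel_measurable_const L2D(3)[OF w])
  define r where "r i t = (if t \<in> E i then s i t else 0)" for i t
  have r: "approximable T (r i)" for i
    unfolding r_def
    by (intro approximable_simple simple_function_If_set s simple_function_const) (use E sets.Int_space_eq2[OF E] in auto)
  then have rL: "r i \<in> L2 T" for i by (simp add: approximable_def)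
  show ?thesis
  proof (rule approximable_limit_seq[OF w r], rule L2_dominated_convergence[OF w rL])
    show "integrable (Xi T) (\<lambda>t. 4 * (norm (w t))\<^sup>2)" using L2D(2)[OF w] by simp
    show "AE t in Xi T. (norm (r i t))\<^sup>2 \<le> 4 * (norm (w t))\<^sup>2" for i
    proof (intro AE_I2)
      fix t
      have "norm (r i t) \<le> 2 * norm (w t)" by (auto simp: r_def E_def)
      then have "(norm (r i t))\<^sup>2 \<le> (2 * norm (w t))\<^sup>2" by (intro power_mono) auto
      then show "(norm (r i t))\<^sup>2 \<le> 4 * (norm (w t))\<^sup>2" by (simp add: power_mult_distrib)
    qed
    show "AE t in Xi T. (\<lambda>i. r i t) \<longlonglongrightarrow> w t"
      using s(2) AE_space
    proof eventually_elim
      fix t assume lim: "(\<lambda>i. s i t) \<longlonglongrightarrow> w t" and t: "t \<in> space (Xi T)"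
      show "(\<lambda>i. r i t) \<longlonglongrightarrow> w t"
      proof (cases "w t = 0")
        case True
        then have "r i t = 0" for i by (auto simp: r_def E_def)
        then show ?thesis using True by simp
      next
        case False
        then have "norm (w t) < 2 * norm (w t)" by simp
        from order_tendstoD(2)[OF tendsto_norm[OF lim] this]
        have "\<forall>\<^sub>F i in sequentially. s i t = r i t"
          by eventually_elim (use t in \<open>auto simp: r_def E_def\<close>)
        then show ?thesis by (rule Lim_transform_eventually[OF lim])
      qed
    qed
  qed
qed

corollary L2_dense:
  assumes "w \<in> L2 T" "0 < \<epsilon>"
  obtains s where "s \<in> span (D0 T)" "L2_norm T (w - s) < \<epsilon>"
  using L2_approximable[OF assms(1)] assms(2) unfolding approximable_def by blast

section \<open>Weak derivatives tested with continuously differentiable functions\<close>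

lemma integral_FTC_Xi:
  fixes F :: "real \<Rightarrow> real"
  assumes F: "C1_pair F F'" and ab: "0 \<le> a" "a \<le> b" "b \<le> T"
  shows "(\<integral>r. indicat_real {a..b} r * F' r \<partial>Xi T) = F b - F a"
proof -
  have F'b: "F' \<in> borel_measurable borel"
    by (rule borel_measurable_continuous_onI[OF C1_pairD(2)[OF F]])
  then have F'l: "F' \<in> borel_measurable lebesgue" by (intro measurable_completion) simp
  have "(\<integral>r. indicat_real {a..b} r * F' r \<partial>Xi T)
      = (\<integral>r. indicat_real {0<..<T} r *\<^sub>R (indicat_real {a..b} r * F' r) \<partial>lebesgue)"
    by (rule integral_restrict_space) simp
  also have "\<dots> = (\<integral>r. indicat_real {a..b} r *\<^sub>R F' r \<partial>lebesgue)"
  proof (rule integral_cong_AE)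
    have "{0, T} \<in> null_sets lebesgue"
      by (intro null_sets_completionI countable_imp_null_set_lborel) simp
    then have "AE r in lebesgue. r \<notin> {0, T}" by (rule AE_not_in)
    then show "AE r in lebesgue. indicat_real {0<..<T} r *\<^sub>R (indicat_real {a..b} r * F' r)
        = indicat_real {a..b} r *\<^sub>R F' r"
      by eventually_elim (use ab in \<open>auto simp: indicator_def\<close>)
    show "(\<lambda>r. indicat_real {0<..<T} r *\<^sub>R (indicat_real {a..b} r * F' r)) \<in> borel_measurable lebesgue"
      "(\<lambda>r. indicat_real {a..b} r *\<^sub>R F' r) \<in> borel_measurable lebesgue"
      by (intro borel_measurable_scaleR borel_measurable_times borel_measurable_indicator F'l; simp)+
  qed
  also have "\<dots> = (\<integral>r. indicat_real {a..b} r *\<^sub>R F' r \<partial>lborel)"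
    by (rule integral_completion)
       (intro borel_measurable_scaleR borel_measurable_indicator; use F'b in simp)
  also have "\<dots> = F b - F a"
    by (rule integral_FTC_atLeastAtMost[OF ab(2)])
       (use has_vector_derivative_at_within[OF C1_pairD(1)[OF F]] continuous_on_subset[OF C1_pairD(2)[OF F]] in auto)
  finally show ?thesis .
qed

lemma integral_by_parts_C1:
  fixes B :: "'b::real_normed_vector \<Rightarrow> 'c::real_normed_vector \<Rightarrow> real"
  assumes B: "bounded_bilinear B" and z: "C1_pair z z'" and w: "C1_pair w w'" and T: "0 \<le> T"
  shows "(\<integral>t. B (z' t) (w t) \<partial>Xi T) + (\<integral>t. B (z t) (w' t) \<partial>Xi T) = B (z T) (w T) - B (z 0) (w 0)"
proof -
  have "(\<integral>t. B (z' t) (w t) \<partial>Xi T) + (\<integral>t. B (z t) (w' t) \<partial>Xi T)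
      = (\<integral>t. B (z t) (w' t) + B (z' t) (w t) \<partial>Xi T)"
    by (subst Bochner_Integration.integral_add)
       (use L2_bilinear_integrable[OF B] C1_pairD(4,5)[OF z] C1_pairD(4,5)[OF w] in auto)
  also have "\<dots> = (\<integral>t. indicat_real {0..T} t * (B (z t) (w' t) + B (z' t) (w t)) \<partial>Xi T)"
    by (rule Bochner_Integration.integral_cong) (auto simp: indicator_def)
  also have "\<dots> = B (z T) (w T) - B (z 0) (w 0)"
    by (rule integral_FTC_Xi[OF C1_pair_bilinear[OF B z w]]) (use T in auto)
  finally show ?thesis .
qed

lemma L2_real_integrable:
  fixes f :: "real \<Rightarrow> real"
  assumes "f \<in> L2 T"
  shows "integrable (Xi T) f"
  using L2_inner_integrable[OF assms L2_continuous[OF continuous_on_const[of UNIV "1::real"]]] by simp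

lemma DERIV_max_0_sq: "((\<lambda>t::real. (max 0 t)\<^sup>2) has_real_derivative 2 * max 0 t) (at t)"
proof -
  consider "t < 0" | "t = 0" | "0 < t" by linarith
  then show ?thesis
  proof cases
    case 1
    have "((\<lambda>t::real. 0) has_real_derivative 0) (at t)" by simp
    then have "((\<lambda>t::real. (max 0 t)\<^sup>2) has_real_derivative 0) (at t)"
      by (rule has_field_derivative_transform_within_open[of _ _ _ "{..<0}"]) (use 1 in auto)
    then show ?thesis using 1 by simp
  next
    case 2
    have "(\<lambda>h::real. (max 0 h)\<^sup>2 / h) \<midarrow>0\<rightarrow> 0"
    proof (rule Lim_null_comparison)
      show "\<forall>\<^sub>F h::real in at 0. norm ((max 0 h)\<^sup>2 / h) \<le> \<bar>h\<bar>"
        by (rule always_eventually) (auto simp: max_def power2_eq_square)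
      show "((\<lambda>h::real. \<bar>h\<bar>) \<longlongrightarrow> 0) (at 0)" by (rule tendsto_rabs_zero) simp
    qed
    then show ?thesis using 2 by (simp add: DERIV_def)
  next
    case 3
    have "((\<lambda>t::real. t\<^sup>2) has_real_derivative 2 * t) (at t)" by (auto intro!: derivative_eq_intros)
    then have "((\<lambda>t::real. (max 0 t)\<^sup>2) has_real_derivative 2 * t) (at t)"
      by (rule has_field_derivative_transform_within_open[of _ _ _ "{0<..}"]) (use 3 in auto)
    then show ?thesis using 3 by simp
  qed
qed

text \<open>
  A continuously differentiable cut-off that vanishes up to \<open>a\<close> and tends to \<open>1\<close> on \<open>(0,\<infinity>)\<close> as
  \<open>a \<rightarrow> 0\<close>. Its shape is chosen such that \<open>t\<close> times the derivative stays bounded uniformly in \<open>a\<close>.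
\<close>

definition ramp :: "real \<Rightarrow> real \<Rightarrow> real" where
  "ramp a t = (max 0 (t - a))\<^sup>2 / ((max 0 (t - a))\<^sup>2 + a\<^sup>2)"

definition ramp' :: "real \<Rightarrow> real \<Rightarrow> real" where
  "ramp' a t = 2 * max 0 (t - a) * a\<^sup>2 / ((max 0 (t - a))\<^sup>2 + a\<^sup>2)\<^sup>2"

lemma ramp_C1:
  assumes a: "0 < a"
  shows "C1_pair (ramp a) (ramp' a)"
  unfolding C1_pair_real
proof (intro conjI allI)
  fix t
  have pos: "(max 0 (t - a))\<^sup>2 + a\<^sup>2 \<noteq> 0" for t using a by (simp add: sum_power2_eq_zero_iff)
  have d: "((\<lambda>t. (max 0 (t - a))\<^sup>2) has_real_derivative 2 * max 0 (t - a)) (at t)"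
  proof -
    have "((\<lambda>t. t - a) has_real_derivative 1) (at t)" by (auto intro!: derivative_eq_intros)
    from DERIV_chain2[OF DERIV_max_0_sq this] show ?thesis by simp
  qed
  show "(ramp a has_real_derivative ramp' a t) (at t)"
    unfolding ramp_def[abs_def] ramp'_def
    by (rule derivative_eq_intros d pos refl | simp)+ (simp add: algebra_simps power2_eq_square)
  show "continuous_on UNIV (ramp' a)"
    unfolding ramp'_def[abs_def] using pos by (intro continuous_intros) auto
qed

lemma ramp_bounds: "0 \<le> ramp a t" "ramp a t \<le> 1" "0 < a \<Longrightarrow> t \<le> a \<Longrightarrow> ramp a t = 0"
proof -
  have d: "0 \<le> (max 0 (t - a))\<^sup>2 + a\<^sup>2" by simp
  show "ramp a t \<le> 1"
  proof (cases "(max 0 (t - a))\<^sup>2 + a\<^sup>2 = 0")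
    case False
    then have "0 < (max 0 (t - a))\<^sup>2 + a\<^sup>2" using d by linarith
    then show ?thesis by (simp add: ramp_def divide_le_eq del: zero_less_power2)
  qed (simp only: ramp_def div_by_0 zero_le_one)
qed (auto simp: ramp_def)

lemma ramp'_bounds:
  assumes a: "0 < a" and t: "0 < t"
  shows "0 \<le> ramp' a t" "t * ramp' a t \<le> 2"
proof -
  show "0 \<le> ramp' a t" by (simp add: ramp'_def)
  \<comment> \<open>As \<open>t \<le> x + a\<close>, the second claim follows from \<open>(x + a) x a\<^sup>2 \<le> (x\<^sup>2 + a\<^sup>2)\<^sup>2\<close>.\<close>
  define x where "x = max 0 (t - a)"
  have x: "0 \<le> x" "t \<le> x + a" by (auto simp: x_def)
  have p: "0 < (x\<^sup>2 + a\<^sup>2)\<^sup>2" using a by (simp add: add_nonneg_pos)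
  have "2 * (x * a) \<le> x\<^sup>2 + a\<^sup>2" using sum_squares_bound[of x a] by simp
  then have "(x + a) * (x * a\<^sup>2) \<le> (x\<^sup>2 + a\<^sup>2)\<^sup>2"
  proof -
    assume h: "2 * (x * a) \<le> x\<^sup>2 + a\<^sup>2"
    have "(x + a) * (x * a\<^sup>2) = x\<^sup>2 * a\<^sup>2 + (x * a) * a\<^sup>2" by (simp add: algebra_simps power2_eq_square)
    also have "\<dots> \<le> x\<^sup>2 * a\<^sup>2 + (x\<^sup>2 + a\<^sup>2) * a\<^sup>2"
      using h x a by (intro add_left_mono mult_right_mono) (auto intro: order_trans[rotated])
    also have "\<dots> \<le> x\<^sup>2 * a\<^sup>2 + (x\<^sup>2 + a\<^sup>2) * a\<^sup>2 + (x\<^sup>2)\<^sup>2" by simp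
    also have "\<dots> = (x\<^sup>2 + a\<^sup>2)\<^sup>2" by (simp add: algebra_simps power2_eq_square)
    finally show ?thesis .
  qed
  moreover have "t * (x * a\<^sup>2) \<le> (x + a) * (x * a\<^sup>2)" using x by (intro mult_right_mono) auto
  ultimately have "t * (2 * x * a\<^sup>2) \<le> 2 * (x\<^sup>2 + a\<^sup>2)\<^sup>2" by simp
  then show "t * ramp' a t \<le> 2" using p by (simp add: ramp'_def x_def[symmetric] divide_le_eq)
qed

lemma ramp_limits:
  assumes t: "0 < t"
  shows "(\<lambda>n. ramp (inverse (real (Suc n))) t) \<longlonglongrightarrow> 1"
    and "(\<lambda>n. ramp' (inverse (real (Suc n))) t) \<longlonglongrightarrow> 0"
proof -
  note a = LIMSEQ_inverse_real_of_nat
  have m: "(\<lambda>n. max 0 (t - inverse (real (Suc n)))) \<longlonglongrightarrow> max 0 (t - 0)"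
    by (intro tendsto_intros a)
  have "(\<lambda>n. ramp (inverse (real (Suc n))) t) \<longlonglongrightarrow> (max 0 (t - 0))\<^sup>2 / ((max 0 (t - 0))\<^sup>2 + 0\<^sup>2)"
    unfolding ramp_def by (intro tendsto_intros a) (use t in simp)
  then show "(\<lambda>n. ramp (inverse (real (Suc n))) t) \<longlonglongrightarrow> 1" using t by simp
  have "(\<lambda>n. ramp' (inverse (real (Suc n))) t)
      \<longlonglongrightarrow> 2 * max 0 (t - 0) * 0\<^sup>2 / ((max 0 (t - 0))\<^sup>2 + 0\<^sup>2)\<^sup>2"
    unfolding ramp'_def by (intro tendsto_intros a) (use t in simp)
  then show "(\<lambda>n. ramp' (inverse (real (Suc n))) t) \<longlonglongrightarrow> 0" by simp
qed

lemma C1_vanishing_bound: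
  fixes y :: "real \<Rightarrow> real"
  assumes y: "C1_pair y y'" and "y 0 = 0" "y T = 0"
  obtains C where "0 \<le> C" "\<And>t. 0 < t \<Longrightarrow> t < T \<Longrightarrow> \<bar>y' t\<bar> \<le> C \<and> \<bar>y t\<bar> \<le> C * t \<and> \<bar>y t\<bar> \<le> C * (T - t)"
proof -
  have "compact (y' ` {0..T})"
    by (rule compact_continuous_image[OF continuous_on_subset[OF C1_pairD(2)[OF y]]]) auto
  then have "bounded (y' ` {0..T})" by (rule compact_imp_bounded)
  then obtain C where "\<forall>x\<in>y' ` {0..T}. norm x \<le> C" unfolding bounded_iff ..
  then have C: "\<bar>y' t\<bar> \<le> \<bar>C\<bar>" if "0 \<le> t" "t \<le> T" for t using that by force
  have d: "DERIV y t :> y' t" for t using y by (simp add: C1_pair_real)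
  have "\<bar>y' t\<bar> \<le> \<bar>C\<bar> \<and> \<bar>y t\<bar> \<le> \<bar>C\<bar> * t \<and> \<bar>y t\<bar> \<le> \<bar>C\<bar> * (T - t)" if t: "0 < t" "t < T" for t
  proof (intro conjI)
    show "\<bar>y' t\<bar> \<le> \<bar>C\<bar>" using C t by simp
    obtain r where r: "0 < r" "r < t" "y t - y 0 = (t - 0) * y' r" using MVT2[OF t(1) d] by blast
    have "\<bar>y t\<bar> = \<bar>y' r\<bar> * t" using r assms(2) t by (simp add: abs_mult)
    also have "\<dots> \<le> \<bar>C\<bar> * t" using r t by (intro mult_right_mono C) auto
    finally show "\<bar>y t\<bar> \<le> \<bar>C\<bar> * t" .
    obtain r where r: "t < r" "r < T" "y T - y t = (T - t) * y' r" using MVT2[OF t(2) d] by blast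
    have "\<bar>y t\<bar> = \<bar>y T - y t\<bar>" using assms(3) by simp
    also have "\<dots> = \<bar>y' r\<bar> * (T - t)" unfolding r(3) using t by (simp add: abs_mult)
    also have "\<dots> \<le> \<bar>C\<bar> * (T - t)" using r t by (intro mult_right_mono C) auto
    finally show "\<bar>y t\<bar> \<le> \<bar>C\<bar> * (T - t)" .
  qed
  then show ?thesis by (intro that[of "\<bar>C\<bar>"]) auto
qed

text \<open>
  The function \<open>y\<close> becomes a test function after multiplication by the two ramps. The derivative
  of a ramp is of order \<open>1 / t\<close> at distance \<open>t\<close> from its end point, where \<open>y\<close> is of order \<open>t\<close>;
  hence all integrands are dominated and the terms with derivatives of ramps vanish in the limit.
\<close>

lemma weak_derivative_vanishing_C1:
  fixes f g :: "real \<Rightarrow> real"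
  assumes f: "f \<in> L2 T" and g: "g \<in> L2 T"
    and weak: "\<And>\<phi>. test_function T \<phi> \<Longrightarrow> (\<integral>t. deriv \<phi> t * f t \<partial>Xi T) = - (\<integral>t. \<phi> t * g t \<partial>Xi T)"
    and y: "C1_pair y y'" and y0: "y 0 = 0" "y T = 0"
  shows "(\<integral>t. y' t * f t \<partial>Xi T) = - (\<integral>t. y t * g t \<partial>Xi T)"
proof -
  define a where "a n = inverse (real (Suc n))" for n
  have a: "0 < a n" for n by (simp add: a_def)
  obtain C where C0: "0 \<le> C" and C: "\<And>t. 0 < t \<Longrightarrow> t < T \<Longrightarrow>
      \<bar>y' t\<bar> \<le> C \<and> \<bar>y t\<bar> \<le> C * t \<and> \<bar>y t\<bar> \<le> C * (T - t)"
    using C1_vanishing_bound[OF y y0] by blast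
  define \<phi> where "\<phi> n t = (ramp (a n) t * ramp (a n) (T - t)) * y t" for n t
  define \<psi> where "\<psi> n t = (ramp (a n) t * ramp (a n) (T - t)) * y' t
      + (ramp (a n) t * (- ramp' (a n) (T - t)) + ramp' (a n) t * ramp (a n) (T - t)) * y t" for n t
  have \<phi>\<psi>: "C1_pair (\<phi> n) (\<psi> n)" for n
  proof -
    have "C1_pair (\<lambda>t. ramp (a n) (T - t)) (\<lambda>t. - ramp' (a n) (T - t))"
      unfolding C1_pair_real
    proof (intro conjI allI)
      have "(ramp (a n) has_real_derivative ramp' (a n) t) (at t)" for t
        using ramp_C1[OF a] by (simp add: C1_pair_real)
      moreover have "((\<lambda>t. T - t) has_real_derivative - 1) (at t)" for t
        by (auto intro!: derivative_eq_intros)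
      ultimately show "((\<lambda>t. ramp (a n) (T - t)) has_real_derivative - ramp' (a n) (T - t)) (at t)" for t
        using DERIV_chain2[of "ramp (a n)" "ramp' (a n) (T - t)" "\<lambda>t. T - t" t "- 1" UNIV] by simp
      show "continuous_on UNIV (\<lambda>t. - ramp' (a n) (T - t))"
        by (intro continuous_intros continuous_on_compose2[OF C1_pairD(2)[OF ramp_C1[OF a]]]) auto
    qed
    from C1_pair_bilinear[OF bounded_bilinear_mult ramp_C1[OF a] this]
    have "C1_pair (\<lambda>t. ramp (a n) t * ramp (a n) (T - t))
       (\<lambda>t. ramp (a n) t * - ramp' (a n) (T - t) + ramp' (a n) t * ramp (a n) (T - t))" .
    from C1_pair_bilinear[OF bounded_bilinear_mult this y]
    show ?thesis unfolding \<phi>_def[abs_def] \<psi>_def[abs_def] .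
  qed
  have der: "deriv (\<phi> n) t = \<psi> n t" for n t
    using \<phi>\<psi>[of n] by (intro DERIV_imp_deriv) (simp add: C1_pair_real)
  have test: "test_function T (\<phi> n)" for n
    unfolding test_function_def
  proof (intro conjI)
    show "\<phi> n C1_differentiable_on UNIV"
      unfolding C1_differentiable_on_def using \<phi>\<psi>[of n] by (auto simp: C1_pair_def)
    have "{t. \<phi> n t \<noteq> 0} \<subseteq> {a n..T - a n}"
    proof
      fix t assume "t \<in> {t. \<phi> n t \<noteq> 0}"
      then have "ramp (a n) t \<noteq> 0" "ramp (a n) (T - t) \<noteq> 0" by (auto simp: \<phi>_def)
      then have "\<not> t \<le> a n" "\<not> T - t \<le> a n" using ramp_bounds(3)[OF a] by auto
      then show "t \<in> {a n..T - a n}" by simp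
    qed
    then have sub: "closure {t. \<phi> n t \<noteq> 0} \<subseteq> {a n..T - a n}" by (rule closure_minimal) simp
    then show "closure {t. \<phi> n t \<noteq> 0} \<subseteq> {0<..<T}" using a[of n] by force
    have "bounded (closure {t. \<phi> n t \<noteq> 0})" by (rule bounded_subset[OF _ sub]) simp
    then show "compact (closure {t. \<phi> n t \<noteq> 0})" by (simp add: compact_eq_bounded_closed)
  qed
  have fi: "integrable (Xi T) f" and gi: "integrable (Xi T) g"
    using f g by (auto intro: L2_real_integrable)
  have \<phi>le: "\<bar>\<phi> n t\<bar> \<le> C * T" and \<psi>le: "\<bar>\<psi> n t\<bar> \<le> 5 * C" if t: "0 < t" "t < T" for n t
  proof -
    let ?r = "ramp (a n) t" and ?s = "ramp (a n) (T - t)"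
    let ?r' = "ramp' (a n) t" and ?s' = "ramp' (a n) (T - t)"
    have t': "0 < T - t" using t by simp
    have rs: "0 \<le> ?r" "?r \<le> 1" "0 \<le> ?s" "?s \<le> 1" by (rule ramp_bounds)+
    then have rs1: "0 \<le> ?r * ?s" "?r * ?s \<le> 1" by (auto intro: mult_le_one)
    have "\<bar>y t\<bar> \<le> C * T" using C[OF t] t C0 by (meson less_imp_le mult_left_mono order_trans)
    then have "(?r * ?s) * \<bar>y t\<bar> \<le> 1 * (C * T)" using rs1 by (intro mult_mono) auto
    then show "\<bar>\<phi> n t\<bar> \<le> C * T" using rs by (simp add: \<phi>_def abs_mult)
    have r': "?r' * \<bar>y t\<bar> \<le> 2 * C"
    proof -
      have "?r' * \<bar>y t\<bar> \<le> ?r' * (C * t)"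
        using C[OF t] ramp'_bounds(1)[OF a t(1)] by (intro mult_left_mono) auto
      also have "\<dots> = C * (t * ?r')" by simp
      also have "\<dots> \<le> C * 2" using ramp'_bounds(2)[OF a t(1)] C0 by (rule mult_left_mono)
      finally show ?thesis by simp
    qed
    have s': "?s' * \<bar>y t\<bar> \<le> 2 * C"
    proof -
      have "?s' * \<bar>y t\<bar> \<le> ?s' * (C * (T - t))"
        using C[OF t] ramp'_bounds(1)[OF a t'] by (intro mult_left_mono) auto
      also have "\<dots> = C * ((T - t) * ?s')" by simp
      also have "\<dots> \<le> C * 2" using ramp'_bounds(2)[OF a t'] C0 by (rule mult_left_mono)
      finally show ?thesis by simp
    qed
    have "\<bar>(?r * ?s) * y' t\<bar> \<le> C"
      using mult_mono[OF rs1(2), of "\<bar>y' t\<bar>" C] C[OF t] rs by (simp add: abs_mult)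
    moreover have "\<bar>(?r * (- ?s')) * y t\<bar> \<le> 2 * C"
      using mult_mono[OF rs(2) s'] C0 rs(1) ramp'_bounds(1)[OF a t', of n] by (simp add: abs_mult mult.assoc)
    moreover have "\<bar>(?r' * ?s) * y t\<bar> \<le> 2 * C"
      using mult_mono[OF rs(4) r'] C0 rs(3) ramp'_bounds(1)[OF a t(1), of n]
      by (simp add: abs_mult mult.assoc mult.left_commute)
    ultimately show "\<bar>\<psi> n t\<bar> \<le> 5 * C" unfolding \<psi>_def distrib_right by linarith
  qed
  have \<phi>lim: "(\<lambda>n. \<phi> n t) \<longlonglongrightarrow> y t" and \<psi>lim: "(\<lambda>n. \<psi> n t) \<longlonglongrightarrow> y' t" if t: "0 < t" "t < T" for t
  proof -
    have t': "0 < T - t" using t by simp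
    note l = ramp_limits[OF t(1), folded a_def] ramp_limits[OF t', folded a_def]
    have "(\<lambda>n. \<phi> n t) \<longlonglongrightarrow> (1 * 1) * y t" unfolding \<phi>_def by (intro tendsto_intros l)
    then show "(\<lambda>n. \<phi> n t) \<longlonglongrightarrow> y t" by simp
    have "(\<lambda>n. \<psi> n t) \<longlonglongrightarrow> (1 * 1) * y' t + (1 * (- 0) + 0 * 1) * y t"
      unfolding \<psi>_def by (intro tendsto_intros l)
    then show "(\<lambda>n. \<psi> n t) \<longlonglongrightarrow> y' t" by simp
  qed
  have m: "h \<in> borel_measurable (Xi T)" if "continuous_on UNIV h" for h :: "real \<Rightarrow> real"
    by (rule borel_measurable_strongly_measurable[OF strongly_measurable_continuous[OF that]])
  have "(\<lambda>n. \<integral>t. \<psi> n t * f t \<partial>Xi T) \<longlonglongrightarrow> (\<integral>t. y' t * f t \<partial>Xi T)"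
  proof (rule integral_dominated_convergence[where w="\<lambda>t. 5 * C * \<bar>f t\<bar>"])
    show "(\<lambda>t. y' t * f t) \<in> borel_measurable (Xi T)"
      by (intro borel_measurable_times m C1_pairD(2)[OF y] borel_measurable_integrable[OF fi])
    show "(\<lambda>t. \<psi> n t * f t) \<in> borel_measurable (Xi T)" for n
      by (intro borel_measurable_times m C1_pairD(2)[OF \<phi>\<psi>] borel_measurable_integrable[OF fi])
    show "integrable (Xi T) (\<lambda>t. 5 * C * \<bar>f t\<bar>)" using fi by simp
    show "AE t in Xi T. (\<lambda>n. \<psi> n t * f t) \<longlonglongrightarrow> y' t * f t"
      by (intro AE_I2 tendsto_intros \<psi>lim) auto
    show "AE t in Xi T. norm (\<psi> n t * f t) \<le> 5 * C * \<bar>f t\<bar>" for n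
      by (intro AE_I2) (auto simp: abs_mult intro!: mult_right_mono \<psi>le)
  qed
  moreover have "(\<lambda>n. \<integral>t. \<phi> n t * g t \<partial>Xi T) \<longlonglongrightarrow> (\<integral>t. y t * g t \<partial>Xi T)"
  proof (rule integral_dominated_convergence[where w="\<lambda>t. C * T * \<bar>g t\<bar>"])
    show "(\<lambda>t. y t * g t) \<in> borel_measurable (Xi T)"
      by (intro borel_measurable_times m C1_pairD(3)[OF y] borel_measurable_integrable[OF gi])
    show "(\<lambda>t. \<phi> n t * g t) \<in> borel_measurable (Xi T)" for n
      by (intro borel_measurable_times m C1_pairD(3)[OF \<phi>\<psi>] borel_measurable_integrable[OF gi])
    show "integrable (Xi T) (\<lambda>t. C * T * \<bar>g t\<bar>)" using gi by simp
    show "AE t in Xi T. (\<lambda>n. \<phi> n t * g t) \<longlonglongrightarrow> y t * g t"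
      by (intro AE_I2 tendsto_intros \<phi>lim) auto
    show "AE t in Xi T. norm (\<phi> n t * g t) \<le> C * T * \<bar>g t\<bar>" for n
      by (intro AE_I2) (auto simp: abs_mult intro!: mult_right_mono \<phi>le)
  qed
  moreover have "(\<integral>t. \<psi> n t * f t \<partial>Xi T) = - (\<integral>t. \<phi> n t * g t \<partial>Xi T)" for n
    using weak[OF test[of n]] by (simp add: der)
  ultimately have "(\<lambda>n. - (\<integral>t. \<phi> n t * g t \<partial>Xi T)) \<longlonglongrightarrow> (\<integral>t. y' t * f t \<partial>Xi T)"
    "(\<lambda>n. - (\<integral>t. \<phi> n t * g t \<partial>Xi T)) \<longlonglongrightarrow> - (\<integral>t. y t * g t \<partial>Xi T)"
    by (auto intro: tendsto_minus)
  then show ?thesis by (rule LIMSEQ_unique)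
qed

section \<open>Linear differential equations in time\<close>

lemma antiderivative_real:
  fixes f :: "real \<Rightarrow> real"
  assumes f: "continuous_on UNIV f"
  obtains F where "\<And>t. (F has_real_derivative f t) (at t)" "F 0 = 0"
proof -
  define F where "F u = (LBINT y=0..ereal u. f y)" for u :: real
  have "(F has_real_derivative f t) (at t)" for t
  proof -
    define b where "b = \<bar>t\<bar> + 1"
    have "(F has_vector_derivative f t) (at t within {-b..b})"
      using interval_integral_FTC2[of "-b" 0 b f t] continuous_on_subset[OF f]
      by (auto simp: b_def zero_ereal_def F_def[abs_def])
    moreover have "at t within {-b..b} = at t"
      by (rule at_within_interior) (auto simp: b_def)
    ultimately show ?thesis by (simp add: has_real_derivative_iff_has_vector_derivative)
  qed
  moreover have "F 0 = 0" by (simp add: zero_ereal_def F_def)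
  ultimately show thesis by (rule that)
qed

text \<open>
  Variation of constants.
\<close>

lemma linear_ode_solvable:
  fixes \<phi> :: "real \<Rightarrow> real"
  assumes \<phi>: "continuous_on UNIV \<phi>"
  shows "\<exists>y. C1_pair y (\<lambda>t. lam * (\<phi> t - y t)) \<and> y 0 = 0"
proof -
  have "continuous_on UNIV (\<lambda>t. lam * exp (lam * t) * \<phi> t)" by (intro continuous_intros \<phi>)
  then obtain P where P: "\<And>t. (P has_real_derivative lam * exp (lam * t) * \<phi> t) (at t)" "P 0 = 0"
    by (rule antiderivative_real) blast
  define y where "y t = exp (- lam * t) * P t" for t
  have e: "exp (- lam * t) * exp (lam * t) = 1" for t by (simp flip: exp_add)
  have d: "(y has_real_derivative lam * (\<phi> t - y t)) (at t)" for t
  proof -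
    have "(y has_real_derivative (- lam * exp (- lam * t)) * P t + (lam * exp (lam * t) * \<phi> t) * exp (- lam * t)) (at t)"
      unfolding y_def[abs_def] by (rule derivative_eq_intros P refl | simp)+
    moreover have "(- lam * exp (- lam * t)) * P t + (lam * exp (lam * t) * \<phi> t) * exp (- lam * t)
        = lam * (\<phi> t * (exp (- lam * t) * exp (lam * t)) - y t)"
      by (simp only: y_def) (simp only: algebra_simps)
    ultimately show ?thesis by (simp only: e mult_1_right)
  qed
  then have "continuous_on UNIV y"
    by (meson DERIV_isCont continuous_at_imp_continuous_on)
  then have "continuous_on UNIV (\<lambda>t. lam * (\<phi> t - y t))" by (intro continuous_intros \<phi>)
  then show ?thesis using d P(2) unfolding C1_pair_real by (intro exI[of _ y]) (simp add: y_def)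
qed

text \<open>
  The problem is \<open>y - \<kappa>\<^sup>2 y'' = \<phi>\<close> with \<open>y 0 = y T = 0\<close>. The factorization
  \<open>(1 - \<kappa> d/dt) (1 + \<kappa> d/dt)\<close> reduces a particular solution to two first order problems, and a
  multiple of \<open>sinh (t / \<kappa>)\<close> corrects the value at \<open>T\<close>.
\<close>

lemma dirichlet_solvable_real:
  fixes \<phi> :: "real \<Rightarrow> real"
  assumes \<phi>: "continuous_on UNIV \<phi>" and \<kappa>: "0 < \<kappa>" and T: "0 < T"
  shows "\<exists>y y'. C1_pair y y' \<and> C1_pair y' (\<lambda>t. (y t - \<phi> t) / \<kappa>\<^sup>2) \<and> y 0 = 0 \<and> y T = 0"
proof -
  define l where "l = 1 / \<kappa>"
  have l: "0 < l" "l\<^sup>2 = 1 / \<kappa>\<^sup>2" using \<kappa> by (auto simp: l_def power_divide)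
  obtain y1 where y1: "C1_pair y1 (\<lambda>t. l * (\<phi> t - y1 t))"
    using linear_ode_solvable[OF \<phi>, of l] by blast
  obtain y2 where y2: "C1_pair y2 (\<lambda>t. (- l) * (y1 t - y2 t))" "y2 0 = 0"
    using linear_ode_solvable[OF C1_pairD(3)[OF y1], of "- l"] by blast
  define \<alpha> where "\<alpha> = - y2 T / sinh (l * T)"
  define y where "y t = y2 t + \<alpha> * sinh (l * t)" for t
  define y' where "y' t = (- l) * (y1 t - y2 t) + \<alpha> * (l * cosh (l * t))" for t
  have d1: "(y1 has_real_derivative l * (\<phi> t - y1 t)) (at t)" for t using y1 by (simp add: C1_pair_real)
  have d2: "(y2 has_real_derivative (- l) * (y1 t - y2 t)) (at t)" for t using y2 by (simp add: C1_pair_real)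
  have dy: "(y has_real_derivative y' t) (at t)" for t
    unfolding y_def[abs_def] y'_def
    by (rule derivative_eq_intros d2 refl | simp)+
  have dy': "(y' has_real_derivative (y t - \<phi> t) / \<kappa>\<^sup>2) (at t)" for t
  proof -
    have "(y' has_real_derivative (- l) * (l * (\<phi> t - y1 t) - (- l) * (y1 t - y2 t)) + \<alpha> * (l * (sinh (l * t) * l))) (at t)"
      unfolding y'_def[abs_def] by (rule derivative_eq_intros d1 d2 refl | simp)+
    moreover have "(- l) * (l * (\<phi> t - y1 t) - (- l) * (y1 t - y2 t)) + \<alpha> * (l * (sinh (l * t) * l))
        = (y t - \<phi> t) * l\<^sup>2"
      by (simp add: y_def algebra_simps power2_eq_square)
    ultimately show ?thesis using l(2) by (simp only:) simp
  qed
  have cy: "continuous_on UNIV y" "continuous_on UNIV y'"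
    using dy dy' by (auto intro!: continuous_at_imp_continuous_on DERIV_isCont)
  then have "continuous_on UNIV (\<lambda>t. (y t - \<phi> t) / \<kappa>\<^sup>2)" using \<kappa> by (intro continuous_intros \<phi>) auto
  moreover have "sinh (l * T) \<noteq> 0" using l T by simp
  then have "y 0 = 0" "y T = 0" using y2(2) by (simp_all add: y_def \<alpha>_def)
  ultimately show ?thesis using dy dy' cy unfolding C1_pair_real by blast
qed

lemma dirichlet_solvable:
  fixes x :: "real \<Rightarrow> 'b::real_normed_vector"
  assumes x: "x \<in> span (D0 T)" and \<kappa>: "0 < \<kappa>" and T: "0 < T"
  shows "\<exists>q q' q''. C1_pair q q' \<and> C1_pair q' q'' \<and> (\<forall>t. \<kappa>\<^sup>2 *\<^sub>R q'' t = q t - x t) \<and> q \<in> span (D0 T)"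
  using x
proof (induction rule: span_induct_alt)
  case base
  show ?case
    by (intro exI[of _ 0] conjI allI C1_pair_0 span_zero; simp)
next
  case (step c x r)
  obtain q q' q'' where q: "C1_pair q q'" "C1_pair q' q''" "\<And>t. \<kappa>\<^sup>2 *\<^sub>R q'' t = q t - r t"
    "q \<in> span (D0 T)" using step.IH by auto
  from step.hyps obtain \<phi> \<phi>' v where x: "x = (\<lambda>t. \<phi> t *\<^sub>R v)" "C1_pair \<phi> \<phi>'"
    by (auto simp: D0_def)
  obtain y y' where y: "C1_pair y y'" "C1_pair y' (\<lambda>t. (y t - \<phi> t) / \<kappa>\<^sup>2)" "y 0 = 0" "y T = 0"
    using dirichlet_solvable_real[OF C1_pairD(3)[OF x(2)] \<kappa> T] by blast
  let ?q = "c *\<^sub>R (\<lambda>t. y t *\<^sub>R v) + q" and ?q' = "c *\<^sub>R (\<lambda>t. y' t *\<^sub>R v) + q'"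
  let ?q'' = "c *\<^sub>R (\<lambda>t. ((y t - \<phi> t) / \<kappa>\<^sup>2) *\<^sub>R v) + q''"
  have "C1_pair ?q ?q'" "C1_pair ?q' ?q''"
    by (intro C1_pair_add C1_pair_scale C1_pair_scaleR_vec y q)+
  moreover have "\<kappa>\<^sup>2 *\<^sub>R ?q'' t = ?q t - (c *\<^sub>R x + r) t" for t
  proof -
    have k: "\<kappa>\<^sup>2 * (c * ((y t - \<phi> t) / \<kappa>\<^sup>2)) = c * (y t - \<phi> t)" using \<kappa> by simp
    have "\<kappa>\<^sup>2 *\<^sub>R ?q'' t = (\<kappa>\<^sup>2 * (c * ((y t - \<phi> t) / \<kappa>\<^sup>2))) *\<^sub>R v + \<kappa>\<^sup>2 *\<^sub>R q'' t"
      by (simp only: plus_fun_apply scaleR_fun_def scaleR_right_distrib scaleR_scaleR)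
    also have "\<dots> = (c * (y t - \<phi> t)) *\<^sub>R v + (q t - r t)" by (simp only: k q(3))
    also have "\<dots> = ?q t - (c *\<^sub>R x + r) t" by (simp add: scaleR_fun_def x(1) algebra_simps)
    finally show ?thesis .
  qed
  moreover have "?q \<in> span (D0 T)"
    by (intro span_add span_scale span_base D0I[OF y(1,3,4)] q(4))
  ultimately show ?case by blast
qed

text \<open>
  If \<open>p\<close> solves the Dirichlet problem with right-hand side \<open>\<phi>'\<close>, then \<open>\<phi> + \<kappa>\<^sup>2 p'\<close> has derivative
  \<open>p\<close> and solves the Neumann problem with right-hand side \<open>\<phi>\<close>.
\<close>

lemma neumann_solvable:
  fixes s :: "real \<Rightarrow> 'b::real_normed_vector"
  assumes s: "s \<in> span (D0 T)" and \<kappa>: "0 < \<kappa>" and T: "0 < T"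
  shows "\<exists>z z' z''. C1_pair z z' \<and> C1_pair z' z'' \<and> (\<forall>t. \<kappa>\<^sup>2 *\<^sub>R z'' t = z t - s t) \<and> z' 0 = 0 \<and> z' T = 0"
  using s
proof (induction rule: span_induct_alt)
  case base
  show ?case
    by (intro exI[of _ 0] conjI allI C1_pair_0; simp)
next
  case (step c x r)
  obtain q q' q'' where q: "C1_pair q q'" "C1_pair q' q''" "\<And>t. \<kappa>\<^sup>2 *\<^sub>R q'' t = q t - r t"
    "q' 0 = 0" "q' T = 0" using step.IH by auto
  from step.hyps obtain \<phi> \<phi>' v where x: "x = (\<lambda>t. \<phi> t *\<^sub>R v)" "C1_pair \<phi> \<phi>'"
    by (auto simp: D0_def)
  obtain p p' where p: "C1_pair p p'" "C1_pair p' (\<lambda>t. (p t - \<phi>' t) / \<kappa>\<^sup>2)" "p 0 = 0" "p T = 0"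
    using dirichlet_solvable_real[OF C1_pairD(2)[OF x(2)] \<kappa> T] by blast
  define y where "y t = \<phi> t + \<kappa>\<^sup>2 * p' t" for t
  have y: "C1_pair y p"
  proof -
    have "C1_pair (\<phi> + \<kappa>\<^sup>2 *\<^sub>R p') (\<phi>' + \<kappa>\<^sup>2 *\<^sub>R (\<lambda>t. (p t - \<phi>' t) / \<kappa>\<^sup>2))"
      by (intro C1_pair_add C1_pair_scale x p)
    moreover have "\<phi> + \<kappa>\<^sup>2 *\<^sub>R p' = y" by (rule ext) (simp add: scaleR_fun_def y_def)
    moreover have "\<phi>' + \<kappa>\<^sup>2 *\<^sub>R (\<lambda>t. (p t - \<phi>' t) / \<kappa>\<^sup>2) = p"
      using \<kappa> by (intro ext) (simp add: scaleR_fun_def)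
    ultimately show ?thesis by simp
  qed
  let ?q = "c *\<^sub>R (\<lambda>t. y t *\<^sub>R v) + q" and ?q' = "c *\<^sub>R (\<lambda>t. p t *\<^sub>R v) + q'"
  let ?q'' = "c *\<^sub>R (\<lambda>t. p' t *\<^sub>R v) + q''"
  have "C1_pair ?q ?q'" "C1_pair ?q' ?q''"
    by (intro C1_pair_add C1_pair_scale C1_pair_scaleR_vec y p q)+
  moreover have "\<kappa>\<^sup>2 *\<^sub>R ?q'' t = ?q t - (c *\<^sub>R x + r) t" for t
    using q(3)[of t] by (simp add: scaleR_fun_def x(1) y_def scaleR_right_distrib algebra_simps)
  moreover have "?q' 0 = 0" "?q' T = 0" using p q by (simp_all add: scaleR_fun_def)
  ultimately show ?case by blast
qed

lemma smoothing_solvable: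
  fixes s :: "real \<Rightarrow> 'b::real_normed_vector"
  assumes s: "s \<in> span (D0 T)"
  shows "\<exists>z z'. C1_pair z z' \<and> (\<forall>t. z' t = lam *\<^sub>R (s t - z t)) \<and> z 0 = 0"
  using s
proof (induction rule: span_induct_alt)
  case base
  show ?case
    by (intro exI[of _ 0] conjI allI C1_pair_0; simp)
next
  case (step c x r)
  obtain q q' where q: "C1_pair q q'" "\<And>t. q' t = lam *\<^sub>R (r t - q t)" "q 0 = 0"
    using step.IH by auto
  from step.hyps obtain \<phi> \<phi>' v where x: "x = (\<lambda>t. \<phi> t *\<^sub>R v)" "C1_pair \<phi> \<phi>'"
    by (auto simp: D0_def)
  obtain y where y: "C1_pair y (\<lambda>t. lam * (\<phi> t - y t))" "y 0 = 0"
    using linear_ode_solvable[OF C1_pairD(3)[OF x(2)]] by blast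
  let ?q = "c *\<^sub>R (\<lambda>t. y t *\<^sub>R v) + q" and ?q' = "c *\<^sub>R (\<lambda>t. (lam * (\<phi> t - y t)) *\<^sub>R v) + q'"
  have "C1_pair ?q ?q'" by (intro C1_pair_add C1_pair_scale C1_pair_scaleR_vec y q)
  moreover have "?q' t = lam *\<^sub>R ((c *\<^sub>R x + r) t - ?q t)" for t
    using q(2)[of t] by (simp add: scaleR_fun_def x(1) algebra_simps)
  moreover have "?q 0 = 0" using y q by (simp add: scaleR_fun_def)
  ultimately show ?case by blast
qed

section \<open>The time derivative as a functional\<close>

lemma bounded_bilinear_H: "bounded_bilinear (\<lambda>x y. blinfun_apply \<iota> x \<bullet> blinfun_apply \<iota> y)"
  by (rule bounded_bilinear.comp[OF bounded_bilinear_inner blinfun.bounded_linear_right blinfun.bounded_linear_right])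

text \<open>
  The inner product of \<open>L\<^sub>2(0,T;H)\<close> for functions with values in \<open>V\<close>. It equals the pairing of
  \<open>emb_dual \<iota> (z t)\<close> in \<open>V'\<close> with \<open>x t\<close> in \<open>V\<close>.
\<close>

definition H_ip ::
    "real \<Rightarrow> ('v::real_inner \<Rightarrow>\<^sub>L 'h::real_inner) \<Rightarrow> (real \<Rightarrow> 'v) \<Rightarrow> (real \<Rightarrow> 'v) \<Rightarrow> real" where
  "H_ip T \<iota> z x = (\<integral>t. \<iota> (z t) \<bullet> \<iota> (x t) \<partial>Xi T)"

definition duality :: "real \<Rightarrow> (real \<Rightarrow> 'v::real_inner \<Rightarrow>\<^sub>L real) \<Rightarrow> (real \<Rightarrow> 'v) \<Rightarrow> real" where
  "duality T G x = (\<integral>t. G t (x t) \<partial>Xi T)"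

lemma integral_bilinear_right:
  assumes B: "bounded_bilinear (B :: 'b::real_normed_vector \<Rightarrow> 'c::real_normed_vector \<Rightarrow> real)"
    and w: "w \<in> L2 T" and x: "x \<in> L2 T" and y: "y \<in> L2 T"
  shows "(\<integral>t. B (w t) ((x - y) t) \<partial>Xi T) = (\<integral>t. B (w t) (x t) \<partial>Xi T) - (\<integral>t. B (w t) (y t) \<partial>Xi T)"
    and "(\<integral>t. B (w t) ((x + y) t) \<partial>Xi T) = (\<integral>t. B (w t) (x t) \<partial>Xi T) + (\<integral>t. B (w t) (y t) \<partial>Xi T)"
    and "(\<integral>t. B (w t) ((c *\<^sub>R x) t) \<partial>Xi T) = c * (\<integral>t. B (w t) (x t) \<partial>Xi T)"
proof -
  interpret bounded_bilinear B by (rule B)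
  note i = L2_bilinear_integrable[OF B w x] L2_bilinear_integrable[OF B w y]
  show "(\<integral>t. B (w t) ((x - y) t) \<partial>Xi T) = (\<integral>t. B (w t) (x t) \<partial>Xi T) - (\<integral>t. B (w t) (y t) \<partial>Xi T)"
    using i by (simp add: diff_right)
  show "(\<integral>t. B (w t) ((x + y) t) \<partial>Xi T) = (\<integral>t. B (w t) (x t) \<partial>Xi T) + (\<integral>t. B (w t) (y t) \<partial>Xi T)"
    using i by (simp add: add_right)
  show "(\<integral>t. B (w t) ((c *\<^sub>R x) t) \<partial>Xi T) = c * (\<integral>t. B (w t) (x t) \<partial>Xi T)"
    by (simp add: scaleR_fun_def scaleR_right)
qed

lemma integral_bilinear_left:
  assumes B: "bounded_bilinear (B :: 'b::real_normed_vector \<Rightarrow> 'c::real_normed_vector \<Rightarrow> real)"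
    and w: "w \<in> L2 T" and x: "x \<in> L2 T" and y: "y \<in> L2 T"
  shows "(\<integral>t. B ((x - y) t) (w t) \<partial>Xi T) = (\<integral>t. B (x t) (w t) \<partial>Xi T) - (\<integral>t. B (y t) (w t) \<partial>Xi T)"
    and "(\<integral>t. B ((x + y) t) (w t) \<partial>Xi T) = (\<integral>t. B (x t) (w t) \<partial>Xi T) + (\<integral>t. B (y t) (w t) \<partial>Xi T)"
    and "(\<integral>t. B ((c *\<^sub>R x) t) (w t) \<partial>Xi T) = c * (\<integral>t. B (x t) (w t) \<partial>Xi T)"
  using integral_bilinear_right[OF bounded_bilinear.flip[OF B] w x y] by auto

lemma H_ip_right:
  assumes "w \<in> L2 T" "x \<in> L2 T" "y \<in> L2 T"
  shows "H_ip T \<iota> w (x - y) = H_ip T \<iota> w (x) - H_ip T \<iota> w (y)"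
    and "H_ip T \<iota> w (x + y) = H_ip T \<iota> w (x) + H_ip T \<iota> w (y)"
    and "H_ip T \<iota> w (c *\<^sub>R x) = c * H_ip T \<iota> w (x)"
  unfolding H_ip_def by (rule integral_bilinear_right[OF bounded_bilinear_H assms])+

lemma H_ip_left:
  assumes "w \<in> L2 T" "x \<in> L2 T" "y \<in> L2 T"
  shows "H_ip T \<iota> (x - y) w = H_ip T \<iota> (x) w - H_ip T \<iota> (y) w"
    and "H_ip T \<iota> (x + y) w = H_ip T \<iota> (x) w + H_ip T \<iota> (y) w"
    and "H_ip T \<iota> (c *\<^sub>R x) w = c * H_ip T \<iota> (x) w"
  unfolding H_ip_def by (rule integral_bilinear_left[OF bounded_bilinear_H assms])+

lemma duality_right:
  assumes "w \<in> L2 T" "x \<in> L2 T" "y \<in> L2 T"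
  shows "duality T w (x - y) = duality T w (x) - duality T w (y)"
    and "duality T w (x + y) = duality T w (x) + duality T w (y)"
    and "duality T w (c *\<^sub>R x) = c * duality T w (x)"
  unfolding duality_def by (rule integral_bilinear_right[OF bounded_bilinear_blinfun_apply assms])+

lemma duality_left:
  assumes "w \<in> L2 T" "x \<in> L2 T" "y \<in> L2 T"
  shows "duality T (x - y) w = duality T (x) w - duality T (y) w"
    and "duality T (x + y) w = duality T (x) w + duality T (y) w"
    and "duality T (c *\<^sub>R x) w = c * duality T (x) w"
  unfolding duality_def by (rule integral_bilinear_left[OF bounded_bilinear_blinfun_apply assms])+

lemma H_ip_sym: "H_ip T \<iota> z x = H_ip T \<iota> x z"
  by (simp add: H_ip_def inner_commute)

lemma H_ip_bound:
  assumes "z \<in> L2 T" "x \<in> L2 T"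
  shows "\<bar>H_ip T \<iota> z x\<bar> \<le> (norm \<iota>)\<^sup>2 * (L2_norm T z * L2_norm T x)"
  unfolding H_ip_def
proof (rule L2_bilinear_bound[OF bounded_bilinear_H _ _ assms])
  fix x y
  have "\<bar>\<iota> x \<bullet> \<iota> y\<bar> \<le> norm (\<iota> x) * norm (\<iota> y)" by (rule Cauchy_Schwarz_ineq2)
  also have "\<dots> \<le> (norm \<iota> * norm x) * (norm \<iota> * norm y)" by (intro mult_mono norm_blinfun) auto
  finally show "\<bar>\<iota> x \<bullet> \<iota> y\<bar> \<le> (norm \<iota>)\<^sup>2 * (norm x * norm y)" by (simp add: power2_eq_square algebra_simps)
qed simp

lemma duality_bound:
  assumes "G \<in> L2 T" "x \<in> L2 T"
  shows "\<bar>duality T G x\<bar> \<le> L2_norm T G * L2_norm T x"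
  unfolding duality_def
proof -
  have "\<bar>blinfun_apply f y\<bar> \<le> 1 * (norm f * norm y)" for f :: "'a \<Rightarrow>\<^sub>L real" and y
    using norm_blinfun[of f y] by simp
  from L2_bilinear_bound[OF bounded_bilinear_blinfun_apply this zero_le_one assms]
  show "\<bar>\<integral>t. G t (x t) \<partial>Xi T\<bar> \<le> L2_norm T G * L2_norm T x" by simp
qed

lemma H_ip_by_parts:
  assumes "C1_pair z z'" "C1_pair w w'" "0 \<le> T"
  shows "H_ip T \<iota> z' w + H_ip T \<iota> z w' = \<iota> (z T) \<bullet> \<iota> (w T) - \<iota> (z 0) \<bullet> \<iota> (w 0)"
  unfolding H_ip_def by (rule integral_by_parts_C1[OF bounded_bilinear_H assms])

lemma emb_dual_apply [simp]: "blinfun_apply (emb_dual \<iota> v) x = \<iota> v \<bullet> \<iota> x"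
  by (simp add: emb_dual_def)

lemma bounded_linear_emb_dual: "bounded_linear (emb_dual \<iota>)"
proof (rule bounded_linear_intro[where K="norm \<iota> * norm \<iota>"])
  show "emb_dual \<iota> (x + y) = emb_dual \<iota> x + emb_dual \<iota> y" for x y
    by (rule blinfun_eqI) (simp add: blinfun.add_left blinfun.add_right inner_add_left)
  show "emb_dual \<iota> (c *\<^sub>R x) = c *\<^sub>R emb_dual \<iota> x" for c x
    by (rule blinfun_eqI) (simp add: blinfun.scaleR_left blinfun.scaleR_right)
  show "norm (emb_dual \<iota> x) \<le> norm x * (norm \<iota> * norm \<iota>)" for x
  proof (rule norm_blinfun_bound)
    fix y
    have "\<bar>\<iota> x \<bullet> \<iota> y\<bar> \<le> norm (\<iota> x) * norm (\<iota> y)" by (rule Cauchy_Schwarz_ineq2)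
    also have "\<dots> \<le> (norm \<iota> * norm x) * (norm \<iota> * norm y)" by (intro mult_mono norm_blinfun) auto
    finally show "norm (emb_dual \<iota> x y) \<le> norm x * (norm \<iota> * norm \<iota>) * norm y"
      by (simp add: algebra_simps)
  qed simp
qed

lemma C1_pair_unique:
  assumes "C1_pair z z'" "C1_pair z z''"
  shows "z' = z''"
  using C1_pairD(1)[OF assms(1)] C1_pairD(1)[OF assms(2)] by (intro ext vector_derivative_unique_at)

lemma weak_derivative_span_D0:
  fixes w :: "real \<Rightarrow> 'v::real_inner"
  assumes w: "w \<in> L2 T" and G: "G \<in> L2 T" and weak: "weak_derivative T (\<lambda>t. emb_dual \<iota> (w t)) G"
    and q: "q \<in> span (D0 T)" and qq: "C1_pair q q'"
  shows "H_ip T \<iota> w q' = - duality T G q"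
proof -
  have "\<exists>q'. C1_pair q q' \<and> H_ip T \<iota> w q' = - duality T G q"
    using q
  proof (induction rule: span_induct_alt)
    case base
    have "H_ip T \<iota> w 0 = - duality T G 0" by (simp add: H_ip_def duality_def)
    then show ?case using C1_pair_0 by blast
  next
    case (step c x r)
    obtain r' where r: "C1_pair r r'" "H_ip T \<iota> w r' = - duality T G r" using step.IH by auto
    from step.hyps obtain \<phi> \<phi>' v where x: "x = (\<lambda>t. \<phi> t *\<^sub>R v)" "C1_pair \<phi> \<phi>'" "\<phi> 0 = 0" "\<phi> T = 0"
      by (auto simp: D0_def)
    let ?x' = "\<lambda>t. \<phi>' t *\<^sub>R v"
    have x': "C1_pair x ?x'" unfolding x(1) by (rule C1_pair_scaleR_vec[OF x(2)])
    have "(\<integral>t. \<phi>' t * (\<iota> (w t) \<bullet> \<iota> v) \<partial>Xi T) = - (\<integral>t. \<phi> t * G t v \<partial>Xi T)"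
    proof (rule weak_derivative_vanishing_C1[OF _ _ _ x(2-4)])
      show "(\<lambda>t. \<iota> (w t) \<bullet> \<iota> v) \<in> L2 T"
        by (rule L2_linear[OF w bounded_bilinear.bounded_linear_left[OF bounded_bilinear_H]])
      show "(\<lambda>t. G t v) \<in> L2 T" by (rule L2_linear[OF G blinfun.bounded_linear_left])
      show "(\<integral>t. deriv \<phi> t * (\<iota> (w t) \<bullet> \<iota> v) \<partial>Xi T) = - (\<integral>t. \<phi> t * G t v \<partial>Xi T)"
        if "test_function T \<phi>" for \<phi>
        using weak that unfolding weak_derivative_def by simp
    qed
    then have eq: "H_ip T \<iota> w ?x' = - duality T G x"
      by (simp add: H_ip_def duality_def x(1) blinfun.scaleR_right)
    have "H_ip T \<iota> w (c *\<^sub>R ?x' + r') = - duality T G (c *\<^sub>R x + r)"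
    proof -
      note L = C1_pairD(4,5)[OF x'] C1_pairD(4,5)[OF r(1)]
      note L' = subspace_scale[OF subspace_L2 L(1), of c] subspace_scale[OF subspace_L2 L(2), of c]
      show ?thesis
        using H_ip_right(2)[where \<iota>=\<iota>, OF w L'(2) L(4)] H_ip_right(3)[where \<iota>=\<iota> and c=c, OF w L(2) L(2)]
          duality_right(2)[OF G L'(1) L(3)] duality_right(3)[OF G L(1) L(1), of c] eq r(2) by simp
    qed
    moreover have "C1_pair (c *\<^sub>R x + r) (c *\<^sub>R ?x' + r')"
      by (intro C1_pair_add C1_pair_scale x' r)
    ultimately show ?case by blast
  qed
  then show ?thesis using C1_pair_unique[OF qq] by blast
qed

text \<open>
  A bound with the constant \<open>C\<close> on a dense subspace holds everywhere for a functional that is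
  continuous with some constant. With \<open>C = 0\<close> this is uniqueness of a continuous extension.
\<close>

lemma L2_functional_bound_extends:
  fixes \<Phi> :: "(real \<Rightarrow> 'b::real_normed_vector) \<Rightarrow> real"
  assumes diff: "\<And>x y. x \<in> L2 T \<Longrightarrow> y \<in> L2 T \<Longrightarrow> \<Phi> (x - y) = \<Phi> x - \<Phi> y"
    and K: "\<And>x. x \<in> L2 T \<Longrightarrow> \<bar>\<Phi> x\<bar> \<le> K * L2_norm T x"
    and C: "\<And>x. x \<in> span (D0 T) \<Longrightarrow> \<bar>\<Phi> x\<bar> \<le> C * L2_norm T x" "0 \<le> C"
    and x: "x \<in> L2 T"
  shows "\<bar>\<Phi> x\<bar> \<le> C * L2_norm T x"
proof (rule field_le_epsilon)
  fix e :: real assume e: "0 < e"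
  define d where "d = e / (\<bar>K\<bar> + C + 1)"
  have pos: "0 < \<bar>K\<bar> + C + 1" using C(2) by linarith
  then have d: "0 < d" using e by (simp add: d_def)
  obtain s where s: "s \<in> span (D0 T)" "L2_norm T (x - s) < d" using L2_dense[OF x d] by blast
  have sL: "s \<in> L2 T" by (rule span_D0_L2[OF s(1)])
  have "\<bar>\<Phi> x\<bar> \<le> \<bar>\<Phi> (x - s)\<bar> + \<bar>\<Phi> s\<bar>" using diff[OF x sL] by linarith
  also have "\<bar>\<Phi> (x - s)\<bar> \<le> \<bar>K\<bar> * d"
    by (rule order_trans[OF K[OF L2_diff[OF x sL]]]) (use s(2) in \<open>auto intro!: mult_mono\<close>)
  also have "\<bar>\<Phi> s\<bar> \<le> C * (L2_norm T x + d)"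
  proof -
    have "L2_norm T s \<le> L2_norm T x + L2_norm T (s - x)"
      using L2_norm_triangle[OF x L2_diff[OF sL x]] by simp
    also have "L2_norm T (s - x) = L2_norm T (x - s)" using L2_norm_scale[of T "-1" "x - s"] by simp
    finally have "L2_norm T s \<le> L2_norm T x + d" using s(2) by simp
    then show ?thesis by (rule order_trans[OF C(1)[OF s(1)] mult_left_mono[OF _ C(2)]])
  qed
  also have "\<bar>K\<bar> * d + C * (L2_norm T x + d) = C * L2_norm T x + (\<bar>K\<bar> + C) * d" by (simp add: algebra_simps)
  also have "(\<bar>K\<bar> + C) * d \<le> (\<bar>K\<bar> + C + 1) * d" using d by (intro mult_right_mono) auto
  also have "(\<bar>K\<bar> + C + 1) * d = e" using pos by (simp add: d_def)
  finally show "\<bar>\<Phi> x\<bar> \<le> C * L2_norm T x + e" by simp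
qed

text \<open>
  The derivative \<open>ddt\<close> is chosen by Hilbert's epsilon and is determined only almost everywhere; this
  predicate allows to compute with any representative.
\<close>

definition is_ddt ::
    "real \<Rightarrow> ('v::real_inner \<Rightarrow>\<^sub>L 'h::real_inner) \<Rightarrow> (real \<Rightarrow> 'v) \<Rightarrow> (real \<Rightarrow> 'v \<Rightarrow>\<^sub>L real) \<Rightarrow> bool" where
  "is_ddt T \<iota> w G \<longleftrightarrow> w \<in> L2 T \<and> G \<in> L2 T \<and> weak_derivative T (\<lambda>t. emb_dual \<iota> (w t)) G"

lemma Xspace_iff: "w \<in> Xspace T \<iota> \<longleftrightarrow> (\<exists>G. is_ddt T \<iota> w G)"
proof
  assume "w \<in> Xspace T \<iota>"
  then have w: "w \<in> L2 T" and F: "(\<lambda>t. emb_dual \<iota> (w t)) \<in> H1 T" by (simp_all add: Xspace_def)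
  from F obtain G where "G \<in> L2 T" "weak_derivative T (\<lambda>t. emb_dual \<iota> (w t)) G"
    unfolding H1_def by blast
  with w show "\<exists>G. is_ddt T \<iota> w G" unfolding is_ddt_def by blast
next
  assume "\<exists>G. is_ddt T \<iota> w G"
  then obtain G where G: "w \<in> L2 T" "G \<in> L2 T" "weak_derivative T (\<lambda>t. emb_dual \<iota> (w t)) G"
    unfolding is_ddt_def by blast
  moreover have "(\<lambda>t. emb_dual \<iota> (w t)) \<in> L2 T" by (rule L2_linear[OF G(1) bounded_linear_emb_dual])
  ultimately have "(\<lambda>t. emb_dual \<iota> (w t)) \<in> H1 T" unfolding H1_def by blast
  with G(1) show "w \<in> Xspace T \<iota>" unfolding Xspace_def by simp
qed

lemma is_ddt_span_D0:
  assumes "is_ddt T \<iota> w G" "q \<in> span (D0 T)" "C1_pair q q'"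
  shows "H_ip T \<iota> w q' = - duality T G q"
  using weak_derivative_span_D0 assms unfolding is_ddt_def by blast

text \<open>
  Two weak derivatives agree when paired with the dense subspace \<open>span (D0 T)\<close>, hence with all of
  \<open>L2 T\<close>. No statement about their values at single times is involved, so that null sets depending
  on the direction in \<open>V\<close> do not arise.
\<close>

lemma is_ddt_unique:
  assumes G1: "is_ddt T \<iota> w G1" and G2: "is_ddt T \<iota> w G2" and x: "x \<in> L2 T"
  shows "duality T G1 x = duality T G2 x"
proof -
  have L: "G1 \<in> L2 T" "G2 \<in> L2 T" using assms by (auto simp: is_ddt_def)
  have "\<bar>duality T (G1 - G2) x\<bar> \<le> 0 * L2_norm T x"
  proof (rule L2_functional_bound_extends[OF _ _ _ _ x])
    show "duality T (G1 - G2) (x - y) = duality T (G1 - G2) x - duality T (G1 - G2) y"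
      if "x \<in> L2 T" "y \<in> L2 T" for x y
      by (rule duality_right(1)[OF L2_diff[OF L] that])
    show "\<bar>duality T (G1 - G2) x\<bar> \<le> L2_norm T (G1 - G2) * L2_norm T x" if "x \<in> L2 T" for x
      by (rule duality_bound[OF L2_diff[OF L] that])
    show "\<bar>duality T (G1 - G2) s\<bar> \<le> 0 * L2_norm T s" if s: "s \<in> span (D0 T)" for s
    proof -
      obtain s' where s': "C1_pair s s'" using span_D0_C1[OF s] by blast
      show ?thesis
        using is_ddt_span_D0[OF G1 s s'] is_ddt_span_D0[OF G2 s s'] duality_left(1)[OF span_D0_L2[OF s] L] by simp
    qed
  qed simp
  then show ?thesis using duality_left(1)[OF x L] by simp
qed

lemma dt_eq_duality:
  assumes G: "is_ddt T \<iota> w G" and v: "v \<in> L2 T"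
  shows "dt T \<iota> w v = duality T G v"
proof -
  have "ddt T \<iota> w \<in> L2 T \<and> weak_derivative T (\<lambda>t. emb_dual \<iota> (w t)) (ddt T \<iota> w)"
  proof -
    have "\<exists>G. G \<in> L2 T \<and> weak_derivative T (\<lambda>t. emb_dual \<iota> (w t)) G"
      using G unfolding is_ddt_def by blast
    from someI_ex[OF this] show ?thesis unfolding ddt_def .
  qed
  then have "is_ddt T \<iota> w (ddt T \<iota> w)" using G by (simp add: is_ddt_def)
  from is_ddt_unique[OF this G v] show ?thesis by (simp add: dt_def duality_def)
qed

lemma test_function_C1:
  assumes "test_function T \<phi>"
  shows "C1_pair \<phi> (deriv \<phi>)" "\<phi> 0 = 0" "\<phi> T = 0"
proof -
  from assms obtain D where D: "\<And>t. (\<phi> has_vector_derivative D t) (at t)" "continuous_on UNIV D"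
    by (auto simp: test_function_def C1_differentiable_on_def)
  have "D t = deriv \<phi> t" for t
    using D(1)[of t] by (intro DERIV_imp_deriv[symmetric]) (simp add: has_real_derivative_iff_has_vector_derivative)
  then have "D = deriv \<phi>" by (rule ext)
  then show "C1_pair \<phi> (deriv \<phi>)" using D by (simp add: C1_pair_def)
  have "0 \<notin> closure {t. \<phi> t \<noteq> 0}" "T \<notin> closure {t. \<phi> t \<noteq> 0}"
    using assms by (auto simp: test_function_def)
  then show "\<phi> 0 = 0" "\<phi> T = 0" using closure_subset[of "{t. \<phi> t \<noteq> 0}"] by auto
qed

lemma is_ddt_C1:
  assumes z: "C1_pair z z'" and T: "0 \<le> T"
  shows "is_ddt T \<iota> z (\<lambda>t. emb_dual \<iota> (z' t))"
  unfolding is_ddt_def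
proof (intro conjI)
  show "z \<in> L2 T" by (rule C1_pairD(4)[OF z])
  show "(\<lambda>t. emb_dual \<iota> (z' t)) \<in> L2 T" by (rule L2_linear[OF C1_pairD(5)[OF z] bounded_linear_emb_dual])
  show "weak_derivative T (\<lambda>t. emb_dual \<iota> (z t)) (\<lambda>t. emb_dual \<iota> (z' t))"
    unfolding weak_derivative_def
  proof (intro allI impI)
    fix \<phi> v assume "test_function T \<phi>"
    note \<phi> = test_function_C1[OF this]
    have "C1_pair (\<lambda>t. \<iota> (z t) \<bullet> \<iota> v) (\<lambda>t. \<iota> (z' t) \<bullet> \<iota> v)"
      by (rule C1_pair_linear[OF bounded_bilinear.bounded_linear_left[OF bounded_bilinear_H] z])
    from integral_by_parts_C1[OF bounded_bilinear_mult \<phi>(1) this T]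
    show "(\<integral>t. deriv \<phi> t * emb_dual \<iota> (z t) v \<partial>Xi T) = - (\<integral>t. \<phi> t * emb_dual \<iota> (z' t) v \<partial>Xi T)"
      using \<phi>(2,3) by simp
  qed
qed

lemma C1_Xspace: "C1_pair z z' \<Longrightarrow> 0 \<le> T \<Longrightarrow> z \<in> Xspace T \<iota>"
  unfolding Xspace_iff by (rule exI, rule is_ddt_C1)

lemma dt_C1:
  assumes "C1_pair z z'" "0 \<le> T" "v \<in> L2 T"
  shows "dt T \<iota> z v = H_ip T \<iota> z' v"
  using dt_eq_duality[OF is_ddt_C1[OF assms(1,2)] assms(3)] by (simp add: duality_def H_ip_def)

lemma is_ddt_combination:
  assumes w: "is_ddt T \<iota> w G" and v: "is_ddt T \<iota> v F"
  shows "is_ddt T \<iota> (w + c *\<^sub>R v) (G + c *\<^sub>R F)"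
  unfolding is_ddt_def
proof (intro conjI)
  have L: "w \<in> L2 T" "v \<in> L2 T" "G \<in> L2 T" "F \<in> L2 T" using w v by (auto simp: is_ddt_def)
  show "w + c *\<^sub>R v \<in> L2 T" "G + c *\<^sub>R F \<in> L2 T"
    using L by (auto intro: L2_add subspace_scale[OF subspace_L2])
  show "weak_derivative T (\<lambda>t. emb_dual \<iota> ((w + c *\<^sub>R v) t)) (G + c *\<^sub>R F)"
    unfolding weak_derivative_def
  proof (intro allI impI)
    fix \<phi> x assume t: "test_function T \<phi>"
    note \<phi> = C1_pairD(4,5)[OF test_function_C1(1)[OF t], of T]
    have M: "integrable (Xi T) (\<lambda>t. h t * f t)" if "h \<in> L2 T" "f \<in> L2 T" for h f :: "real \<Rightarrow> real"
      using L2_inner_integrable[OF that] by simp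
    have LL: "(\<lambda>t. \<iota> (w t) \<bullet> \<iota> x) \<in> L2 T" "(\<lambda>t. \<iota> (v t) \<bullet> \<iota> x) \<in> L2 T"
      "(\<lambda>t. G t x) \<in> L2 T" "(\<lambda>t. F t x) \<in> L2 T"
      by (rule L2_linear[OF L(1) bounded_bilinear.bounded_linear_left[OF bounded_bilinear_H]],
          rule L2_linear[OF L(2) bounded_bilinear.bounded_linear_left[OF bounded_bilinear_H]],
          rule L2_linear[OF L(3) blinfun.bounded_linear_left],
          rule L2_linear[OF L(4) blinfun.bounded_linear_left])
    have "(\<integral>t. deriv \<phi> t * emb_dual \<iota> ((w + c *\<^sub>R v) t) x \<partial>Xi T)
        = (\<integral>t. deriv \<phi> t * (\<iota> (w t) \<bullet> \<iota> x) + c * (deriv \<phi> t * (\<iota> (v t) \<bullet> \<iota> x)) \<partial>Xi T)"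
      by (simp add: scaleR_fun_def blinfun.add_right blinfun.scaleR_right inner_add_left algebra_simps)
    also have "\<dots> = (\<integral>t. deriv \<phi> t * (\<iota> (w t) \<bullet> \<iota> x) \<partial>Xi T) + c * (\<integral>t. deriv \<phi> t * (\<iota> (v t) \<bullet> \<iota> x) \<partial>Xi T)"
      using M[OF \<phi>(2) LL(1)] M[OF \<phi>(2) LL(2)] by simp
    also have "\<dots> = - (\<integral>t. \<phi> t * G t x \<partial>Xi T) + c * (- (\<integral>t. \<phi> t * F t x \<partial>Xi T))"
      using w v t unfolding is_ddt_def weak_derivative_def by simp
    also have "\<dots> = - (\<integral>t. \<phi> t * G t x + c * (\<phi> t * F t x) \<partial>Xi T)"
      using M[OF \<phi>(1) LL(3)] M[OF \<phi>(1) LL(4)] by simp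
    also have "\<dots> = - (\<integral>t. \<phi> t * (G + c *\<^sub>R F) t x \<partial>Xi T)"
      by (simp add: scaleR_fun_def blinfun.add_left blinfun.scaleR_left algebra_simps)
    finally show "(\<integral>t. deriv \<phi> t * emb_dual \<iota> ((w + c *\<^sub>R v) t) x \<partial>Xi T)
        = - (\<integral>t. \<phi> t * (G + c *\<^sub>R F) t x \<partial>Xi T)" .
  qed
qed

lemma Xspace_L2: "w \<in> Xspace T \<iota> \<Longrightarrow> w \<in> L2 T"
  by (simp add: Xspace_def)

lemma subspace_Xspace:
  assumes T: "0 \<le> T"
  shows "subspace (Xspace T \<iota>)"
proof (rule subspaceI)
  show z: "0 \<in> Xspace T \<iota>" by (rule C1_Xspace[OF C1_pair_0 T])
  have comb: "w + c *\<^sub>R v \<in> Xspace T \<iota>" if w: "w \<in> Xspace T \<iota>" and v: "v \<in> Xspace T \<iota>" for w v c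
  proof -
    obtain G where G: "is_ddt T \<iota> w G" using w Xspace_iff[of w T \<iota>] by blast
    obtain F where F: "is_ddt T \<iota> v F" using v Xspace_iff[of v T \<iota>] by blast
    show ?thesis unfolding Xspace_iff by (rule exI, rule is_ddt_combination[OF G F])
  qed
  show "w + v \<in> Xspace T \<iota>" if "w \<in> Xspace T \<iota>" "v \<in> Xspace T \<iota>" for w v
    using comb[OF that, of 1] by simp
  show "c *\<^sub>R w \<in> Xspace T \<iota>" if "w \<in> Xspace T \<iota>" for c w
    using comb[OF z that, of c] by simp
qed

lemma dt_combination:
  assumes "w \<in> Xspace T \<iota>" "v \<in> Xspace T \<iota>" "x \<in> L2 T"
  shows "dt T \<iota> (w + c *\<^sub>R v) x = dt T \<iota> w x + c * dt T \<iota> v x"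
proof -
  obtain G F where GF: "is_ddt T \<iota> w G" "is_ddt T \<iota> v F"
    using assms Xspace_iff[of w T \<iota>] Xspace_iff[of v T \<iota>] by blast
  then have L: "G \<in> L2 T" "F \<in> L2 T" by (auto simp: is_ddt_def)
  show ?thesis
    using dt_eq_duality[OF is_ddt_combination[OF GF] assms(3), of c] dt_eq_duality[OF GF(1) assms(3)]
      dt_eq_duality[OF GF(2) assms(3)] duality_left(2)[OF assms(3) L(1) subspace_scale[OF subspace_L2 L(2), of c]]
      duality_left(3)[OF assms(3) L(2) L(2), of c] by simp
qed

lemma dt_dual: "w \<in> Xspace T \<iota> \<Longrightarrow> dt T \<iota> w \<in> dual (L2 T) (L2_norm T)"
proof -
  assume "w \<in> Xspace T \<iota>"
  then obtain G where G: "is_ddt T \<iota> w G" using Xspace_iff[of w T \<iota>] by blast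
  then have L: "G \<in> L2 T" by (simp add: is_ddt_def)
  show ?thesis
  proof (rule dualI)
    fix x y :: "real \<Rightarrow> 'a" and c :: real
    assume x: "x \<in> L2 T"
    show "dt T \<iota> w (c *\<^sub>R x) = c * dt T \<iota> w x"
      using duality_right(3)[OF L x x, of c] dt_eq_duality[OF G] x subspace_scale[OF subspace_L2 x] by simp
    show "\<bar>dt T \<iota> w x\<bar> \<le> L2_norm T G * L2_norm T x"
      using duality_bound[OF L x] dt_eq_duality[OF G x] by simp
    assume y: "y \<in> L2 T"
    show "dt T \<iota> w (x + y) = dt T \<iota> w x + dt T \<iota> w y"
      using duality_right(2)[OF L x y] dt_eq_duality[OF G] x y L2_add[OF x y] by simp
  qed
qed

section \<open>The trace and integration by parts\<close>

lemma L2_ip_left: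
  assumes "w \<in> L2 T" "x \<in> L2 T" "y \<in> L2 T"
  shows "L2_ip T (x - y) w = L2_ip T x w - L2_ip T y w"
    and "L2_ip T (x + y) w = L2_ip T x w + L2_ip T y w"
    and "L2_ip T (c *\<^sub>R x) w = c * L2_ip T x w"
  unfolding L2_ip_def by (rule integral_bilinear_left[OF bounded_bilinear_inner assms])+

lemma L2_ip_right:
  assumes "w \<in> L2 T" "x \<in> L2 T" "y \<in> L2 T"
  shows "L2_ip T w (x - y) = L2_ip T w x - L2_ip T w y"
  unfolding L2_ip_def by (rule integral_bilinear_right[OF bounded_bilinear_inner assms])

lemma L2_ip_by_parts:
  assumes "C1_pair z z'" "C1_pair w w'" "0 \<le> T"
  shows "L2_ip T z' w + L2_ip T z w' = z T \<bullet> w T - z 0 \<bullet> w 0"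
  unfolding L2_ip_def by (rule integral_by_parts_C1[OF bounded_bilinear_inner assms])

lemma square_le_mult_imp_le:
  fixes a b :: real
  assumes "a\<^sup>2 \<le> b * a" "0 \<le> a" "0 \<le> b"
  shows "a \<le> b"
  using assms by (cases "a = 0") (auto simp: power2_eq_square)

text \<open>
  Test the equation with \<open>z\<close>, respectively with \<open>z - s\<close>; the Neumann conditions remove the boundary
  terms. The second bound shows that \<open>z\<close> converges to a differentiable \<open>s\<close> as \<open>\<kappa> \<rightarrow> 0\<close>.
\<close>

lemma neumann_stability:
  fixes z s :: "real \<Rightarrow> 'b::real_inner"
  assumes z: "C1_pair z z'" "C1_pair z' z''" and eq: "\<And>t. \<kappa>\<^sup>2 *\<^sub>R z'' t = z t - s t"
    and bc: "z' 0 = 0" "z' T = 0" and s: "s \<in> L2 T" and T: "0 \<le> T"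
  shows "L2_norm T z \<le> L2_norm T s"
    and "C1_pair s s' \<Longrightarrow> L2_norm T (z - s) \<le> \<bar>\<kappa>\<bar> * L2_norm T s'"
proof -
  note zL = C1_pairD(4,5)[OF z(1), of T] C1_pairD(5)[OF z(2), of T]
  have eq': "\<kappa>\<^sup>2 *\<^sub>R z'' = z - s" by (rule ext) (simp add: scaleR_fun_def eq)
  have ip: "L2_ip T (z - s) w = \<kappa>\<^sup>2 * L2_ip T z'' w" if "w \<in> L2 T" for w
    unfolding eq'[symmetric] by (rule L2_ip_left(3)[OF that zL(3) zL(3)])
  have "L2_ip T z'' z + L2_ip T z' z' = 0"
    using L2_ip_by_parts[OF z(2,1) T] bc by simp
  then have "L2_ip T z'' z = - (L2_norm T z')\<^sup>2" using L2.N_sq[OF zL(2)] by linarith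
  then have "L2_ip T (z - s) z = - (\<kappa>\<^sup>2 * (L2_norm T z')\<^sup>2)" using ip[OF zL(1)] by simp
  moreover have "0 \<le> \<kappa>\<^sup>2 * (L2_norm T z')\<^sup>2" by simp
  ultimately have "(L2_norm T z)\<^sup>2 \<le> L2_ip T s z"
    using L2_ip_left(1)[OF zL(1) zL(1) s] L2.N_sq[OF zL(1)] by linarith
  also have "\<dots> \<le> L2_norm T s * L2_norm T z" using L2.cauchy_schwarz[OF s zL(1)] by simp
  finally show "L2_norm T z \<le> L2_norm T s" by (rule square_le_mult_imp_le) simp_all
  assume s': "C1_pair s s'"
  note sL = C1_pairD(5)[OF s', of T]
  have "L2_ip T z'' (z - s) + L2_ip T z' (z' - s') = 0"
    using L2_ip_by_parts[OF z(2) C1_pair_diff[OF z(1) s'] T] bc by simp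
  moreover have "L2_ip T z' (z' - s') = (L2_norm T z')\<^sup>2 - L2_ip T z' s'"
    using L2_ip_right[OF zL(2) zL(2) sL] L2.N_sq[OF zL(2)] by simp
  ultimately have "L2_ip T z'' (z - s) = L2_ip T z' s' - (L2_norm T z')\<^sup>2" by linarith
  also have "\<dots> \<le> (L2_norm T s')\<^sup>2"
  proof -
    have "L2_ip T z' s' \<le> L2_norm T z' * L2_norm T s'" using L2.cauchy_schwarz[OF zL(2) sL] by simp
    moreover have "2 * (L2_norm T z' * L2_norm T s') \<le> (L2_norm T z')\<^sup>2 + (L2_norm T s')\<^sup>2"
      using sum_squares_bound[of "L2_norm T z'" "L2_norm T s'"] by simp
    ultimately show ?thesis using zero_le_power2[of "L2_norm T z'"] zero_le_power2[of "L2_norm T s'"] by linarith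
  qed
  finally have "\<kappa>\<^sup>2 * L2_ip T z'' (z - s) \<le> \<kappa>\<^sup>2 * (L2_norm T s')\<^sup>2" by (rule mult_left_mono) simp
  then have "(L2_norm T (z - s))\<^sup>2 \<le> (\<bar>\<kappa>\<bar> * L2_norm T s')\<^sup>2"
    using ip[OF L2_diff[OF zL(1) s]] L2.N_sq[OF L2_diff[OF zL(1) s]] by (simp add: power_mult_distrib)
  then show "L2_norm T (z - s) \<le> \<bar>\<kappa>\<bar> * L2_norm T s'" by (rule power2_le_imp_le) simp
qed

lemma dirichlet_stability:
  fixes q x :: "real \<Rightarrow> 'b::real_inner"
  assumes q: "C1_pair q q'" "C1_pair q' q''" and eq: "\<And>t. \<kappa>\<^sup>2 *\<^sub>R q'' t = q t - x t"
    and bc: "q 0 = 0" "q T = 0" and x: "x \<in> L2 T" and T: "0 \<le> T" and \<kappa>: "0 < \<kappa>"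
  shows "L2_norm T q \<le> L2_norm T x" and "\<kappa> * L2_norm T q' \<le> L2_norm T x"
proof -
  note qL = C1_pairD(4,5)[OF q(1), of T] C1_pairD(5)[OF q(2), of T]
  have eq': "\<kappa>\<^sup>2 *\<^sub>R q'' = q - x" by (rule ext) (simp add: scaleR_fun_def eq)
  have "L2_ip T (q - x) q = \<kappa>\<^sup>2 * L2_ip T q'' q"
    unfolding eq'[symmetric] by (rule L2_ip_left(3)[OF qL(1) qL(3) qL(3)])
  moreover have "L2_ip T q'' q + L2_ip T q' q' = 0"
    using L2_ip_by_parts[OF q(2,1) T] bc by simp
  then have "L2_ip T q'' q = - (L2_norm T q')\<^sup>2" using L2.N_sq[OF qL(2)] by linarith
  ultimately have "L2_ip T (q - x) q = - (\<kappa>\<^sup>2 * (L2_norm T q')\<^sup>2)" by simp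
  then have "(L2_norm T q)\<^sup>2 + \<kappa>\<^sup>2 * (L2_norm T q')\<^sup>2 = L2_ip T x q"
    using L2_ip_left(1)[OF qL(1) qL(1) x] L2.N_sq[OF qL(1)] by linarith
  also have "\<dots> \<le> L2_norm T x * L2_norm T q" using L2.cauchy_schwarz[OF x qL(1)] by simp
  finally have E: "(L2_norm T q)\<^sup>2 + \<kappa>\<^sup>2 * (L2_norm T q')\<^sup>2 \<le> L2_norm T x * L2_norm T q" .
  moreover have "0 \<le> \<kappa>\<^sup>2 * (L2_norm T q')\<^sup>2" by simp
  ultimately have "(L2_norm T q)\<^sup>2 \<le> L2_norm T x * L2_norm T q" by linarith
  then show le: "L2_norm T q \<le> L2_norm T x" by (rule square_le_mult_imp_le) simp_all
  have "(\<kappa> * L2_norm T q')\<^sup>2 \<le> L2_norm T x * L2_norm T q"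
    using E zero_le_power2[of "L2_norm T q"] unfolding power_mult_distrib by linarith
  also have "\<dots> \<le> (L2_norm T x)\<^sup>2" using le by (simp add: power2_eq_square mult_left_mono)
  finally show "\<kappa> * L2_norm T q' \<le> L2_norm T x" by (rule power2_le_imp_le) simp
qed

text \<open>
  Formally \<open>z'\<close> solves the Dirichlet problem with right-hand side \<open>s'\<close>, close to \<open>G\<close>, and the
  solution operator is a contraction. The space \<open>V'\<close> carries only its operator norm here, so the
  contraction property is proved by duality: represent \<open>x = q - \<kappa>\<^sup>2 q''\<close> with \<open>q\<close> vanishing at both
  end points. Moving the solution operator to \<open>q\<close> turns the pairing of \<open>z'\<close> with \<open>x\<close> into
  \<open>- (s, q')\<close>, where \<open>s\<close> may be replaced by \<open>w\<close> up to a small error, and \<open>- (w, q') = G(q)\<close>.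
\<close>

lemma neumann_derivative_bound:
  assumes G: "is_ddt T \<iota> w G" and z: "C1_pair z z'" "C1_pair z' z''"
    and eq: "\<And>t. \<kappa>\<^sup>2 *\<^sub>R z'' t = z t - s t" and bc: "z' 0 = 0" "z' T = 0"
    and s: "s \<in> L2 T" and T: "0 < T" and \<kappa>: "0 < \<kappa>"
    and close: "(norm \<iota>)\<^sup>2 * L2_norm T (w - s) \<le> \<kappa>" and x: "x \<in> L2 T"
  shows "\<bar>H_ip T \<iota> z' x\<bar> \<le> (L2_norm T G + 1) * L2_norm T x"
proof -
  have wL: "w \<in> L2 T" and GL: "G \<in> L2 T" using G by (auto simp: is_ddt_def)
  note zL = C1_pairD(4,5)[OF z(1), of T] C1_pairD(5)[OF z(2), of T]
  note wsL = L2_diff[OF wL s]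
  have eq': "\<kappa>\<^sup>2 *\<^sub>R z'' = z - s" by (rule ext) (simp add: scaleR_fun_def eq)
  have T0: "0 \<le> T" using T by simp
  show ?thesis
  proof (rule L2_functional_bound_extends[OF _ _ _ _ x])
    fix x :: "real \<Rightarrow> 'a" assume x: "x \<in> span (D0 T)"
    then have xL: "x \<in> L2 T" by (rule span_D0_L2)
    obtain q q' q'' where q: "C1_pair q q'" "C1_pair q' q''" and qeq: "\<And>t. \<kappa>\<^sup>2 *\<^sub>R q'' t = q t - x t"
      and qD: "q \<in> span (D0 T)" using dirichlet_solvable[OF x \<kappa> T] by blast
    note qL = C1_pairD(4,5)[OF q(1), of T] C1_pairD(5)[OF q(2), of T]
    have q0: "q 0 = 0" "q T = 0" using span_D0_C1[OF qD] by auto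
    note qb = dirichlet_stability[OF q qeq q0 xL T0 \<kappa>]
    have qeq': "x = q - \<kappa>\<^sup>2 *\<^sub>R q''" by (rule ext) (simp add: scaleR_fun_def qeq)
    have "H_ip T \<iota> z' x = H_ip T \<iota> z' q - \<kappa>\<^sup>2 * H_ip T \<iota> z' q''"
      unfolding qeq' H_ip_right(1)[OF zL(2) qL(1) subspace_scale[OF subspace_L2 qL(3)]]
      by (simp only: H_ip_right(3)[OF zL(2) qL(3) qL(3)])
    moreover have "\<kappa>\<^sup>2 * H_ip T \<iota> z' q'' = - (\<kappa>\<^sup>2 * H_ip T \<iota> z'' q')"
    proof -
      have "H_ip T \<iota> z' q'' = - H_ip T \<iota> z'' q'"
        using H_ip_by_parts[OF z(2) q(2) T0, of \<iota>] bc by simp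
      then show ?thesis by simp
    qed
    moreover have "H_ip T \<iota> z' q = - H_ip T \<iota> z q'"
      using H_ip_by_parts[OF z(1) q(1) T0, of \<iota>] q0 by simp
    moreover have "\<kappa>\<^sup>2 * H_ip T \<iota> z'' q' = H_ip T \<iota> z q' - H_ip T \<iota> s q'"
      using H_ip_left(3)[where \<iota>=\<iota> and c="\<kappa>\<^sup>2", OF qL(2) zL(3) zL(3)] H_ip_left(1)[where \<iota>=\<iota>, OF qL(2) zL(1) s]
      unfolding eq' by simp
    moreover have "H_ip T \<iota> (w - s) q' = H_ip T \<iota> w q' - H_ip T \<iota> s q'"
      by (rule H_ip_left(1)[OF qL(2) wL s])
    moreover have "H_ip T \<iota> w q' = - duality T G q" by (rule is_ddt_span_D0[OF G qD q(1)])
    ultimately have "H_ip T \<iota> z' x = duality T G q + H_ip T \<iota> (w - s) q'" by linarith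
    moreover have "\<bar>duality T G q\<bar> \<le> L2_norm T G * L2_norm T x"
      by (rule order_trans[OF duality_bound[OF GL qL(1)] mult_left_mono[OF qb(1)]]) simp
    moreover have "\<bar>H_ip T \<iota> (w - s) q'\<bar> \<le> L2_norm T x"
    proof -
      have "\<bar>H_ip T \<iota> (w - s) q'\<bar> \<le> ((norm \<iota>)\<^sup>2 * L2_norm T (w - s)) * L2_norm T q'"
        using H_ip_bound[OF wsL qL(2), of \<iota>] by (simp only: mult.assoc)
      also have "\<dots> \<le> \<kappa> * L2_norm T q'" by (rule mult_right_mono[OF close]) simp
      finally show ?thesis using qb(2) by linarith
    qed
    ultimately have "\<bar>H_ip T \<iota> z' x\<bar> \<le> L2_norm T G * L2_norm T x + L2_norm T x" by linarith
    then show "\<bar>H_ip T \<iota> z' x\<bar> \<le> (L2_norm T G + 1) * L2_norm T x" by (simp only: distrib_right mult_1)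
  next
    show "H_ip T \<iota> z' (x - y) = H_ip T \<iota> z' x - H_ip T \<iota> z' y" if "x \<in> L2 T" "y \<in> L2 T" for x y
      by (rule H_ip_right(1)[OF zL(2) that])
    show "\<bar>H_ip T \<iota> z' x\<bar> \<le> ((norm \<iota>)\<^sup>2 * L2_norm T z') * L2_norm T x" if "x \<in> L2 T" for x
      using H_ip_bound[OF zL(2) that, of \<iota>] by (simp only: mult.assoc)
  qed simp
qed

text \<open>
  Elements of \<open>X\<close> are limits in \<open>Y\<close> of smooth functions whose time derivatives stay bounded in
  \<open>Y'\<close>. The trace theorem below uses this boundedness, together with convergence in \<open>Y\<close>. The
  data \<open>s\<close> of the Neumann problem are compared with a fixed approximation \<open>s0\<close>, for which the rate of
  convergence as \<open>\<kappa> \<rightarrow> 0\<close> is known.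
\<close>

lemma C1_approximation:
  assumes G: "is_ddt T \<iota> w G" and T: "0 < T" and e: "0 < \<epsilon>"
  shows "\<exists>z z'. C1_pair z z' \<and> L2_norm T (w - z) < \<epsilon> \<and>
    (\<forall>x\<in>L2 T. \<bar>H_ip T \<iota> z' x\<bar> \<le> (L2_norm T G + 1) * L2_norm T x)"
proof -
  have wL: "w \<in> L2 T" using G by (simp add: is_ddt_def)
  have T0: "0 \<le> T" using T by simp
  obtain s0 where s0: "s0 \<in> span (D0 T)" "L2_norm T (w - s0) < \<epsilon> / 5" using L2_dense[OF wL, of "\<epsilon> / 5"] e by auto
  obtain s0' where s0': "C1_pair s0 s0'" using span_D0_C1[OF s0(1)] by blast
  define m where "m = L2_norm T s0' + 1"
  \<comment> \<open>First \<open>\<kappa>\<close>, such that the Neumann solution for \<open>s0\<close> is close to \<open>s0\<close>; then \<open>s\<close>, depending on \<open>\<kappa>\<close>.\<close>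
  define \<kappa> where "\<kappa> = \<epsilon> / (5 * m)"
  have n1: "0 < m" unfolding m_def using L2_norm_nonneg[of T s0'] by linarith
  have \<kappa>: "0 < \<kappa>" using e n1 by (simp add: \<kappa>_def)
  have \<kappa>s: "\<kappa> * L2_norm T s0' \<le> \<epsilon> / 5"
  proof -
    have "\<kappa> * L2_norm T s0' \<le> \<kappa> * m" using \<kappa> by (intro mult_left_mono) (auto simp: m_def)
    also have "\<dots> = \<epsilon> / 5" using n1 by (simp add: \<kappa>_def)
    finally show ?thesis .
  qed
  define d where "d = min (\<epsilon> / 5) (\<kappa> / ((norm \<iota>)\<^sup>2 + 1))"
  have p1: "0 < (norm \<iota>)\<^sup>2 + 1" using zero_le_power2[of "norm \<iota>"] by linarith
  have d: "0 < d" using e \<kappa> p1 by (simp add: d_def)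
  obtain s where s: "s \<in> span (D0 T)" "L2_norm T (w - s) < d" using L2_dense[OF wL d] by blast
  note sL = span_D0_L2[OF s(1)] span_D0_L2[OF s0(1)]
  obtain z z' z'' where z: "C1_pair z z'" "C1_pair z' z''" and zeq: "\<And>t. \<kappa>\<^sup>2 *\<^sub>R z'' t = z t - s t"
    and zbc: "z' 0 = 0" "z' T = 0" using neumann_solvable[OF s(1) \<kappa> T] by blast
  obtain y y' y'' where y: "C1_pair y y'" "C1_pair y' y''" and yeq: "\<And>t. \<kappa>\<^sup>2 *\<^sub>R y'' t = y t - s0 t"
    and ybc: "y' 0 = 0" "y' T = 0" using neumann_solvable[OF s0(1) \<kappa> T] by blast
  note zL = C1_pairD(4)[OF z(1), of T] and yL = C1_pairD(4)[OF y(1), of T]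
  have zy: "L2_norm T (z - y) \<le> L2_norm T (s - s0)"
  proof (rule neumann_stability(1)[OF C1_pair_diff[OF z(1) y(1)] C1_pair_diff[OF z(2) y(2)]])
    show "\<kappa>\<^sup>2 *\<^sub>R (z'' - y'') t = (z - y) t - (s - s0) t" for t
      using zeq[of t] yeq[of t] by (simp add: scaleR_right_diff_distrib)
  qed (use zbc ybc L2_diff[OF sL] T0 in auto)
  have ys: "L2_norm T (y - s0) \<le> \<kappa> * L2_norm T s0'"
    using neumann_stability(2)[OF y yeq ybc sL(2) T0 s0'] \<kappa> by simp
  have "L2_norm T (w - s) < \<epsilon> / 5" using s(2) by (simp add: d_def)
  then have ss: "L2_norm T (s - s0) < 2 * \<epsilon> / 5"
    using L2_norm_triangle_diff[OF sL(1) wL sL(2)] L2.N_minus_commute[OF sL(1) wL] s0(2) by linarith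
  have wz: "L2_norm T (w - z) < \<epsilon>"
    using L2_norm_triangle_diff[OF wL sL(2) zL] L2_norm_triangle_diff[OF sL(2) yL zL]
      L2.N_minus_commute[OF sL(2) yL] L2.N_minus_commute[OF yL zL] zy ys ss \<kappa>s s0(2) e by linarith
  have close: "(norm \<iota>)\<^sup>2 * L2_norm T (w - s) \<le> \<kappa>"
  proof -
    have "(norm \<iota>)\<^sup>2 * L2_norm T (w - s) \<le> ((norm \<iota>)\<^sup>2 + 1) * (\<kappa> / ((norm \<iota>)\<^sup>2 + 1))"
      using s(2) by (intro mult_mono) (auto simp: d_def)
    then show ?thesis using p1 by simp
  qed
  show ?thesis
    using z(1) wz neumann_derivative_bound[OF G z zeq zbc sL(1) T \<kappa> close] by blast
qed

lemma L2_indicator: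
  assumes x: "x \<in> L2 T"
  shows "(\<lambda>t. indicat_real {a..b} t *\<^sub>R x t) \<in> L2 T"
    and "L2_norm T (\<lambda>t. indicat_real {a..b} t *\<^sub>R x t) \<le> L2_norm T x"
proof -
  have le: "(norm (indicat_real {a..b} t *\<^sub>R x t))\<^sup>2 \<le> (norm (x t))\<^sup>2" for t
    by (auto simp: indicator_def)
  show L: "(\<lambda>t. indicat_real {a..b} t *\<^sub>R x t) \<in> L2 T"
  proof (rule L2I)
    have "{a..b} \<inter> {0<..<T} \<in> sets (Xi T)" by (auto simp: sets_restrict_space)
    then have "simple_function (Xi T) (indicat_real ({a..b} \<inter> {0<..<T}))" by (rule simple_function_indicator)
    then have "simple_function (Xi T) (indicat_real {a..b})"
      by (subst simple_function_cong[of _ _ "indicat_real ({a..b} \<inter> {0<..<T})"]) (auto simp: indicator_def)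
    note sm = strongly_measurable_simple[OF this]
    show "strongly_measurable (Xi T) (\<lambda>t. indicat_real {a..b} t *\<^sub>R x t)"
      by (rule strongly_measurable_compose2[OF sm L2D(1)[OF x]])
         (unfold isCont_def, intro tendsto_intros)
    show "integrable (Xi T) (\<lambda>t. (norm (x t))\<^sup>2)" by (rule L2D(2)[OF x])
  qed (use le in simp)
  show "L2_norm T (\<lambda>t. indicat_real {a..b} t *\<^sub>R x t) \<le> L2_norm T x"
    unfolding L2_norm_def by (intro real_sqrt_le_mono integral_mono L2D(2)[OF L] L2D(2)[OF x] le)
qed

lemma measure_Xi: "0 \<le> T \<Longrightarrow> measure (Xi T) (space (Xi T)) = T"
  by (simp add: measure_restrict_space)

text \<open>
  The squared norm in \<open>H\<close> has derivative \<open>2 (x', x)\<close>, so between two times it changes by at most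
  \<open>2 C\<close> times the norm of \<open>x\<close>. Averaging over the second time bounds it everywhere.
  The point is that the bound tends to \<open>0\<close> with the norm of \<open>x\<close> in \<open>Y\<close> while \<open>C\<close> stays fixed.
\<close>

lemma energy_sup_bound:
  assumes x: "C1_pair x x'" and C: "\<And>y. y \<in> L2 T \<Longrightarrow> \<bar>H_ip T \<iota> x' y\<bar> \<le> C * L2_norm T y" "0 \<le> C"
    and T: "0 < T" and t: "t \<in> {0..T}"
  shows "(norm (\<iota> (x t)))\<^sup>2 \<le> (norm \<iota>)\<^sup>2 / T * (L2_norm T x)\<^sup>2 + 2 * C * L2_norm T x"
proof -
  note xL = C1_pairD(4,5)[OF x, of T]
  have diff: "\<bar>(norm (\<iota> (x b)))\<^sup>2 - (norm (\<iota> (x a)))\<^sup>2\<bar> \<le> 2 * C * L2_norm T x"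
    if ab: "0 \<le> a" "a \<le> b" "b \<le> T" for a b
  proof -
    let ?y = "\<lambda>t. indicat_real {a..b} t *\<^sub>R x t"
    have "(norm (\<iota> (x b)))\<^sup>2 - (norm (\<iota> (x a)))\<^sup>2
        = (\<integral>r. indicat_real {a..b} r * (\<iota> (x r) \<bullet> \<iota> (x' r) + \<iota> (x' r) \<bullet> \<iota> (x r)) \<partial>Xi T)"
      using integral_FTC_Xi[OF C1_pair_bilinear[OF bounded_bilinear_H x x] ab, of \<iota>]
      by (simp add: power2_norm_eq_inner)
    also have "\<dots> = (\<integral>r. 2 * (\<iota> (x' r) \<bullet> \<iota> (?y r)) \<partial>Xi T)"
      by (rule Bochner_Integration.integral_cong)
         (simp_all add: blinfun.scaleR_right inner_commute[of "\<iota> (x r)" "\<iota> (x' r)" for r])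
    also have "\<dots> = 2 * H_ip T \<iota> x' ?y" by (simp add: H_ip_def)
    finally have "\<bar>(norm (\<iota> (x b)))\<^sup>2 - (norm (\<iota> (x a)))\<^sup>2\<bar> = 2 * \<bar>H_ip T \<iota> x' ?y\<bar>" by (simp add: abs_mult)
    also have "\<dots> \<le> 2 * (C * L2_norm T x)"
      using order_trans[OF C(1)[OF L2_indicator(1)[OF xL(1)]] mult_left_mono[OF L2_indicator(2)[OF xL(1)] C(2)]]
      by simp
    finally show ?thesis by simp
  qed
  have le: "(norm (\<iota> (x t)))\<^sup>2 \<le> (norm (\<iota> (x r)))\<^sup>2 + 2 * C * L2_norm T x" if r: "0 < r" "r < T" for r
    using diff[of r t] diff[of t r] r t by (cases "r \<le> t") auto
  have \<iota>x: "(\<lambda>t. \<iota> (x t)) \<in> L2 T" by (rule L2_linear[OF xL(1) blinfun.bounded_linear_right])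
  have "T * (norm (\<iota> (x t)))\<^sup>2 = (\<integral>r. (norm (\<iota> (x t)))\<^sup>2 \<partial>Xi T)"
    using measure_Xi[of T] T by simp
  also have "\<dots> \<le> (\<integral>r. (norm (\<iota> (x r)))\<^sup>2 + 2 * C * L2_norm T x \<partial>Xi T)"
    by (rule integral_mono) (use L2D(2)[OF \<iota>x] le in auto)
  also have "\<dots> = (L2_norm T (\<lambda>t. \<iota> (x t)))\<^sup>2 + T * (2 * C * L2_norm T x)"
    using L2D(2)[OF \<iota>x] measure_Xi[of T] T by (simp add: L2_norm_sq)
  also have "(L2_norm T (\<lambda>t. \<iota> (x t)))\<^sup>2 \<le> (norm \<iota> * L2_norm T x)\<^sup>2"
    by (intro power_mono L2_norm_linear_le[OF xL(1) blinfun.bounded_linear_right] norm_blinfun) auto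
  finally have "T * (norm (\<iota> (x t)))\<^sup>2 \<le> (norm \<iota>)\<^sup>2 * (L2_norm T x)\<^sup>2 + T * (2 * C * L2_norm T x)"
    by (simp add: power_mult_distrib)
  then have "(norm (\<iota> (x t)))\<^sup>2 \<le> ((norm \<iota>)\<^sup>2 * (L2_norm T x)\<^sup>2 + T * (2 * C * L2_norm T x)) / T"
    using T by (simp add: pos_le_divide_eq mult.commute)
  also have "\<dots> = (norm \<iota>)\<^sup>2 / T * (L2_norm T x)\<^sup>2 + 2 * C * L2_norm T x"
    using T by (simp add: add_divide_distrib)
  finally show ?thesis .
qed

lemma L2_norm_le_sup:
  assumes f: "f \<in> L2 T" and T: "0 \<le> T" and b: "\<And>t. 0 < t \<Longrightarrow> t < T \<Longrightarrow> norm (f t) \<le> b" "0 \<le> b"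
  shows "L2_norm T f \<le> b * sqrt T"
proof -
  have "(\<integral>t. (norm (f t))\<^sup>2 \<partial>Xi T) \<le> (\<integral>t. b\<^sup>2 \<partial>Xi T)"
    by (rule integral_mono) (use L2D(2)[OF f] b in \<open>auto intro!: power_mono\<close>)
  also have "\<dots> = b\<^sup>2 * T" using measure_Xi[OF T] by simp
  finally have "L2_norm T f \<le> sqrt (b\<^sup>2 * T)" unfolding L2_norm_def by (rule real_sqrt_le_mono)
  then show ?thesis using b(2) by (simp add: real_sqrt_mult)
qed

lemma continuous_clamp:
  fixes c :: "real \<Rightarrow> 'b::topological_space"
  assumes c: "continuous_on {0..T} c" and T: "0 \<le> T"
  shows "continuous_on UNIV (\<lambda>t. c (max 0 (min T t)))"
  by (rule continuous_on_compose2[OF c]) (use T in \<open>auto intro!: continuous_intros\<close>)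

lemma L2_continuous_Icc:
  fixes c :: "real \<Rightarrow> 'b::real_normed_vector"
  assumes c: "continuous_on {0..T} c" and T: "0 \<le> T"
  shows "c \<in> L2 T"
  by (rule L2_cong[OF L2_continuous[OF continuous_clamp[OF assms]]]) simp

text \<open>
  The set where two continuous functions differ is open inside \<open>(0,T)\<close>, and a null set that is open
  is empty. The end points follow by continuity.
\<close>

lemma continuous_AE_unique:
  fixes c d :: "real \<Rightarrow> 'b::real_normed_vector"
  assumes c: "continuous_on {0..T} c" and d: "continuous_on {0..T} d" and T: "0 < T"
    and eq: "AE t in Xi T. c t = d t" and t: "t \<in> {0..T}"
  shows "c t = d t"
proof -
  define N where "N = {t \<in> {0<..<T}. c t - d t \<noteq> 0}"
  have cd: "continuous_on {0..T} (\<lambda>t. c t - d t)" by (intro continuous_intros c d)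
  have cd': "continuous_on {0<..<T} (\<lambda>t. c t - d t)" by (rule continuous_on_subset[OF cd]) auto
  have "N = {0<..<T} \<inter> (\<lambda>t. c t - d t) -` (- {0})" by (auto simp: N_def)
  then have "open N" using continuous_open_preimage[OF cd' open_greaterThanLessThan, of "- {0}"] by auto
  moreover have "negligible N"
  proof -
    have "AE t in lebesgue. t \<in> {0<..<T} \<longrightarrow> c t = d t"
      using eq by (subst (asm) AE_restrict_space_iff) auto
    then have "AE t in lebesgue. t \<notin> N" by eventually_elim (auto simp: N_def)
    then have "N \<in> null_sets lebesgue" by (simp add: completion.AE_iff_null_sets)
    then show ?thesis by (simp add: negligible_iff_null_sets)
  qed
  ultimately have "N = {}" using open_not_negligible by blast
  then have sub: "{0<..<T} \<subseteq> {t \<in> {0..T}. c t - d t = 0}" by (auto simp: N_def)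
  have "closed {t \<in> {0..T}. c t - d t = 0}" by (rule continuous_closed_preimage_constant[OF cd]) simp
  then have "closure {0<..<T} \<subseteq> {t \<in> {0..T}. c t - d t = 0}" by (rule closure_minimal[OF sub])
  then show ?thesis using t T by (auto simp: closure_greaterThanLessThan)
qed

text \<open>
  The embedding of \<open>X\<close> into \<open>C([0,T];H)\<close>: by the energy bound, the approximations in \<open>Y\<close> with
  bounded derivatives form a Cauchy sequence in the supremum norm. The sequence itself is exported,
  since integration by parts passes to the limit along it.
\<close>

lemma trace_approximation:
  fixes \<iota> :: "'v::{real_inner,complete_space} \<Rightarrow>\<^sub>L 'h::{real_inner,complete_space}"
  assumes w: "is_ddt T \<iota> w G" and T: "0 < T"
  obtains c z z' where "continuous_on {0..T} c" "AE t in Xi T. \<iota> (w t) = c t"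
    "\<And>n::nat. C1_pair (z n) (z' n)" "(\<lambda>n. L2_norm T (w - z n)) \<longlonglongrightarrow> 0"
    "\<And>n x. x \<in> L2 T \<Longrightarrow> \<bar>H_ip T \<iota> (z' n) x\<bar> \<le> (L2_norm T G + 1) * L2_norm T x"
    "\<And>t. t \<in> {0..T} \<Longrightarrow> (\<lambda>n. \<iota> (z n t)) \<longlonglongrightarrow> c t"
proof -
  have wL: "w \<in> L2 T" using w by (simp add: is_ddt_def)
  have T0: "0 \<le> T" using T by simp
  define C where "C = L2_norm T G + 1"
  have C: "0 \<le> C" unfolding C_def using L2_norm_nonneg[of T G] by linarith
  have "\<forall>n::nat. \<exists>z z'. C1_pair z z' \<and> L2_norm T (w - z) < inverse (real (Suc n)) \<and>
      (\<forall>x\<in>L2 T. \<bar>H_ip T \<iota> z' x\<bar> \<le> C * L2_norm T x)"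
    unfolding C_def by (intro allI C1_approximation[OF w T]) simp
  then obtain z where "\<forall>n::nat. \<exists>z'. C1_pair (z n) z' \<and> L2_norm T (w - z n) < inverse (real (Suc n)) \<and>
      (\<forall>x\<in>L2 T. \<bar>H_ip T \<iota> z' x\<bar> \<le> C * L2_norm T x)" by (rule exE[OF choice])
  then obtain z' where zz: "\<forall>n::nat. C1_pair (z n) (z' n) \<and> L2_norm T (w - z n) < inverse (real (Suc n)) \<and>
      (\<forall>x\<in>L2 T. \<bar>H_ip T \<iota> (z' n) x\<bar> \<le> C * L2_norm T x)" by (rule exE[OF choice])
  from zz have z: "C1_pair (z n) (z' n)" and wz: "L2_norm T (w - z n) < inverse (real (Suc n))"
    and zC: "x \<in> L2 T \<Longrightarrow> \<bar>H_ip T \<iota> (z' n) x\<bar> \<le> C * L2_norm T x" for n x by auto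
  have zL: "z n \<in> L2 T" "z' n \<in> L2 T" for n using C1_pairD(4,5)[OF z] by auto
  have lim0: "(\<lambda>n. L2_norm T (w - z n)) \<longlonglongrightarrow> 0"
  proof (rule Lim_null_comparison[OF _ LIMSEQ_inverse_real_of_nat])
    have "norm (L2_norm T (w - z n)) \<le> inverse (real (Suc n))" for n using wz[of n] by simp
    then show "\<forall>\<^sub>F n in sequentially. norm (L2_norm T (w - z n)) \<le> inverse (real (Suc n))" by simp
  qed
  \<comment> \<open>The energy bound for a difference of two approximations; the constant \<open>C\<close> doubles.\<close>
  define a where "a r = (norm \<iota>)\<^sup>2 / T * r\<^sup>2 + 2 * (2 * C) * r" for r
  have sup: "(dist (\<iota> (z m t)) (\<iota> (z n t)))\<^sup>2 \<le> a (L2_norm T (z m - z n))" if t: "t \<in> {0..T}" for m n t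
  proof -
    have "\<bar>H_ip T \<iota> (z' m - z' n) y\<bar> \<le> 2 * C * L2_norm T y" if y: "y \<in> L2 T" for y
      using H_ip_left(1)[where \<iota>=\<iota>, OF y zL(2)[of m] zL(2)[of n]] zC[OF y, of m] zC[OF y, of n] by linarith
    from energy_sup_bound[OF C1_pair_diff[OF z z] this _ T t]
    have "(norm (\<iota> ((z m - z n) t)))\<^sup>2 \<le> a (L2_norm T (z m - z n))" using C by (simp add: a_def)
    then show ?thesis by (simp add: dist_norm blinfun.diff_right)
  qed
  have amono: "a r \<le> a r'" if "0 \<le> r" "r \<le> r'" for r r'
    unfolding a_def using that C T by (intro add_mono mult_left_mono power_mono) auto
  have ucauchy: "uniformly_Cauchy_on {0..T} (\<lambda>n t. \<iota> (z n t))"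
    unfolding uniformly_Cauchy_on_def
  proof (intro allI impI)
    fix e :: real assume e: "0 < e"
    have "(\<lambda>n. a (2 * inverse (real (Suc n)))) \<longlonglongrightarrow> a (2 * 0)"
      unfolding a_def by (intro tendsto_intros LIMSEQ_inverse_real_of_nat)
    moreover have "a (2 * 0) < e\<^sup>2" using e by (simp add: a_def)
    ultimately have "\<forall>\<^sub>F n in sequentially. a (2 * inverse (real (Suc n))) < e\<^sup>2" by (rule order_tendstoD(2))
    then obtain M where M: "a (2 * inverse (real (Suc M))) < e\<^sup>2" unfolding eventually_sequentially by blast
    have "dist (\<iota> (z m t)) (\<iota> (z n t)) < e" if "t \<in> {0..T}" "M \<le> m" "M \<le> n" for m n t
    proof -
      have "L2_norm T (z m - z n) \<le> inverse (real (Suc m)) + inverse (real (Suc n))"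
        using L2_norm_triangle_diff[OF zL(1)[of m] wL zL(1)[of n]] L2.N_minus_commute[OF zL(1)[of m] wL]
          wz[of m] wz[of n] by linarith
      also have "\<dots> \<le> inverse (real (Suc M)) + inverse (real (Suc M))"
        using that by (intro add_mono le_imp_inverse_le) auto
      finally have "a (L2_norm T (z m - z n)) \<le> a (2 * inverse (real (Suc M)))"
        by (intro amono) auto
      then have "(dist (\<iota> (z m t)) (\<iota> (z n t)))\<^sup>2 < e\<^sup>2" using sup[OF that(1), of m n] M by linarith
      then show ?thesis by (rule power2_less_imp_less) (use e in simp)
    qed
    then show "\<exists>M. \<forall>t\<in>{0..T}. \<forall>m\<ge>M. \<forall>n\<ge>M. dist (\<iota> (z m t)) (\<iota> (z n t)) < e" by blast
  qed
  obtain c where c: "uniform_limit {0..T} (\<lambda>n t. \<iota> (z n t)) c sequentially"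
    using Cauchy_uniformly_convergent[OF ucauchy] unfolding uniformly_convergent_on_def by blast
  have zcont: "continuous_on {0..T} (\<lambda>t. \<iota> (z n t))" for n
    by (intro bounded_linear.continuous_on[OF blinfun.bounded_linear_right]
        continuous_on_subset[OF C1_pairD(3)[OF z]]) auto
  have ccont: "continuous_on {0..T} c"
    by (rule uniform_limit_theorem[OF _ c]) (use zcont in auto)
  have cL: "c \<in> L2 T" by (rule L2_continuous_Icc[OF ccont T0])
  have \<iota>L: "(\<lambda>t. \<iota> (x t)) \<in> L2 T" if "x \<in> L2 T" for x
    by (rule L2_linear[OF that blinfun.bounded_linear_right])
  have "L2_norm T ((\<lambda>t. \<iota> (w t)) - c) \<le> 0"
  proof (rule field_le_epsilon)
    fix e :: real assume e: "0 < e"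
    define m where "m = sqrt T + 1"
    define b where "b = e / (2 * m)"
    have b: "0 < b" "b * sqrt T \<le> e / 2"
    proof -
      have p: "0 < m" using T by (simp add: m_def add_pos_pos)
      show b0: "0 < b" using e p by (simp add: b_def)
      have "b * sqrt T \<le> b * m" using b0 by (intro mult_left_mono) (auto simp: m_def)
      also have "\<dots> = e / 2" using p by (simp add: b_def)
      finally show "b * sqrt T \<le> e / 2" .
    qed
    have "\<forall>\<^sub>F n in sequentially. \<forall>t\<in>{0..T}. dist (\<iota> (z n t)) (c t) < b"
      using c b(1) by (simp add: uniform_limit_iff)
    moreover have "(\<lambda>n. norm \<iota> * L2_norm T (w - z n)) \<longlonglongrightarrow> norm \<iota> * 0" by (intro tendsto_intros lim0)
    then have "\<forall>\<^sub>F n in sequentially. norm \<iota> * L2_norm T (w - z n) < e / 2"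
      by (rule order_tendstoD(2)) (use e in simp)
    ultimately have "\<forall>\<^sub>F n in sequentially. (\<forall>t\<in>{0..T}. dist (\<iota> (z n t)) (c t) < b) \<and>
      norm \<iota> * L2_norm T (w - z n) < e / 2" by (rule eventually_conj)
    then obtain n where n: "\<forall>t\<in>{0..T}. dist (\<iota> (z n t)) (c t) < b"
      "norm \<iota> * L2_norm T (w - z n) < e / 2" unfolding eventually_sequentially by blast
    have "L2_norm T ((\<lambda>t. \<iota> (w t)) - c) \<le> L2_norm T ((\<lambda>t. \<iota> (w t)) - (\<lambda>t. \<iota> (z n t))) + L2_norm T ((\<lambda>t. \<iota> (z n t)) - c)"
      by (rule L2_norm_triangle_diff[OF \<iota>L[OF wL] \<iota>L[OF zL(1)] cL])
    also have "(\<lambda>t. \<iota> (w t)) - (\<lambda>t. \<iota> (z n t)) = (\<lambda>t. \<iota> ((w - z n) t))"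
      by (rule ext) (simp add: blinfun.diff_right)
    also have "L2_norm T (\<lambda>t. \<iota> ((w - z n) t)) \<le> norm \<iota> * L2_norm T (w - z n)"
      by (rule L2_norm_linear_le[OF L2_diff[OF wL zL(1)] blinfun.bounded_linear_right norm_blinfun]) simp
    also have "L2_norm T ((\<lambda>t. \<iota> (z n t)) - c) \<le> b * sqrt T"
      using n(1) b(1) by (intro L2_norm_le_sup L2_diff \<iota>L zL cL T0) (auto simp: dist_norm less_imp_le)
    finally show "L2_norm T ((\<lambda>t. \<iota> (w t)) - c) \<le> 0 + e" using n(2) b(2) by linarith
  qed
  then have "L2_norm T ((\<lambda>t. \<iota> (w t)) - c) = 0" using L2_norm_nonneg[of T "(\<lambda>t. \<iota> (w t)) - c"] by linarith
  then have "AE t in Xi T. ((\<lambda>t. \<iota> (w t)) - c) t = 0"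
    by (rule L2_norm_eq_0_AE[OF L2_diff[OF \<iota>L[OF wL] cL]])
  then have AEc: "AE t in Xi T. \<iota> (w t) = c t" by eventually_elim simp
  have ptw: "(\<lambda>n. \<iota> (z n t)) \<longlonglongrightarrow> c t" if "t \<in> {0..T}" for t
    by (rule tendsto_uniform_limitI[OF c that])
  show thesis by (rule that[OF ccont AEc z lim0 zC[unfolded C_def] ptw])
qed

lemma time_trace_eq:
  fixes \<iota> :: "'v::real_inner \<Rightarrow>\<^sub>L 'h::real_inner"
  assumes c: "continuous_on {0..T} c" and eq: "AE s in Xi T. \<iota> (w s) = c s" and T: "0 < T" and t: "t \<in> {0..T}"
  shows "time_trace T \<iota> t w = c t"
  unfolding time_trace_def
proof (rule the_equality)
  show "\<exists>d. continuous_on {0..T} d \<and> (AE s in Xi T. \<iota> (w s) = d s) \<and> d t = c t"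
    using c eq by (intro exI[of _ c] conjI refl)
  fix h assume "\<exists>d. continuous_on {0..T} d \<and> (AE s in Xi T. \<iota> (w s) = d s) \<and> d t = h"
  then obtain d where d: "continuous_on {0..T} d" "AE s in Xi T. \<iota> (w s) = d s" "d t = h" by blast
  have "AE s in Xi T. d s = c s" using d(2) eq by eventually_elim simp
  from continuous_AE_unique[OF d(1) c T this t] show "h = c t" using d(3) by simp
qed

lemma time_trace_C1:
  fixes \<iota> :: "'v::real_inner \<Rightarrow>\<^sub>L 'h::real_inner"
  assumes z: "C1_pair z z'" and T: "0 < T" and t: "t \<in> {0..T}"
  shows "time_trace T \<iota> t z = \<iota> (z t)"
  by (rule time_trace_eq[where c="\<lambda>t. \<iota> (z t)", OF _ _ T t])
     (auto intro!: bounded_linear.continuous_on[OF blinfun.bounded_linear_right]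
        continuous_on_subset[OF C1_pairD(3)[OF z]])

lemma time_trace_combination:
  fixes \<iota> :: "'v::{real_inner,complete_space} \<Rightarrow>\<^sub>L 'h::{real_inner,complete_space}"
  assumes w: "w \<in> Xspace T \<iota>" and v: "v \<in> Xspace T \<iota>" and T: "0 < T" and t: "t \<in> {0..T}"
  shows "time_trace T \<iota> t (w + a *\<^sub>R v) = time_trace T \<iota> t w + a *\<^sub>R time_trace T \<iota> t v"
proof -
  obtain G F where GF: "is_ddt T \<iota> w G" "is_ddt T \<iota> v F"
    using w v Xspace_iff[of w T \<iota>] Xspace_iff[of v T \<iota>] by blast
  obtain c where c: "continuous_on {0..T} c" "AE t in Xi T. \<iota> (w t) = c t"
    by (rule trace_approximation[OF GF(1) T])
  obtain d where d: "continuous_on {0..T} d" "AE t in Xi T. \<iota> (v t) = d t"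
    by (rule trace_approximation[OF GF(2) T])
  have "time_trace T \<iota> t (w + a *\<^sub>R v) = c t + a *\<^sub>R d t"
  proof (rule time_trace_eq[where c="\<lambda>t. c t + a *\<^sub>R d t", OF _ _ T t])
    show "continuous_on {0..T} (\<lambda>t. c t + a *\<^sub>R d t)" by (intro continuous_intros c d)
    show "AE s in Xi T. \<iota> ((w + a *\<^sub>R v) s) = c s + a *\<^sub>R d s"
      using c(2) d(2) by eventually_elim (simp add: scaleR_fun_def blinfun.add_right blinfun.scaleR_right)
  qed
  then show ?thesis using time_trace_eq[OF c T t] time_trace_eq[OF d T t] by simp
qed

text \<open>
  Both factors smooth is the classical case. Along the approximating sequence \<open>u\<close> of \<open>w\<close>, the values
  at \<open>0\<close> and \<open>T\<close> converge, and the derivatives converge weakly to that of \<open>w\<close>: they are bounded, and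
  they converge when paired with the dense subspace \<open>span (D0 T)\<close>.
\<close>

theorem integration_by_parts_Xspace:
  fixes \<iota> :: "'v::{real_inner,complete_space} \<Rightarrow>\<^sub>L 'h::{real_inner,complete_space}"
  assumes w: "w \<in> Xspace T \<iota>" and z: "C1_pair z z'" and T: "0 < T"
  shows "dt T \<iota> w z + H_ip T \<iota> w z'
    = time_trace T \<iota> T w \<bullet> \<iota> (z T) - time_trace T \<iota> 0 w \<bullet> \<iota> (z 0)"
proof -
  obtain G where G: "is_ddt T \<iota> w G" using w Xspace_iff[of w T \<iota>] by blast
  have wL: "w \<in> L2 T" and GL: "G \<in> L2 T" using G by (auto simp: is_ddt_def)
  note zL = C1_pairD(4,5)[OF z, of T]
  define C where "C = L2_norm T G + 1"
  have C: "0 < C" unfolding C_def using L2_norm_nonneg[of T G] by linarith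
  obtain c u u' where c: "continuous_on {0..T} c" "AE t in Xi T. \<iota> (w t) = c t"
    and u: "\<And>n::nat. C1_pair (u n) (u' n)" "(\<lambda>n. L2_norm T (w - u n)) \<longlonglongrightarrow> 0"
    and uC: "\<And>n x. x \<in> L2 T \<Longrightarrow> \<bar>H_ip T \<iota> (u' n) x\<bar> \<le> C * L2_norm T x"
    and ptw: "\<And>t. t \<in> {0..T} \<Longrightarrow> (\<lambda>n. \<iota> (u n t)) \<longlonglongrightarrow> c t"
    by (rule trace_approximation[OF G T, folded C_def]) (rule that)
  have uL: "u n \<in> L2 T" "u' n \<in> L2 T" for n using C1_pairD(4,5)[OF u(1)] by auto
  have conv: "(\<lambda>n. H_ip T \<iota> (u n) y) \<longlonglongrightarrow> H_ip T \<iota> w y" if y: "y \<in> L2 T" for y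
  proof (rule LIM_zero_cancel, rule Lim_null_comparison)
    show "\<forall>\<^sub>F n in sequentially. norm (H_ip T \<iota> (u n) y - H_ip T \<iota> w y)
        \<le> (norm \<iota>)\<^sup>2 * (L2_norm T (w - u n) * L2_norm T y)"
    proof (intro always_eventually allI)
      fix n
      show "norm (H_ip T \<iota> (u n) y - H_ip T \<iota> w y) \<le> (norm \<iota>)\<^sup>2 * (L2_norm T (w - u n) * L2_norm T y)"
        using H_ip_bound[OF L2_diff[OF wL uL(1)] y, of \<iota> n] H_ip_left(1)[where \<iota>=\<iota>, OF y wL uL(1)[of n]]
        by simp
    qed
    have "(\<lambda>n. (norm \<iota>)\<^sup>2 * (L2_norm T (w - u n) * L2_norm T y)) \<longlonglongrightarrow> (norm \<iota>)\<^sup>2 * (0 * L2_norm T y)"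
      by (intro tendsto_intros u)
    then show "(\<lambda>n. (norm \<iota>)\<^sup>2 * (L2_norm T (w - u n) * L2_norm T y)) \<longlonglongrightarrow> 0" by simp
  qed
  have weak: "(\<lambda>n. H_ip T \<iota> (u' n) z) \<longlonglongrightarrow> duality T G z"
  proof (rule LIMSEQ_I)
    fix e :: real assume e: "0 < e"
    define d where "d = e / (3 * C)"
    have d: "0 < d" "C * d = e / 3" using e C by (auto simp: d_def)
    obtain s where s: "s \<in> span (D0 T)" "L2_norm T (z - s) < d" using L2_dense[OF zL(1) d(1)] by blast
    obtain s' where s': "C1_pair s s'" "s 0 = 0" "s T = 0" using span_D0_C1[OF s(1)] by blast
    note sL = C1_pairD(4,5)[OF s'(1), of T]
    note zs = L2_diff[OF zL(1) sL(1)]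
    have "(\<lambda>n. - H_ip T \<iota> (u n) s') \<longlonglongrightarrow> - H_ip T \<iota> w s'" by (intro tendsto_intros conv sL)
    moreover have "H_ip T \<iota> (u' n) s = - H_ip T \<iota> (u n) s'" for n
      using H_ip_by_parts[OF u(1) s'(1), of T \<iota> n] s' T by simp
    moreover have "duality T G s = - H_ip T \<iota> w s'" using is_ddt_span_D0[OF G s(1) s'(1)] by simp
    ultimately have "(\<lambda>n. H_ip T \<iota> (u' n) s) \<longlonglongrightarrow> duality T G s" by simp
    then obtain M where M: "\<And>n. M \<le> n \<Longrightarrow> norm (H_ip T \<iota> (u' n) s - duality T G s) < e / 3"
      using LIMSEQ_D[of _ _ "e / 3"] e by (metis zero_less_divide_iff zero_less_numeral)
    have Cd: "C * L2_norm T (z - s) \<le> e / 3"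
      using mult_left_mono[of "L2_norm T (z - s)" d C] s(2) C d(2) by simp
    have b2: "\<bar>duality T G (z - s)\<bar> \<le> e / 3"
    proof -
      have "\<bar>duality T G (z - s)\<bar> \<le> L2_norm T G * L2_norm T (z - s)" by (rule duality_bound[OF GL zs])
      also have "\<dots> \<le> C * L2_norm T (z - s)" by (rule mult_right_mono) (simp_all add: C_def)
      finally show ?thesis using Cd by linarith
    qed
    have "norm (H_ip T \<iota> (u' n) z - duality T G z) < e" if "M \<le> n" for n
    proof -
      have b1: "\<bar>H_ip T \<iota> (u' n) (z - s)\<bar> \<le> e / 3" using uC[OF zs, of n] Cd by linarith
      show ?thesis
        using M[OF that] b1 b2 H_ip_right(1)[where \<iota>=\<iota>, OF uL(2)[of n] zL(1) sL(1)] duality_right(1)[OF GL zL(1) sL(1)]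
        unfolding real_norm_def by linarith
    qed
    then show "\<exists>M. \<forall>n\<ge>M. norm (H_ip T \<iota> (u' n) z - duality T G z) < e" by blast
  qed
  have lhs: "(\<lambda>n. H_ip T \<iota> (u' n) z + H_ip T \<iota> (u n) z') \<longlonglongrightarrow> duality T G z + H_ip T \<iota> w z'"
    by (intro tendsto_intros weak conv zL)
  moreover have "H_ip T \<iota> (u' n) z + H_ip T \<iota> (u n) z' = \<iota> (u n T) \<bullet> \<iota> (z T) - \<iota> (u n 0) \<bullet> \<iota> (z 0)" for n
    by (rule H_ip_by_parts[OF u(1) z]) (use T in simp)
  moreover have "(\<lambda>n. \<iota> (u n T) \<bullet> \<iota> (z T) - \<iota> (u n 0) \<bullet> \<iota> (z 0)) \<longlonglongrightarrow> c T \<bullet> \<iota> (z T) - c 0 \<bullet> \<iota> (z 0)"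
    by (intro tendsto_intros ptw) (use T in auto)
  ultimately have "duality T G z + H_ip T \<iota> w z' = c T \<bullet> \<iota> (z T) - c 0 \<bullet> \<iota> (z 0)"
    using LIMSEQ_unique by simp
  then show ?thesis
    using dt_eq_duality[OF G zL(1)] time_trace_eq[OF c T, of T] time_trace_eq[OF c T, of 0] T by simp
qed

section \<open>Equality of the two solution components\<close>

lemma H_ip_C1_self:
  assumes z: "C1_pair z z'" "z 0 = 0" and T: "0 \<le> T"
  shows "0 \<le> H_ip T \<iota> z' z"
proof -
  have "2 * H_ip T \<iota> z' z = (norm (\<iota> (z T)))\<^sup>2"
    using H_ip_by_parts[OF z(1) z(1) T, of \<iota>] H_ip_sym[of T \<iota> z z'] z(2) by (simp add: power2_norm_eq_inner)
  then show ?thesis using zero_le_power2[of "norm (\<iota> (z T))"] by linarith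
qed

lemma L2_ip_C1_self:
  assumes z: "C1_pair z z'" "z 0 = 0" and T: "0 \<le> T"
  shows "0 \<le> L2_ip T z' z"
proof -
  have "L2_ip T z z' = L2_ip T z' z" by (simp add: L2_ip_def inner_commute)
  then have "2 * L2_ip T z' z = (norm (z T))\<^sup>2"
    using L2_ip_by_parts[OF z(1) z(1) T] z(2) by (simp add: power2_norm_eq_inner)
  then show ?thesis using zero_le_power2[of "norm (z T)"] by linarith
qed

text \<open>
  The exponential average \<open>z\<close> of \<open>s\<close> solves \<open>z + z' / lam = s\<close> with \<open>z 0 = 0\<close>. Testing with \<open>z\<close>
  gives the contraction, and testing the equation of \<open>z - s\<close> with itself the rate of convergence.
\<close>

lemma smoothing_stability:
  fixes z s :: "real \<Rightarrow> 'b::real_inner"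
  assumes z: "C1_pair z z'" "z 0 = 0" and eq: "\<And>t. z' t = lam *\<^sub>R (s t - z t)"
    and s: "s \<in> L2 T" and T: "0 \<le> T" and lam: "0 < lam"
  shows "L2_norm T z \<le> L2_norm T s"
    and "C1_pair s s' \<Longrightarrow> s 0 = 0 \<Longrightarrow> lam * L2_norm T (z - s) \<le> L2_norm T s'"
proof -
  note zL = C1_pairD(4,5)[OF z(1), of T]
  have eq': "z' = lam *\<^sub>R (s - z)" by (rule ext) (simp add: scaleR_fun_def eq)
  have "0 \<le> lam * (L2_ip T s z - (L2_norm T z)\<^sup>2)"
    using L2_ip_C1_self[OF z T] unfolding eq' L2_ip_left(3)[OF zL(1) L2_diff[OF s zL(1)] s]
      L2_ip_left(1)[OF zL(1) s zL(1)] L2.N_sq[OF zL(1)] .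
  then have "(L2_norm T z)\<^sup>2 \<le> L2_ip T s z" using lam by (simp add: zero_le_mult_iff)
  also have "\<dots> \<le> L2_norm T s * L2_norm T z" using L2.cauchy_schwarz[OF s zL(1)] by simp
  finally show "L2_norm T z \<le> L2_norm T s" by (rule square_le_mult_imp_le) simp_all
  assume s': "C1_pair s s'" "s 0 = 0"
  note sL = C1_pairD(5)[OF s'(1), of T]
  let ?p = "z - s"
  have pL: "?p \<in> L2 T" by (rule L2_diff[OF zL(1) s])
  have p: "C1_pair ?p (z' - s')" "?p 0 = 0" using C1_pair_diff[OF z(1) s'(1)] z(2) s'(2) by auto
  have zs: "z' - s' = (- lam) *\<^sub>R ?p - s'" by (rule ext) (simp add: scaleR_fun_def eq algebra_simps)
  have "0 \<le> L2_ip T ((- lam) *\<^sub>R ?p - s') ?p" unfolding zs[symmetric] by (rule L2_ip_C1_self[OF p T])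
  also have "\<dots> = - lam * (L2_norm T ?p)\<^sup>2 - L2_ip T s' ?p"
    unfolding L2_ip_left(1)[OF pL subspace_scale[OF subspace_L2 pL] sL] L2_ip_left(3)[OF pL pL pL] L2.N_sq[OF pL] ..
  finally have "lam * (L2_norm T ?p)\<^sup>2 \<le> \<bar>L2_ip T s' ?p\<bar>" by linarith
  also have "\<dots> \<le> L2_norm T s' * L2_norm T ?p" by (rule L2.cauchy_schwarz[OF sL pL])
  finally have "(lam * L2_norm T ?p)\<^sup>2 \<le> L2_norm T s' * (lam * L2_norm T ?p)"
    using lam by (simp add: power_mult_distrib power2_eq_square mult.left_commute)
  then show "lam * L2_norm T ?p \<le> L2_norm T s'" by (rule square_le_mult_imp_le) (use lam in simp_all)
qed

text \<open>
  For \<open>y = s\<close> the pairing of \<open>z'\<close> with \<open>s = z + z' / lam\<close> is nonnegative; it even contains the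
  square of \<open>z'\<close> in \<open>L\<^sub>2(0,T;H)\<close> with the factor \<open>1 / lam\<close>, which absorbs the error from
  replacing \<open>s\<close> by \<open>y\<close>.
\<close>

lemma smoothing_energy:
  fixes \<iota> :: "'v::real_inner \<Rightarrow>\<^sub>L 'h::real_inner"
  assumes z: "C1_pair z z'" "z 0 = 0" and eq: "\<And>t. z' t = lam *\<^sub>R (s t - z t)"
    and s: "s \<in> L2 T" and y: "y \<in> L2 T" and T: "0 \<le> T" and lam: "0 < lam"
  shows "- H_ip T \<iota> z' y \<le> lam * (norm \<iota> * L2_norm T (s - y))\<^sup>2"
proof -
  note zL = C1_pairD(4,5)[OF z(1), of T]
  let ?E = "\<lambda>x::real \<Rightarrow> 'v. \<lambda>t. \<iota> (x t)"
  have EL: "?E x \<in> L2 T" if "x \<in> L2 T" for x by (rule L2_linear[OF that blinfun.bounded_linear_right])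
  have HE: "H_ip T \<iota> x r = L2_ip T (?E x) (?E r)" for x r by (simp add: H_ip_def L2_ip_def)
  define h k where "h = L2_norm T (?E z')" and "k = norm \<iota> * L2_norm T (s - y)"
  have "s = z + (1 / lam) *\<^sub>R z'" using lam by (intro ext) (simp add: scaleR_fun_def eq)
  then have "H_ip T \<iota> z' s = H_ip T \<iota> z' z + (1 / lam) * H_ip T \<iota> z' z'"
    using H_ip_right(2)[where \<iota>=\<iota>, OF zL(2) zL(1) subspace_scale[OF subspace_L2 zL(2), of "1 / lam"]]
      H_ip_right(3)[where \<iota>=\<iota> and c="1 / lam", OF zL(2) zL(2) zL(2)] by simp
  moreover have "(1 / lam) * H_ip T \<iota> z' z' = (1 / lam) * h\<^sup>2"
    unfolding HE h_def L2.N_sq[OF EL[OF zL(2)]] ..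
  moreover have "0 \<le> H_ip T \<iota> z' z" by (rule H_ip_C1_self[OF z T])
  moreover have "\<bar>H_ip T \<iota> z' (s - y)\<bar> \<le> h * k"
  proof -
    have "\<bar>H_ip T \<iota> z' (s - y)\<bar> \<le> h * L2_norm T (?E (s - y))"
      unfolding HE h_def by (rule L2.cauchy_schwarz[OF EL[OF zL(2)] EL[OF L2_diff[OF s y]]])
    also have "\<dots> \<le> h * k" unfolding k_def
      by (intro mult_left_mono L2_norm_linear_le[OF L2_diff[OF s y] blinfun.bounded_linear_right] norm_blinfun)
         (auto simp: h_def)
    finally show ?thesis .
  qed
  moreover have "H_ip T \<iota> z' (s - y) = H_ip T \<iota> z' s - H_ip T \<iota> z' y" by (rule H_ip_right(1)[OF zL(2) s y])
  moreover have "h * k \<le> (1 / lam) * h\<^sup>2 + lam * k\<^sup>2"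
  proof -
    have "0 \<le> (h - lam * k)\<^sup>2" by simp
    then have "2 * (lam * (h * k)) \<le> h\<^sup>2 + lam\<^sup>2 * k\<^sup>2" by (simp add: power2_diff power_mult_distrib algebra_simps)
    moreover have "0 \<le> lam * (h * k)" using lam by (simp add: h_def k_def)
    ultimately have "lam * (h * k) \<le> h\<^sup>2 + lam\<^sup>2 * k\<^sup>2" by linarith
    also have "\<dots> = lam * ((1 / lam) * h\<^sup>2 + lam * k\<^sup>2)" using lam by (simp add: power2_eq_square distrib_left)
    finally show ?thesis using lam by (simp only: mult_le_cancel_left_pos)
  qed
  ultimately show ?thesis unfolding k_def by linarith
qed

text \<open>
  For smooth \<open>z\<close> with \<open>z 0 = 0\<close> the two equations add up to \<open>\<alpha>(z) = - (z', \<eta>)\<close>, where \<open>\<eta> = \<theta> - u\<close> and \<open>\<alpha>\<close> is the difference of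
  the values of the monotone operator; the initial datum drops out. Were \<open>\<eta>\<close> itself admissible, the
  right-hand side would be nonpositive. Since \<open>\<eta>\<close> is only known to lie in \<open>Y\<close>, take for \<open>z\<close> an
  exponential average of \<open>\<eta>\<close>: the right-hand side is then at most a small number, so that
  \<open>\<alpha>(\<eta>) \<le> 0\<close>, and strong monotonicity gives \<open>\<eta> = 0\<close>.
\<close>

lemma parabolic_uniqueness:
  fixes \<iota> :: "'v::{real_inner,complete_space} \<Rightarrow>\<^sub>L 'h::{real_inner,complete_space}"
  assumes \<theta>: "\<theta> \<in> L2 T" and u: "u \<in> Xspace T \<iota>" and T: "0 < T"
    and a\<theta>: "a\<theta> \<in> dual (L2 T) (L2_norm T)" and au: "au \<in> dual (L2 T) (L2_norm T)"
    and mono: "m * (L2_norm T (\<theta> - u))\<^sup>2 \<le> a\<theta> (\<theta> - u) - au (\<theta> - u)" and m: "0 < m"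
    and first: "\<And>v. v \<in> L2 T \<Longrightarrow> a\<theta> v + dt T \<iota> u v = l v"
    and second: "\<And>z. z \<in> Xspace T \<iota> \<Longrightarrow>
      dt T \<iota> z \<theta> - (au z + time_trace T \<iota> T u \<bullet> time_trace T \<iota> T z) = - (l z + u0 \<bullet> time_trace T \<iota> 0 z)"
  shows "L2_norm T (\<theta> - u) = 0"
proof -
  have T0: "0 \<le> T" using T by simp
  have uL: "u \<in> L2 T" by (rule Xspace_L2[OF u])
  define \<eta> where "\<eta> = \<theta> - u"
  have \<eta>: "\<eta> \<in> L2 T" unfolding \<eta>_def by (rule L2_diff[OF \<theta> uL])
  define \<alpha> where "\<alpha> = (\<lambda>x. 1 * a\<theta> x + (-1) * au x)"
  have \<alpha>: "\<alpha> \<in> dual (L2 T) (L2_norm T)" unfolding \<alpha>_def by (rule L2.dual_combination[OF a\<theta> au])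
  define M where "M = dual_norm (L2 T) (L2_norm T) \<alpha>"
  have M0: "0 \<le> M" unfolding M_def by (rule L2.dual_norm_nonneg[OF \<alpha>])
  \<comment> \<open>Sum of the two equations; the values at \<open>T\<close> cancel by integration by parts.\<close>
  have key: "\<alpha> z + H_ip T \<iota> z' \<eta> = 0" if z: "C1_pair z z'" "z 0 = 0" for z z'
  proof -
    note zL = C1_pairD(4,5)[OF z(1), of T]
    have tr: "time_trace T \<iota> T z = \<iota> (z T)" "time_trace T \<iota> 0 z = 0"
      using time_trace_C1[OF z(1) T, of T \<iota>] time_trace_C1[OF z(1) T, of 0 \<iota>] T z(2) by simp_all
    have "dt T \<iota> z \<theta> = H_ip T \<iota> z' \<theta>" by (rule dt_C1[OF z(1) T0 \<theta>])
    moreover have "H_ip T \<iota> z' \<eta> = H_ip T \<iota> z' \<theta> - H_ip T \<iota> z' u"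
      unfolding \<eta>_def by (rule H_ip_right(1)[OF zL(2) \<theta> uL])
    moreover have "dt T \<iota> u z + H_ip T \<iota> u z' = time_trace T \<iota> T u \<bullet> \<iota> (z T)"
      using integration_by_parts_Xspace[OF u z(1) T] z(2) by simp
    ultimately show ?thesis
      using first[OF zL(1)] second[OF C1_Xspace[OF z(1) T0]] H_ip_sym[of T \<iota> u z'] tr
      by (simp add: \<alpha>_def)
  qed
  have "\<alpha> \<eta> \<le> 0"
  proof (rule field_le_epsilon)
    fix e :: real assume e: "0 < e"
    define d where "d = min 1 (e / (1 + 4 * M))"
    have M1: "0 < 1 + 4 * M" using M0 by simp
    have d: "0 < d" "d \<le> 1" using e M1 by (auto simp: d_def)
    have de: "(1 + 4 * M) * d \<le> e"
    proof -
      have "(1 + 4 * M) * d \<le> (1 + 4 * M) * (e / (1 + 4 * M))" using M1 by (intro mult_left_mono) (auto simp: d_def)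
      then show ?thesis using M1 by simp
    qed
    obtain s0 where s0: "s0 \<in> span (D0 T)" "L2_norm T (\<eta> - s0) < d" using L2_dense[OF \<eta> d(1)] by blast
    obtain s0' where s0': "C1_pair s0 s0'" "s0 0 = 0" using span_D0_C1[OF s0(1)] by blast
    \<comment> \<open>The rate \<open>lam\<close> depends on the fixed \<open>s0\<close>; the better approximation \<open>s\<close> is chosen after \<open>lam\<close>,
      because the error in \<open>smoothing_energy\<close> grows with \<open>lam\<close>.\<close>
    define lam where "lam = (L2_norm T s0' + 1) / d"
    have n1: "0 < L2_norm T s0' + 1" using L2_norm_nonneg[of T s0'] by linarith
    have lam: "0 < lam" using n1 d by (simp add: lam_def)
    have lamd: "L2_norm T s0' \<le> lam * d" using d by (simp add: lam_def)
    define b where "b = lam * (norm \<iota>)\<^sup>2 + 1"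
    have b: "0 < b" using lam by (simp add: b_def add_nonneg_pos)
    define r where "r = min d (d / b)"
    have r: "0 < r" "r \<le> d" "b * r \<le> d"
    proof -
      show "0 < r" "r \<le> d" using d b by (auto simp: r_def)
      have "b * r \<le> b * (d / b)" using b by (intro mult_left_mono) (auto simp: r_def)
      then show "b * r \<le> d" using b by simp
    qed
    obtain s where s: "s \<in> span (D0 T)" "L2_norm T (\<eta> - s) < r" using L2_dense[OF \<eta> r(1)] by blast
    note sL = span_D0_L2[OF s(1)] span_D0_L2[OF s0(1)]
    obtain z z' where z: "C1_pair z z'" and zeq: "\<And>t. z' t = lam *\<^sub>R (s t - z t)" and z0: "z 0 = 0"
      using smoothing_solvable[OF s(1), of lam] by blast
    obtain y y' where y: "C1_pair y y'" and yeq: "\<And>t. y' t = lam *\<^sub>R (s0 t - y t)" and y0: "y 0 = 0"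
      using smoothing_solvable[OF s0(1), of lam] by blast
    note zL = C1_pairD(4)[OF z, of T] and yL = C1_pairD(4)[OF y, of T]
    have zy: "L2_norm T (z - y) \<le> L2_norm T (s - s0)"
    proof (rule smoothing_stability(1)[OF C1_pair_diff[OF z y]])
      show "(z' - y') t = lam *\<^sub>R ((s - s0) t - (z - y) t)" for t
        using zeq[of t] yeq[of t] by (simp add: algebra_simps)
    qed (use z0 y0 L2_diff[OF sL] T0 lam in auto)
    have "lam * L2_norm T (y - s0) \<le> lam * d"
      by (rule order_trans[OF smoothing_stability(2)[OF y y0 yeq sL(2) T0 lam s0'] lamd])
    then have ys: "L2_norm T (y - s0) \<le> d" using lam by simp
    have ss: "L2_norm T (s - s0) \<le> 2 * d"
      using L2_norm_triangle_diff[OF sL(1) \<eta> sL(2)] L2.N_minus_commute[OF sL(1) \<eta>] s(2) s0(2) r(2) by linarith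
    have dist: "L2_norm T (\<eta> - z) \<le> 4 * d"
      using L2_norm_triangle_diff[OF \<eta> sL(2) zL] L2_norm_triangle_diff[OF sL(2) yL zL]
        L2.N_minus_commute[OF sL(2) yL] L2.N_minus_commute[OF yL zL] zy ys ss s0(2) by linarith
    have "\<alpha> z \<le> d"
    proof -
      define k where "k = L2_norm T (s - \<eta>)"
      have k: "0 \<le> k" "k \<le> r" "k \<le> 1"
        using s(2) r(2) d(2) L2.N_minus_commute[OF sL(1) \<eta>] by (auto simp: k_def)
      have "\<alpha> z = - H_ip T \<iota> z' \<eta>" using key[OF z z0] by simp
      also have "\<dots> \<le> lam * (norm \<iota> * k)\<^sup>2"
        unfolding k_def by (rule smoothing_energy[OF z z0 zeq sL(1) \<eta> T0 lam])
      also have "\<dots> = (lam * (norm \<iota>)\<^sup>2) * (k * k)" by (simp add: power_mult_distrib power2_eq_square)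
      also have "\<dots> \<le> b * (1 * r)"
        using k lam by (intro mult_mono) (auto simp: b_def)
      finally show ?thesis using r(3) by simp
    qed
    moreover have "\<alpha> \<eta> = \<alpha> z + \<alpha> (\<eta> - z)" using L2.dual_lin(2)[OF \<alpha> \<eta> zL] by simp
    moreover have "\<bar>\<alpha> (\<eta> - z)\<bar> \<le> M * (4 * d)"
      by (rule order_trans[OF L2.bounded_dual[OF \<alpha> L2_diff[OF \<eta> zL], folded M_def] mult_left_mono[OF dist M0]])
    ultimately have "\<alpha> \<eta> \<le> d + M * (4 * d)" by linarith
    also have "\<dots> = (1 + 4 * M) * d" by (simp add: algebra_simps)
    finally show "\<alpha> \<eta> \<le> 0 + e" using de by linarith
  qed
  then have "m * (L2_norm T \<eta>)\<^sup>2 \<le> 0" using mono by (simp add: \<alpha>_def \<eta>_def)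
  then have "(L2_norm T \<eta>)\<^sup>2 \<le> 0" using m by (simp add: mult_le_0_iff)
  then show ?thesis by (simp add: \<eta>_def)
qed

section \<open>Quasi-optimality\<close>

lemma Xnorm_triangle:
  fixes \<iota> :: "'v::{real_inner,complete_space} \<Rightarrow>\<^sub>L 'h::{real_inner,complete_space}"
  assumes w: "w \<in> Xspace T \<iota>" and v: "v \<in> Xspace T \<iota>" and T: "0 < T"
  shows "Xnorm T \<iota> (w + v) \<le> Xnorm T \<iota> w + Xnorm T \<iota> v"
proof -
  let ?D = "\<lambda>w. dual_norm (L2 T) (L2_norm T) (dt T \<iota> w)"
  let ?P = "\<lambda>w. (L2_norm T w, ?D w, norm (time_trace T \<iota> T w))"
  have X: "Xnorm T \<iota> w = norm (?P w)" for w
    by (simp add: Xnorm_def norm_Pair)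
  note wL = Xspace_L2[OF w] and vL = Xspace_L2[OF v]
  have D0: "0 \<le> ?D w" if "w \<in> Xspace T \<iota>" for w by (rule L2.dual_norm_nonneg[OF dt_dual[OF that]])
  have wv: "w + v \<in> Xspace T \<iota>" using subspace_add[OF subspace_Xspace w v] T by simp
  have 1: "L2_norm T (w + v) \<le> L2_norm T w + L2_norm T v" by (rule L2_norm_triangle[OF wL vL])
  have 2: "?D (w + v) \<le> ?D w + ?D v"
  proof (rule L2.dual_norm_le)
    fix x :: "real \<Rightarrow> 'v" assume x: "x \<in> L2 T"
    have "dt T \<iota> (w + v) x = dt T \<iota> w x + dt T \<iota> v x" using dt_combination[OF w v x, of 1] by simp
    then show "\<bar>dt T \<iota> (w + v) x\<bar> \<le> (?D w + ?D v) * L2_norm T x"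
      using L2.bounded_dual[OF dt_dual[OF w] x] L2.bounded_dual[OF dt_dual[OF v] x]
      unfolding distrib_right by linarith
  qed (use D0 w v in simp)
  have 3: "norm (time_trace T \<iota> T (w + v)) \<le> norm (time_trace T \<iota> T w) + norm (time_trace T \<iota> T v)"
    using time_trace_combination[OF w v T, of T 1] T norm_triangle_ineq by simp
  have "norm (?P (w + v)) \<le> norm (?P w + ?P v)"
    using 1 2 3 D0[OF wv] unfolding norm_Pair plus_prod_def fst_conv snd_conv
    by (intro real_sqrt_le_mono add_mono power_mono) (auto intro!: real_sqrt_le_mono add_mono power_mono)
  also have "\<dots> \<le> norm (?P w) + norm (?P v)" by (rule norm_triangle_ineq)
  finally show ?thesis unfolding X .
qed

lemma L2_norm_le_Xnorm: "L2_norm T w \<le> Xnorm T \<iota> w"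
  unfolding Xnorm_def by (rule real_le_rsqrt) simp

lemma cauchy_schwarz_2:
  fixes a b c d :: real
  assumes "0 \<le> a" "0 \<le> b" "0 \<le> c" "0 \<le> d"
  shows "a * c + b * d \<le> sqrt (a\<^sup>2 + b\<^sup>2) * sqrt (c\<^sup>2 + d\<^sup>2)"
proof -
  have "(a * c + b * d)\<^sup>2 \<le> (a\<^sup>2 + b\<^sup>2) * (c\<^sup>2 + d\<^sup>2)"
    using zero_le_power2[of "a * d - b * c"] by (simp add: power2_eq_square algebra_simps)
  then have "a * c + b * d \<le> sqrt ((a\<^sup>2 + b\<^sup>2) * (c\<^sup>2 + d\<^sup>2))" by (rule real_le_rsqrt)
  then show ?thesis by (simp add: real_sqrt_mult)
qed

text \<open>
  In terms of the best approximation error, \<open>p\<close> is its first component in \<open>Y\<close>, and \<open>b\<close>, \<open>a\<close>, \<open>c\<close>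
  are the three contributions to the norm of the second component in \<open>X\<close>. If \<open>L \<ge> 1\<close>, the operator
  \<open>N\<close> is Lipschitz with constant \<open>L + 1\<close> and the claim is that bound combined with the one for the
  inverse. If \<open>L < 1\<close>, that Lipschitz bound may fail for the sum norms, but then \<open>m \<le> L < 1\<close>, and the
  factor \<open>1 / m\<close> which \<open>L_Ninv\<close> attaches to all terms compensates for it.
\<close>

lemma quasi_optimality_constant:
  fixes L m p a b c F :: real
  assumes m: "0 < m" "m \<le> L" and nn: "0 \<le> p" "0 \<le> a" "0 \<le> b" "0 \<le> c" "0 \<le> F"
    and F: "F \<le> L * p + a"
  shows "F / m + (1 + 1 / m) / m_S L m * (p + sqrt ((L * b)\<^sup>2 + c\<^sup>2) + F / m)
    \<le> L_Ninv L m * L_N L * (p + sqrt (b\<^sup>2 + a\<^sup>2 + c\<^sup>2))"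
proof -
  define q r where "q = sqrt ((L * b)\<^sup>2 + c\<^sup>2)" and "r = sqrt (b\<^sup>2 + a\<^sup>2 + c\<^sup>2)"
  have q0: "0 \<le> q" and r0: "0 \<le> r" by (simp_all add: q_def r_def)
  have ar: "a \<le> r" unfolding r_def by (rule real_le_rsqrt) simp
  have L: "0 < L" using m by simp
  have mS: "0 < m_S L m" using m L by (simp add: m_S_def)
  show ?thesis
  proof (cases "1 \<le> L")
    case True
    have "q \<le> L * r"
    proof -
      have "c\<^sup>2 \<le> (L * c)\<^sup>2" using mult_right_mono[OF True nn(4)] nn(4) by (intro power_mono) auto
      then have "q \<le> sqrt ((L * b)\<^sup>2 + (L * c)\<^sup>2)" unfolding q_def by (intro real_sqrt_le_mono) simp
      also have "\<dots> = sqrt (L\<^sup>2 * (b\<^sup>2 + c\<^sup>2))" by (simp add: power_mult_distrib distrib_left)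
      also have "\<dots> = L * sqrt (b\<^sup>2 + c\<^sup>2)" using L by (simp add: real_sqrt_mult)
      also have "\<dots> \<le> L * r" unfolding r_def using L by (intro mult_left_mono real_sqrt_le_mono) auto
      finally show ?thesis .
    qed
    then have sum: "F + (p + q) \<le> (L + 1) * (p + r)" using F ar by (simp add: algebra_simps)
    define M where "M = max 1 (1 / m)"
    have M: "1 \<le> M" "1 / m \<le> M" by (auto simp: M_def)
    have "p + q \<le> M * (p + q)" using mult_right_mono[OF M(1), of "p + q"] nn q0 by simp
    moreover have "F / m \<le> M * F" using mult_right_mono[OF M(2) nn(5)] by simp
    ultimately have le: "p + q + F / m \<le> M * (F + (p + q))" by (simp add: algebra_simps)
    have c0: "0 \<le> (1 + 1 / m) / m_S L m" using m mS by simp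
    have "F / m + (1 + 1 / m) / m_S L m * (p + q + F / m)
        \<le> (1 / m) * (F + (p + q)) + (1 + 1 / m) / m_S L m * (M * (F + (p + q)))"
    proof (rule add_mono)
      show "F / m \<le> (1 / m) * (F + (p + q))" using m nn q0 by (simp add: divide_right_mono)
      show "(1 + 1 / m) / m_S L m * (p + q + F / m) \<le> (1 + 1 / m) / m_S L m * (M * (F + (p + q)))"
        by (rule mult_left_mono[OF le c0])
    qed
    also have "\<dots> = L_Ninv L m * (F + (p + q))"
    proof -
      define d where "d = (1 + 1 / m) / m_S L m"
      have "L_Ninv L m = 1 / m + M * d" by (simp add: L_Ninv_def M_def[symmetric] d_def)
      then show ?thesis unfolding d_def[symmetric] by (simp only: distrib_right) (simp only: mult_ac)
    qed
    also have "\<dots> \<le> L_Ninv L m * ((L + 1) * (p + r))"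
    proof (rule mult_left_mono[OF sum])
      have "0 \<le> M * (1 / m_S L m) * (1 + 1 / m)" using M m mS by (intro mult_nonneg_nonneg) auto
      then show "0 \<le> L_Ninv L m" unfolding L_Ninv_def M_def using m by simp
    qed
    finally show ?thesis by (simp add: q_def r_def L_N_def mult.assoc)
  next
    case False
    then have L1: "L < 1" and m1: "m < 1" using m by auto
    have mSm: "m_S L m = m"
    proof -
      have "L\<^sup>2 \<le> 1" using L1 L by (simp add: power_le_one)
      then have "m \<le> m / L\<^sup>2" using m L by (simp add: pos_le_divide_eq mult_left_le)
      then show ?thesis using m1 by (simp add: m_S_def)
    qed
    have M: "max 1 (1 / m) = 1 / m" using m m1 by simp
    have qr: "q \<le> r"
    proof -
      have "(L * b)\<^sup>2 \<le> b\<^sup>2" using L1 L nn(3) mult_right_mono[of L 1 b] by (intro power_mono) auto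
      then show ?thesis unfolding q_def r_def by (intro real_sqrt_le_mono) (use zero_le_power2[of a] in linarith)
    qed
    define k where "k = m\<^sup>2 + m + 1"
    have k: "0 < k" using m by (simp add: k_def add_pos_pos)
    have "m\<^sup>2 * F + (m + 1) * (m * (p + q) + F) = k * F + (m\<^sup>2 + m) * (p + q)"
      by (simp add: k_def algebra_simps power2_eq_square)
    also have "\<dots> \<le> k * (L * p + a) + (m\<^sup>2 + m) * (p + q)" using F k by simp
    also have "\<dots> \<le> k * (L + 1) * (p + r)"
    proof -
      have "(m\<^sup>2 + m) * p \<le> k * p" using nn(1) by (intro mult_right_mono) (auto simp: k_def)
      moreover have "(m\<^sup>2 + m) * q \<le> k * (L * r)"
      proof -
        have "m\<^sup>2 + m \<le> m * k" using m by (simp add: k_def algebra_simps power2_eq_square)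
        also have "\<dots> \<le> L * k" using m(2) k by (intro mult_right_mono) auto
        finally have "(m\<^sup>2 + m) * q \<le> (L * k) * r" using qr q0 L k by (intro mult_mono) auto
        then show ?thesis by (simp add: mult_ac)
      qed
      moreover have "k * a \<le> k * r" using ar k by simp
      ultimately show ?thesis by (simp add: algebra_simps)
    qed
    finally have main: "m\<^sup>2 * F + (m + 1) * (m * (p + q) + F) \<le> k * (L + 1) * (p + r)" .
    have "F / m + (1 + 1 / m) / m * (p + q + F / m) = (m\<^sup>2 * F + (m + 1) * (m * (p + q) + F)) / (m * m\<^sup>2)"
      using m by (simp add: field_simps power2_eq_square)
    also have "\<dots> \<le> (k * (L + 1) * (p + r)) / (m * m\<^sup>2)"
      using main m by (intro divide_right_mono) auto
    also have "\<dots> = (1 / m + 1 / m * (1 / m) * (1 + 1 / m)) * (L + 1) * (p + r)"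
      using m by (simp add: k_def field_simps power2_eq_square)
    finally show ?thesis
      by (simp only: q_def[symmetric] r_def[symmetric] L_N_def L_Ninv_def M mSm)
  qed
qed

text \<open>
  Here \<open>P\<close> and \<open>r / g\<close> bound the two components of the discrete error. One factor \<open>1 / g\<close> comes from
  estimating the residual of the second equation in the discrete norm of \<open>X\<close>, the other from
  returning from that norm to the norm of \<open>X\<close>.
\<close>

lemma discrete_stability_arith:
  fixes P r a F q \<mu> m g :: real
  assumes g: "0 < g" "g \<le> 1" and m: "0 < m" and \<mu>: "0 < \<mu>" and nn: "0 \<le> q" "0 \<le> F" "0 \<le> r" "0 \<le> P"
    and ar: "a \<le> r" and P: "m * P \<le> F + a"
    and energy: "\<mu> * r\<^sup>2 \<le> q * r / g + a * F / m"
  shows "P + r / g \<le> (F / m + (1 + 1 / m) / \<mu> * (q + F / m)) / g\<^sup>2"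
proof -
  define R where "R = q + F / m"
  have R0: "0 \<le> R" using nn m by (simp add: R_def)
  have g1: "1 \<le> 1 / g" using g by simp
  have "a * F / m \<le> (F / m) * (1 / g) * r"
  proof -
    have "a * F / m = a * (F / m)" by simp
    also have "\<dots> \<le> r * (F / m * (1 / g))"
      using ar nn m g mult_left_mono[OF g1, of "F / m"] by (intro mult_mono) auto
    finally show ?thesis by (simp add: mult_ac)
  qed
  then have "\<mu> * r\<^sup>2 \<le> (R / g) * r" using energy by (simp add: R_def add_divide_distrib algebra_simps)
  then have "(\<mu> * r)\<^sup>2 \<le> (R / g) * (\<mu> * r)"
    using mult_left_mono[of "\<mu> * r\<^sup>2" "(R / g) * r" \<mu>] \<mu> by (simp add: power_mult_distrib power2_eq_square mult_ac)
  then have "\<mu> * r \<le> R / g" by (rule square_le_mult_imp_le) (use \<mu> nn R0 g in auto)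
  then have "r \<le> (R / g) / \<mu>" unfolding pos_le_divide_eq[OF \<mu>] by (simp only: mult.commute)
  then have r: "r \<le> (R / \<mu>) / g" by (simp add: mult.commute)
  have "m * P \<le> F + r" using P ar by simp
  then have "P \<le> (F + r) / m" using m by (simp add: pos_le_divide_eq mult.commute)
  then have "P + r / g \<le> F / m + r / m + r / g" by (simp add: add_divide_distrib)
  also have "r / m \<le> (r / m) / g" using mult_left_mono[OF g1, of "r / m"] nn m by simp
  also have "F / m + (r / m) / g + r / g = F / m + (1 + 1 / m) * r / g"
    by (simp add: algebra_simps add_divide_distrib)
  also have "(1 + 1 / m) * r / g \<le> (1 + 1 / m) * ((R / \<mu>) / g) / g"
    using r m g by (intro divide_right_mono mult_left_mono) auto
  also have "\<dots> = ((1 + 1 / m) / \<mu> * R) / g\<^sup>2" by (simp add: power2_eq_square)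
  also have "F / m \<le> (F / m) / g\<^sup>2"
  proof -
    have "g\<^sup>2 \<le> 1" using g by (simp add: power_le_one)
    then have "1 \<le> 1 / g\<^sup>2" using g by simp
    from mult_left_mono[OF this, of "F / m"] show ?thesis using nn m by simp
  qed
  finally show ?thesis by (simp add: R_def add_divide_distrib)
qed

lemma semi_inner_L2_subspace:
  fixes S :: "(real \<Rightarrow> 'b::real_inner) set"
  assumes "subspace S" "S \<subseteq> L2 T"
  shows "semi_inner_space S (L2_ip T)"
proof
  show "subspace S" by (rule assms(1))
  show "L2_ip T x y = L2_ip T y x" if "x \<in> S" "y \<in> S" for x y
    using that assms(2) by (intro L2.ip_sym) auto
  show "L2_ip T (x + y) z = L2_ip T x z + L2_ip T y z" if "x \<in> S" "y \<in> S" "z \<in> S" for x y z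
    using that assms(2) by (intro L2.ip_add) auto
  show "L2_ip T (c *\<^sub>R x) y = c * L2_ip T x y" if "x \<in> S" "y \<in> S" for c x y
    using that assms(2) by (intro L2.ip_scale) auto
  show "0 \<le> L2_ip T x x" if "x \<in> S" for x
    using that assms(2) by (intro L2.ip_nonneg) auto
qed

lemma dual_subset:
  assumes "F \<in> dual S N" "R \<subseteq> S"
  shows "F \<in> dual R N"
proof -
  have "\<exists>C. \<forall>x\<in>S. \<bar>F x\<bar> \<le> C * N x" using assms(1) by (simp add: dual_def)
  then obtain C where C: "\<forall>x\<in>S. \<bar>F x\<bar> \<le> C * N x" ..
  show ?thesis
  proof (rule dualI)
    show "\<bar>F x\<bar> \<le> C * N x" if "x \<in> R" for x
      by (rule bspec[OF C subsetD[OF assms(2) that]])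
    show "F (x + y) = F x + F y" if "x \<in> R" "y \<in> R" for x y
      by (rule dualD(1)[OF assms(1) subsetD[OF assms(2) that(1)] subsetD[OF assms(2) that(2)]])
    show "F (c *\<^sub>R x) = c * F x" if "x \<in> R" for c x
      by (rule dualD(2)[OF assms(1) subsetD[OF assms(2) that] subsetD[OF assms(2) that]])
  qed
qed

text \<open>
  Let \<open>e\<close> and \<open>\<eta>\<close> be the differences between an arbitrary discrete pair and the discrete solution,
  and \<open>d\<close> the time derivative of \<open>\<eta>\<close>. The first Galerkin equation bounds the dual norm \<open>F\<close> of
  \<open>\<alpha> + d\<close> by the approximation error, where \<open>\<alpha>\<close> is the difference of the values of the monotone
  operator. The second one, tested with \<open>\<eta>\<close>, expresses \<open>d e\<close> by the energy of \<open>\<eta>\<close> up to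
  approximation errors, and \<open>monotone_residual_pairing\<close> bounds \<open>d e\<close> from above by
  \<open>a F / m - (m / L\<^sup>2) a\<^sup>2\<close>. The last term supplies the part of the discrete norm of \<open>X\<close> that
  measures \<open>d\<close>. As that norm contains the discrete dual norm \<open>a\<close> instead of the full one, the inf-sup
  constant enters twice.
\<close>

theorem galerkin_quasi_optimal:
  fixes \<iota> :: "'v::{real_inner,complete_space} \<Rightarrow>\<^sub>L 'h::{real_inner,complete_space}"
    and A :: "real \<Rightarrow> 'v \<Rightarrow> 'v \<Rightarrow>\<^sub>L real"
  assumes T: "0 < T" and A: "lipschitz_monotone T A L m" and m: "0 < m" "m \<le> L"
    and YS: "subspace YS" "YS \<subseteq> L2 T" and XS: "subspace XS" "XS \<subseteq> Xspace T \<iota>"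
    and g: "0 < g" "g \<le> 1"
    and infsup: "\<And>z. z \<in> XS \<Longrightarrow>
      g * dual_norm (L2 T) (L2_norm T) (dt T \<iota> z) \<le> dual_norm YS (L2_norm T) (dt T \<iota> z)"
    and \<theta>: "\<theta> \<in> L2 T" and u: "u \<in> Xspace T \<iota>" and \<theta>d: "\<theta>d \<in> YS" and ud: "ud \<in> XS"
    and orth1: "\<And>v. v \<in> YS \<Longrightarrow> op_A T A \<theta> v + dt T \<iota> u v = op_A T A \<theta>d v + dt T \<iota> ud v"
    and orth2: "\<And>z. z \<in> XS \<Longrightarrow>
      dt T \<iota> z \<theta> - (op_A T A u z + time_trace T \<iota> T u \<bullet> time_trace T \<iota> T z)
      = dt T \<iota> z \<theta>d - (op_A T A ud z + time_trace T \<iota> T ud \<bullet> time_trace T \<iota> T z)"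
    and \<theta>b: "\<theta>b \<in> YS" and ub: "ub \<in> XS"
  shows "L2_norm T (\<theta> - \<theta>d) + Xnorm T \<iota> (u - ud)
    \<le> (1 + L_Ninv L m * L_N L / g\<^sup>2) * (L2_norm T (\<theta> - \<theta>b) + Xnorm T \<iota> (u - ub))"
proof -
  let ?op = "op_A T A" and ?n = "L2_norm T" and ?tr = "time_trace T \<iota> T"
  let ?DY = "dual_norm (L2 T) (L2_norm T)" and ?Dd = "dual_norm YS (L2_norm T)"
  interpret D: semi_inner_space YS "L2_ip T"
    rewrites "semi_inner_space.N (L2_ip T) = L2_norm T"
    by (rule semi_inner_L2_subspace[OF YS], rule L2_norm_eq)
  have T0: "0 \<le> T" and L: "0 < L" using T m by auto
  have opD: "?op w \<in> dual (L2 T) ?n" if "w \<in> L2 T" for w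
    using A that unfolding lipschitz_monotone_def by blast
  have opL: "?DY (?op w - ?op v) \<le> L * ?n (w - v)" if "w \<in> L2 T" "v \<in> L2 T" for w v
    using A that unfolding lipschitz_monotone_def by blast
  have opM: "m * (?n (w - v))\<^sup>2 \<le> ?op w (w - v) - ?op v (w - v)" if "w \<in> L2 T" "v \<in> L2 T" for w v
    using A that unfolding lipschitz_monotone_def by fastforce
  have opdiff: "?op w - ?op v \<in> dual (L2 T) ?n" if "w \<in> L2 T" "v \<in> L2 T" for w v
    using L2.dual_combination[OF opD[OF that(1)] opD[OF that(2)], of 1 "-1"]
    by (simp add: fun_diff_def)
  have opB: "\<bar>?op w x - ?op v x\<bar> \<le> L * ?n (w - v) * ?n x" if "w \<in> L2 T" "v \<in> L2 T" "x \<in> L2 T" for w v x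
  proof -
    have "\<bar>(?op w - ?op v) x\<bar> \<le> ?DY (?op w - ?op v) * ?n x"
      by (rule L2.bounded_dual[OF opdiff[OF that(1,2)] that(3)])
    also have "\<dots> \<le> L * ?n (w - v) * ?n x" by (rule mult_right_mono[OF opL[OF that(1,2)]]) simp
    finally show ?thesis by simp
  qed
  have \<theta>bL: "\<theta>b \<in> L2 T" and \<theta>dL: "\<theta>d \<in> L2 T" using \<theta>b \<theta>d YS(2) by auto
  have ubX: "ub \<in> Xspace T \<iota>" and udX: "ud \<in> Xspace T \<iota>" using ub ud XS(2) by auto
  note uL = Xspace_L2[OF u] and ubL = Xspace_L2[OF ubX] and udL = Xspace_L2[OF udX]
  have dtdiff: "dt T \<iota> (w - v) x = dt T \<iota> w x - dt T \<iota> v x"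
    if "w \<in> Xspace T \<iota>" "v \<in> Xspace T \<iota>" "x \<in> L2 T" for w v x
    using dt_combination[OF that, of "-1"] by simp
  have trdiff: "?tr (w - v) = ?tr w - ?tr v" if "w \<in> Xspace T \<iota>" "v \<in> Xspace T \<iota>" for w v
    using time_trace_combination[OF that T, of T "-1"] T by simp
  define e where "e = \<theta>b - \<theta>d"
  define \<eta> where "\<eta> = ub - ud"
  define w where "w = u - ub"
  have e: "e \<in> YS" unfolding e_def by (rule subspace_diff[OF YS(1) \<theta>b \<theta>d])
  have eL: "e \<in> L2 T" using e YS(2) by blast
  have \<eta>: "\<eta> \<in> XS" unfolding \<eta>_def by (rule subspace_diff[OF XS(1) ub ud])
  have \<eta>X: "\<eta> \<in> Xspace T \<iota>" using \<eta> XS(2) by blast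
  note \<eta>L = Xspace_L2[OF \<eta>X]
  have wX: "w \<in> Xspace T \<iota>" unfolding w_def by (rule subspace_diff[OF subspace_Xspace[OF T0] u ubX])
  define \<alpha> where "\<alpha> = ?op \<theta>b - ?op \<theta>d"
  define d where "d = dt T \<iota> \<eta>"
  have \<alpha>D: "\<alpha> \<in> dual YS ?n" unfolding \<alpha>_def by (rule dual_subset[OF opdiff[OF \<theta>bL \<theta>dL] YS(2)])
  have dD: "d \<in> dual YS ?n" unfolding d_def by (rule dual_subset[OF dt_dual[OF \<eta>X] YS(2)])
  have rD: "(\<lambda>x. \<alpha> x + d x) \<in> dual YS ?n" using D.dual_combination[OF \<alpha>D dD, of 1 1] by simp
  define P where "P = ?n e"
  define p where "p = ?n (\<theta> - \<theta>b)"
  define a where "a = ?Dd d"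
  define F where "F = ?Dd (\<lambda>x. \<alpha> x + d x)"
  define b where "b = ?n \<eta>"
  define c where "c = norm (?tr \<eta>)"
  define a0 where "a0 = ?DY (dt T \<iota> w)"
  define b0 where "b0 = ?n w"
  define c0 where "c0 = norm (?tr w)"
  define q where "q = sqrt ((L * b0)\<^sup>2 + c0\<^sup>2)"
  define r where "r = sqrt (b\<^sup>2 + a\<^sup>2 + c\<^sup>2)"
  have nn: "0 \<le> P" "0 \<le> p" "0 \<le> b" "0 \<le> c" "0 \<le> b0" "0 \<le> c0" "0 \<le> q" "0 \<le> r"
    by (simp_all add: P_def p_def b_def c_def b0_def c0_def q_def r_def)
  have a: "0 \<le> a" unfolding a_def by (rule D.dual_norm_nonneg[OF dD])
  have F: "0 \<le> F" unfolding F_def by (rule D.dual_norm_nonneg[OF rD])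
  have a0: "0 \<le> a0" unfolding a0_def by (rule L2.dual_norm_nonneg[OF dt_dual[OF wX]])
  have r2: "r\<^sup>2 = b\<^sup>2 + a\<^sup>2 + c\<^sup>2" by (simp add: r_def)
  have ar: "a \<le> r" unfolding r_def by (rule real_le_rsqrt) simp
  have bp: "?n (\<theta>b - \<theta>) = p" unfolding p_def by (rule L2.N_minus_commute[OF \<theta>bL \<theta>])
  have bu: "?n (ub - u) = b0" unfolding b0_def w_def by (rule L2.N_minus_commute[OF ubL uL])

  have FLp: "F \<le> L * p + a0"
    unfolding F_def
  proof (rule D.dual_norm_le)
    fix v assume v: "v \<in> YS"
    then have vL: "v \<in> L2 T" using YS(2) by blast
    have "d v = dt T \<iota> ub v - dt T \<iota> ud v" unfolding d_def \<eta>_def by (rule dtdiff[OF ubX udX vL])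
    moreover have "dt T \<iota> w v = dt T \<iota> u v - dt T \<iota> ub v" unfolding w_def by (rule dtdiff[OF u ubX vL])
    ultimately have "\<alpha> v + d v = (?op \<theta>b v - ?op \<theta> v) - dt T \<iota> w v"
      using orth1[OF v] by (simp add: \<alpha>_def)
    moreover have "\<bar>?op \<theta>b v - ?op \<theta> v\<bar> \<le> L * p * ?n v" using opB[OF \<theta>bL \<theta> vL] by (simp add: bp)
    moreover have "\<bar>dt T \<iota> w v\<bar> \<le> a0 * ?n v" unfolding a0_def by (rule L2.bounded_dual[OF dt_dual[OF wX] vL])
    ultimately show "\<bar>\<alpha> v + d v\<bar> \<le> (L * p + a0) * ?n v" unfolding distrib_right by linarith
  qed (use L nn a0 in simp)

  have \<alpha>L: "?Dd \<alpha> \<le> L * ?n e"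
  proof (rule D.dual_norm_le)
    fix v assume "v \<in> YS"
    then have vL: "v \<in> L2 T" using YS(2) by blast
    show "\<bar>\<alpha> v\<bar> \<le> L * ?n e * ?n v" using opB[OF \<theta>bL \<theta>dL vL] by (simp add: \<alpha>_def e_def)
  qed (use L in simp)
  have \<alpha>m: "m * (?n e)\<^sup>2 \<le> \<alpha> e" using opM[OF \<theta>bL \<theta>dL] by (simp add: \<alpha>_def e_def)
  have de: "d e \<le> a * F / m - m / L\<^sup>2 * a\<^sup>2"
    unfolding a_def F_def by (rule D.monotone_residual_pairing[OF \<alpha>D dD e m \<alpha>L \<alpha>m])
  have mP: "m * P \<le> F + a"
  proof (cases "P = 0")
    case False
    have "m * P\<^sup>2 \<le> (\<alpha> e + d e) - d e" using \<alpha>m by (simp add: P_def)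
    also have "\<dots> \<le> F * P + a * P"
      using D.bounded_dual[OF rD e] D.bounded_dual[OF dD e] unfolding F_def a_def P_def by linarith
    finally have "(m * P) * P \<le> (F + a) * P" by (simp add: power2_eq_square algebra_simps)
    then show ?thesis using False nn by simp
  qed (use F a in simp)

  have energy: "m_S L m * r\<^sup>2 \<le> (p + q) * r / g + a * F / m"
  proof -
    \<comment> \<open>Express \<open>d e\<close> by the second Galerkin equation tested with \<open>\<eta>\<close>.\<close>
    define a' where "a' = ?DY (dt T \<iota> \<eta>)"
    have a'a: "a' \<le> a / g"
      using infsup[OF \<eta>] g by (simp add: a'_def a_def d_def pos_le_divide_eq mult.commute)
    have tr\<eta>: "?tr \<eta> = ?tr ub - ?tr ud" unfolding \<eta>_def by (rule trdiff[OF ubX udX])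
    have trw: "?tr w = ?tr u - ?tr ub" unfolding w_def by (rule trdiff[OF u ubX])
    have "d e = d \<theta>b - d \<theta>d" unfolding e_def d_def by (rule L2.dual_lin(2)[OF dt_dual[OF \<eta>X] \<theta>bL \<theta>dL])
    moreover have "d (\<theta>b - \<theta>) = d \<theta>b - d \<theta>" unfolding d_def by (rule L2.dual_lin(2)[OF dt_dual[OF \<eta>X] \<theta>bL \<theta>])
    moreover have "d \<theta> - d \<theta>d = (?op u \<eta> - ?op ud \<eta>) + (?tr u \<bullet> ?tr \<eta> - ?tr ud \<bullet> ?tr \<eta>)"
      using orth2[OF \<eta>] by (simp add: d_def)
    moreover have "?tr u \<bullet> ?tr \<eta> - ?tr ud \<bullet> ?tr \<eta> = ?tr w \<bullet> ?tr \<eta> + c\<^sup>2"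
      by (simp add: c_def power2_norm_eq_inner trw tr\<eta> algebra_simps)
    moreover have "m * b\<^sup>2 \<le> ?op ub \<eta> - ?op ud \<eta>" unfolding b_def \<eta>_def by (rule opM[OF ubL udL])
    moreover have "\<bar>?op ub \<eta> - ?op u \<eta>\<bar> \<le> L * b0 * b" using opB[OF ubL uL \<eta>L] by (simp add: bu b_def)
    moreover have "\<bar>?tr w \<bullet> ?tr \<eta>\<bar> \<le> c0 * c" unfolding c0_def c_def by (rule Cauchy_Schwarz_ineq2)
    moreover have "\<bar>d (\<theta>b - \<theta>)\<bar> \<le> a' * p"
      using L2.bounded_dual[OF dt_dual[OF \<eta>X] L2_diff[OF \<theta>bL \<theta>]] by (simp add: d_def a'_def bp)
    moreover have "a' * p \<le> p * r / g"
    proof -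
      have "a' * p \<le> (a / g) * p" by (rule mult_right_mono[OF a'a nn(2)])
      also have "\<dots> \<le> (r / g) * p" using ar g nn by (intro mult_right_mono divide_right_mono) auto
      finally show ?thesis by (simp add: mult.commute)
    qed
    moreover have "L * b0 * b + c0 * c \<le> q * r / g"
    proof -
      have "(L * b0) * b + c0 * c \<le> q * sqrt (b\<^sup>2 + c\<^sup>2)"
        unfolding q_def using L nn by (intro cauchy_schwarz_2) auto
      also have "\<dots> \<le> q * r" unfolding r_def using nn by (intro mult_left_mono real_sqrt_le_mono) auto
      also have "\<dots> \<le> q * r / g"
        using mult_left_mono[of 1 "1 / g" "q * r"] g nn by simp
      finally show ?thesis .
    qed
    ultimately have "m / L\<^sup>2 * a\<^sup>2 + m * b\<^sup>2 + c\<^sup>2 \<le> p * r / g + q * r / g + a * F / m"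
      using de by linarith
    moreover have "m_S L m * r\<^sup>2 \<le> m / L\<^sup>2 * a\<^sup>2 + m * b\<^sup>2 + c\<^sup>2"
    proof -
      have "m_S L m * a\<^sup>2 \<le> m / L\<^sup>2 * a\<^sup>2" "m_S L m * b\<^sup>2 \<le> m * b\<^sup>2" "m_S L m * c\<^sup>2 \<le> 1 * c\<^sup>2"
        by (intro mult_right_mono; simp add: m_S_def)+
      then show ?thesis unfolding r2 distrib_left by linarith
    qed
    ultimately show ?thesis by (simp add: add_divide_distrib distrib_right)
  qed
  have mS: "0 < m_S L m" using m L by (simp add: m_S_def)
  have stab: "P + r / g \<le> (F / m + (1 + 1 / m) / m_S L m * ((p + q) + F / m)) / g\<^sup>2"
    by (rule discrete_stability_arith[OF g m(1) mS _ F nn(8,1) ar mP energy]) (use nn in simp)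
  have Xw: "Xnorm T \<iota> w = sqrt (b0\<^sup>2 + a0\<^sup>2 + c0\<^sup>2)" by (simp add: Xnorm_def b0_def a0_def c0_def)
  have arith: "F / m + (1 + 1 / m) / m_S L m * (p + q + F / m)
      \<le> L_Ninv L m * L_N L * (p + Xnorm T \<iota> w)"
    unfolding Xw q_def
    by (rule quasi_optimality_constant[OF m nn(2) a0 nn(5,6) F FLp])
  have X\<eta>: "Xnorm T \<iota> \<eta> \<le> r / g"
  proof -
    have a1: "1 \<le> 1 / g" using g by simp
    have a': "?DY (dt T \<iota> \<eta>) \<le> a / g"
      using infsup[OF \<eta>] g by (simp add: a_def d_def pos_le_divide_eq mult.commute)
    have "Xnorm T \<iota> \<eta> = sqrt (b\<^sup>2 + (?DY (dt T \<iota> \<eta>))\<^sup>2 + c\<^sup>2)" by (simp add: Xnorm_def b_def c_def)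
    also have "\<dots> \<le> sqrt ((b / g)\<^sup>2 + (a / g)\<^sup>2 + (c / g)\<^sup>2)"
      using mult_left_mono[OF a1 nn(3)] mult_left_mono[OF a1 nn(4)] a' L2.dual_norm_nonneg[OF dt_dual[OF \<eta>X]] nn
      by (intro real_sqrt_le_mono add_mono power_mono) auto
    also have "\<dots> = sqrt ((b\<^sup>2 + a\<^sup>2 + c\<^sup>2) / g\<^sup>2)" by (simp add: power_divide add_divide_distrib)
    also have "\<dots> = r / g" using g by (simp add: real_sqrt_divide r_def)
    finally show ?thesis .
  qed
  have "Xnorm T \<iota> (w + \<eta>) \<le> Xnorm T \<iota> w + Xnorm T \<iota> \<eta>" by (rule Xnorm_triangle[OF wX \<eta>X T])
  moreover have "w + \<eta> = u - ud" by (simp add: w_def \<eta>_def)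
  ultimately have 1: "Xnorm T \<iota> (u - ud) \<le> Xnorm T \<iota> w + r / g" using X\<eta> by simp
  have 2: "?n (\<theta> - \<theta>d) \<le> p + P"
    using L2_norm_triangle_diff[OF \<theta> \<theta>bL \<theta>dL] unfolding p_def P_def e_def .
  have 3: "P + r / g \<le> L_Ninv L m * L_N L * (p + Xnorm T \<iota> w) / g\<^sup>2"
    by (rule order_trans[OF stab divide_right_mono[OF arith]]) simp
  have "?n (\<theta> - \<theta>d) + Xnorm T \<iota> (u - ud) \<le> (p + Xnorm T \<iota> w) + L_Ninv L m * L_N L * (p + Xnorm T \<iota> w) / g\<^sup>2"
    using 1 2 3 by linarith
  also have "\<dots> = (1 + L_Ninv L m * L_N L / g\<^sup>2) * (p + Xnorm T \<iota> w)" by (simp add: distrib_right)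
  finally show ?thesis by (simp only: p_def w_def)
qed

lemma le_mult_INF:
  fixes f :: "'a \<Rightarrow> real"
  assumes "0 < C" "S \<noteq> {}" "\<And>x. x \<in> S \<Longrightarrow> E \<le> C * f x"
  shows "E \<le> C * (INF x\<in>S. f x)"
proof -
  have "E / C \<le> (INF x\<in>S. f x)"
    by (rule cINF_greatest[OF assms(2)]) (use assms in \<open>simp add: pos_divide_le_eq mult.commute\<close>)
  then show ?thesis using assms(1) by (simp add: pos_divide_le_eq mult.commute)
qed

text \<open>
  The upper bound \<open>1\<close> comes from the full spaces, which belong to the family: there the quotient is
  \<open>1\<close> for any \<open>z\<close> whose derivative does not vanish, such as \<open>z t = t v\<close>.
  In particular the infimum is a real number.
\<close>

lemma gamma_Delta_inf_sup:
  fixes \<iota> :: "'v::{real_inner,complete_space} \<Rightarrow>\<^sub>L 'h::{real_inner,complete_space}"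
  assumes T: "0 < T" and \<iota>: "gelfand_triple \<iota>" and fam: "space_family T \<iota> \<Delta> \<delta>s X Y"
    and pos: "0 < gamma_Delta T \<iota> \<Delta> X Y"
  shows "0 < real_of_ereal (gamma_Delta T \<iota> \<Delta> X Y)" "real_of_ereal (gamma_Delta T \<iota> \<Delta> X Y) \<le> 1"
    and "\<delta> \<in> \<Delta> \<Longrightarrow> z \<in> X \<delta> \<Longrightarrow> real_of_ereal (gamma_Delta T \<iota> \<Delta> X Y) *
      dual_norm (Yspace T) (Ynorm T) (dt T \<iota> z) \<le> dual_norm (Y \<delta>) (Ynorm T) (dt T \<iota> z)"
proof -
  let ?\<gamma> = "gamma_Delta T \<iota> \<Delta> X Y" and ?DY = "dual_norm (Yspace T) (Ynorm T)"
  have T0: "0 \<le> T" using T by simp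
  have \<delta>s: "\<delta>s \<in> \<Delta>" "X \<delta>s = Xspace T \<iota>" "Y \<delta>s = Yspace T" using fam by (auto simp: space_family_def)
  have sub: "subspace (X \<delta>)" "X \<delta> \<subseteq> Xspace T \<iota>" "subspace (Y \<delta>)" "Y \<delta> \<subseteq> Yspace T" if "\<delta> \<in> \<Delta>" for \<delta>
    using fam that by (auto simp: space_family_def closed_subspace_def)
  have DYpos: "0 < ?DY (dt T \<iota> z)" if z: "z \<in> Xspace T \<iota>" and v: "v \<in> Yspace T" "dt T \<iota> z v \<noteq> 0" for z v
  proof -
    have "0 < ?DY (dt T \<iota> z) * Ynorm T v" using L2.bounded_dual[OF dt_dual[OF z] v(1)] v(2) by linarith
    then show ?thesis using L2_norm_nonneg[of T v] by (simp add: zero_less_mult_iff)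
  qed
  have lower: "?\<gamma> \<le> ereal (dual_norm (Y \<delta>) (Ynorm T) (dt T \<iota> z) / ?DY (dt T \<iota> z))"
    if "\<delta> \<in> \<Delta>" "z \<in> X \<delta>" "v \<in> Yspace T" "dt T \<iota> z v \<noteq> 0" for \<delta> z v
    unfolding gamma_Delta_def using that by (intro INF_lower2[OF that(1)] INF_lower2[of z]) auto
  have "\<forall>\<delta>\<in>\<Delta>. \<exists>v\<in>Y \<delta>. Ynorm T v \<noteq> 0" using fam by (simp add: space_family_def)
  then have "\<exists>v\<in>Y \<delta>s. Ynorm T v \<noteq> 0" using \<delta>s(1) by (rule bspec)
  then obtain x where x: "Ynorm T (x :: real \<Rightarrow> 'v) \<noteq> 0" by blast
  have "\<exists>t. x t \<noteq> 0"
  proof (rule ccontr)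
    assume "\<nexists>t. x t \<noteq> 0"
    then have "Ynorm T x = 0" by (simp add: L2_norm_def)
    with x show False ..
  qed
  then obtain v :: 'v where v: "v \<noteq> 0" by blast
  have "inj (blinfun_apply \<iota>)" using \<iota> by (simp add: gelfand_triple_def)
  from injD[OF this, of v 0] have \<iota>v: "\<iota> v \<noteq> 0" using v by auto
  \<comment> \<open>The function \<open>t v\<close> has the constant derivative \<open>v\<close>; pair it with \<open>v\<close>.\<close>
  define y where "y = (\<lambda>t::real. t *\<^sub>R v)"
  define k where "k = (\<lambda>t::real. v)"
  have "C1_pair (\<lambda>t::real. t) (\<lambda>t. 1)" by (simp add: C1_pair_real)
  from C1_pair_scaleR_vec[OF this, of v] have y: "C1_pair y k" by (simp add: y_def k_def)
  have kL: "k \<in> L2 T" unfolding k_def by (intro L2_continuous continuous_intros)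
  have yX: "y \<in> Xspace T \<iota>" by (rule C1_Xspace[OF y T0])
  have "dt T \<iota> y k = H_ip T \<iota> k k" by (rule dt_C1[OF y T0 kL])
  also have "\<dots> = T * (\<iota> v \<bullet> \<iota> v)" using measure_Xi[OF T0] by (simp add: H_ip_def k_def)
  finally have "dt T \<iota> y k = T * (\<iota> v \<bullet> \<iota> v)" .
  then have dty: "dt T \<iota> y k \<noteq> 0" using T \<iota>v by simp
  have "?\<gamma> \<le> ereal (?DY (dt T \<iota> y) / ?DY (dt T \<iota> y))"
    using lower[OF \<delta>s(1) _ kL dty] yX \<delta>s by simp
  then have le1: "?\<gamma> \<le> 1" using DYpos[OF yX kL dty] by (simp add: one_ereal_def)
  then obtain g where g: "?\<gamma> = ereal g" using pos by (cases ?\<gamma>) auto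
  show "0 < real_of_ereal ?\<gamma>" "real_of_ereal ?\<gamma> \<le> 1" using pos le1 g by auto
  assume \<delta>: "\<delta> \<in> \<Delta>" and z: "z \<in> X \<delta>"
  have zX: "z \<in> Xspace T \<iota>" using sub(2)[OF \<delta>] z by blast
  interpret D: semi_inner_space "Y \<delta>" "L2_ip T"
    rewrites "semi_inner_space.N (L2_ip T) = L2_norm T"
    by (rule semi_inner_L2_subspace[OF sub(3,4)[OF \<delta>]], rule L2_norm_eq)
  have nn: "0 \<le> dual_norm (Y \<delta>) (Ynorm T) (dt T \<iota> z)"
    by (rule D.dual_norm_nonneg[OF dual_subset[OF dt_dual[OF zX] sub(4)[OF \<delta>]]])
  show "real_of_ereal ?\<gamma> * ?DY (dt T \<iota> z) \<le> dual_norm (Y \<delta>) (Ynorm T) (dt T \<iota> z)"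
  proof (cases "\<exists>v\<in>Yspace T. dt T \<iota> z v \<noteq> 0")
    case True
    then obtain v where v: "v \<in> Yspace T" "dt T \<iota> z v \<noteq> 0" ..
    have "g \<le> dual_norm (Y \<delta>) (Ynorm T) (dt T \<iota> z) / ?DY (dt T \<iota> z)" using lower[OF \<delta> z v] g by simp
    then show ?thesis using DYpos[OF zX v] g by (simp add: pos_le_divide_eq)
  next
    case False
    then have "?DY (dt T \<iota> z) \<le> 0" by (intro L2.dual_norm_le) auto
    then have "?DY (dt T \<iota> z) = 0" using L2.dual_norm_nonneg[OF dt_dual[OF zX]] by simp
    then show ?thesis using nn by simp
  qed
qed

lemma restrict_eqD:
  assumes eq: "restrict f S = restrict h S" and x: "x \<in> S"
  shows "f x = h x"
proof -
  have "restrict f S x = restrict h S x" by (simp only: eq)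
  then show ?thesis by (simp only: restrict_apply x if_True)
qed

theorem proposition5p1:
  fixes T :: real
    and \<iota> :: "'v::{real_inner,complete_space} \<Rightarrow>\<^sub>L 'h::{real_inner,complete_space}"
    and A :: "real \<Rightarrow> 'v \<Rightarrow> 'v \<Rightarrow>\<^sub>L real"
    and LA mA :: real
    and \<Delta> :: "'d set" and \<delta>s :: 'd
    and X Y :: "'d \<Rightarrow> (real \<Rightarrow> 'v) set"
    and f g :: "(real \<Rightarrow> 'v) \<Rightarrow> real"
    and \<delta> :: 'd
    and \<theta> u \<theta>\<delta> u\<delta> :: "real \<Rightarrow> 'v"
  defines "\<gamma> \<equiv> gamma_Delta T \<iota> \<Delta> X Y"
  assumes "T > 0"
    and "gelfand_triple \<iota>"
    and "LA > 0" and "mA > 0"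
    and "lipschitz_monotone T A LA mA"
    and "space_family T \<iota> \<Delta> \<delta>s X Y"
    and "\<gamma> > 0"
    and "f \<in> dual (Yspace T) (Ynorm T)"
    and "g \<in> dual (Xspace T \<iota>) (Xnorm T \<iota>)"
    and "\<delta> \<in> \<Delta>"
    and "\<theta> \<in> Yspace T" and "u \<in> Xspace T \<iota>"
    and "op_N T \<iota> A (Yspace T) (Xspace T \<iota>) (\<theta>, u) =
           (restrict f (Yspace T), restrict g (Xspace T \<iota>))"
    and "\<theta>\<delta> \<in> Y \<delta>" and "u\<delta> \<in> X \<delta>"
    and "op_N T \<iota> A (Y \<delta>) (X \<delta>) (\<theta>\<delta>, u\<delta>) = (restrict f (Y \<delta>), restrict g (X \<delta>))"
  shows "Ynorm T (\<theta> - \<theta>\<delta>) + Xnorm T \<iota> (u - u\<delta>)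
           \<le> (1 + L_Ninv LA mA * L_N LA / (real_of_ereal \<gamma>)\<^sup>2) *
               (INF (\<theta>b, ub)\<in>Y \<delta> \<times> X \<delta>. Ynorm T (\<theta> - \<theta>b) + Xnorm T \<iota> (u - ub))
         \<and>
         ((\<exists>l\<in>dual (Yspace T) (Ynorm T). \<exists>u0.
             restrict f (Yspace T) = restrict l (Yspace T) \<and>
             restrict g (Xspace T \<iota>) = restrict (- (l + trace_adj T \<iota> 0 u0)) (Xspace T \<iota>)) \<and>
          X \<delta> \<subseteq> Y \<delta> \<longrightarrow>
          Xnorm T \<iota> (u - u\<delta>)
            \<le> 2 * (1 + L_Ninv LA mA * L_N LA / (real_of_ereal \<gamma>)\<^sup>2) *
                (INF ub\<in>X \<delta>. Xnorm T \<iota> (u - ub)))"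
proof -
  note T = \<open>T > 0\<close> and A = \<open>lipschitz_monotone T A LA mA\<close> and fam = \<open>space_family T \<iota> \<Delta> \<delta>s X Y\<close>
    and \<delta> = \<open>\<delta> \<in> \<Delta>\<close> and \<theta> = \<open>\<theta> \<in> Yspace T\<close> and u = \<open>u \<in> Xspace T \<iota>\<close>
    and \<theta>d = \<open>\<theta>\<delta> \<in> Y \<delta>\<close> and ud = \<open>u\<delta> \<in> X \<delta>\<close>
  have sub: "subspace (X \<delta>)" "X \<delta> \<subseteq> Xspace T \<iota>" "subspace (Y \<delta>)" "Y \<delta> \<subseteq> Yspace T"
    using fam \<delta> by (auto simp: space_family_def closed_subspace_def)
  note gam = gamma_Delta_inf_sup[OF T \<open>gelfand_triple \<iota>\<close> fam \<open>\<gamma> > 0\<close>[unfolded \<gamma>_def], folded \<gamma>_def]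
  have opD: "op_A T A w \<in> dual (Yspace T) (Ynorm T)" if "w \<in> Yspace T" for w
    using A that unfolding lipschitz_monotone_def by blast
  have opM: "mA * (Ynorm T (w - v))\<^sup>2 \<le> (op_A T A w - op_A T A v) (w - v)"
    if "w \<in> Yspace T" "v \<in> Yspace T" for w v
    using A that unfolding lipschitz_monotone_def by blast
  have opL: "dual_norm (Yspace T) (Ynorm T) (op_A T A w - op_A T A v) \<le> LA * Ynorm T (w - v)"
    if "w \<in> Yspace T" "v \<in> Yspace T" for w v
    using A that by (simp add: lipschitz_monotone_def)
  \<comment> \<open>Both constants bound the same quotient for a nonzero element of \<open>Y\<close>.\<close>
  have mL: "mA \<le> LA"
  proof -
    have "\<forall>\<delta>\<in>\<Delta>. \<exists>v\<in>Y \<delta>. Ynorm T v \<noteq> 0" using fam by (simp add: space_family_def)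
    then have "\<exists>v\<in>Y \<delta>. Ynorm T v \<noteq> 0" using \<delta> by (rule bspec)
    then obtain v where v': "v \<in> Y \<delta>" and v2: "Ynorm T v \<noteq> 0" ..
    note v = subsetD[OF sub(4) v'] v2
    define n where "n = Ynorm T v"
    have n: "0 < n" using v(2) L2_norm_nonneg[of T v] unfolding n_def by linarith
    let ?B = "op_A T A v - op_A T A 0"
    have B: "?B \<in> dual (Yspace T) (Ynorm T)"
      using L2.dual_combination[OF opD[OF v(1)] opD[OF subspace_0[OF subspace_L2]], of 1 "-1"]
      by (simp add: fun_diff_def)
    have "mA * n\<^sup>2 \<le> ?B v" using opM[OF v(1) subspace_0[OF subspace_L2]] by (simp add: n_def)
    also have "\<dots> \<le> dual_norm (Yspace T) (Ynorm T) ?B * n" using L2.bounded_dual[OF B v(1)] by (simp add: n_def)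
    also have "\<dots> \<le> (LA * n) * n"
      using opL[OF v(1) subspace_0[OF subspace_L2]] n by (intro mult_right_mono) (simp_all add: n_def)
    finally have "mA * n\<^sup>2 \<le> LA * n\<^sup>2" by (simp add: power2_eq_square)
    then show ?thesis using n by simp
  qed
  note NN = \<open>op_N T \<iota> A (Yspace T) (Xspace T \<iota>) (\<theta>, u) = _\<close>[unfolded op_N_def prod.case prod.inject]
    and NNd = \<open>op_N T \<iota> A (Y \<delta>) (X \<delta>) (\<theta>\<delta>, u\<delta>) = _\<close>[unfolded op_N_def prod.case prod.inject]
  note N = conjunct1[OF NN] conjunct2[OF NN] and Nd = conjunct1[OF NNd] conjunct2[OF NNd]
  define C where "C = 1 + L_Ninv LA mA * L_N LA / (real_of_ereal \<gamma>)\<^sup>2"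
  have quasi: "Ynorm T (\<theta> - \<theta>\<delta>) + Xnorm T \<iota> (u - u\<delta>) \<le> C * (Ynorm T (\<theta> - \<theta>b) + Xnorm T \<iota> (u - ub))"
    if b: "\<theta>b \<in> Y \<delta>" "ub \<in> X \<delta>" for \<theta>b ub
    unfolding C_def
  proof (rule galerkin_quasi_optimal[OF T A \<open>mA > 0\<close> mL sub(3,4,1,2) gam(1,2) gam(3)[OF \<delta>] \<theta> u \<theta>d ud _ _ b])
    fix v assume v: "v \<in> Y \<delta>"
    show "op_A T A \<theta> v + dt T \<iota> u v = op_A T A \<theta>\<delta> v + dt T \<iota> u\<delta> v"
      using restrict_eqD[OF N(1) subsetD[OF sub(4) v]] restrict_eqD[OF Nd(1) v] by simp
  next
    fix z assume z: "z \<in> X \<delta>"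
    then have zX: "z \<in> Xspace T \<iota>" by (rule subsetD[OF sub(2)])
    show "dt T \<iota> z \<theta> - (op_A T A u z + time_trace T \<iota> T u \<bullet> time_trace T \<iota> T z)
      = dt T \<iota> z \<theta>\<delta> - (op_A T A u\<delta> z + time_trace T \<iota> T u\<delta> \<bullet> time_trace T \<iota> T z)"
      using restrict_eqD[OF N(2) zX] restrict_eqD[OF Nd(2) z] by (simp add: dt_adj_def trace_adj_def)
  qed
  have C: "0 < C"
  proof -
    have "0 < m_S LA mA" using \<open>LA > 0\<close> \<open>mA > 0\<close> by (simp add: m_S_def)
    then have "0 \<le> L_Ninv LA mA * L_N LA / (real_of_ereal \<gamma>)\<^sup>2"
      unfolding L_Ninv_def L_N_def using \<open>LA > 0\<close> \<open>mA > 0\<close>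
      by (intro divide_nonneg_nonneg mult_nonneg_nonneg add_nonneg_nonneg) auto
    then show ?thesis by (simp add: C_def)
  qed
  have part1: "Ynorm T (\<theta> - \<theta>\<delta>) + Xnorm T \<iota> (u - u\<delta>)
      \<le> C * (INF (\<theta>b, ub)\<in>Y \<delta> \<times> X \<delta>. Ynorm T (\<theta> - \<theta>b) + Xnorm T \<iota> (u - ub))"
  proof (rule le_mult_INF[OF C])
    show "Y \<delta> \<times> X \<delta> \<noteq> {}" using \<theta>d ud by blast
    fix x assume "x \<in> Y \<delta> \<times> X \<delta>"
    then obtain \<theta>b ub where x: "x = (\<theta>b, ub)" "\<theta>b \<in> Y \<delta>" "ub \<in> X \<delta>" by (rule SigmaE)
    show "Ynorm T (\<theta> - \<theta>\<delta>) + Xnorm T \<iota> (u - u\<delta>)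
        \<le> C * (case x of (\<theta>b, ub) \<Rightarrow> Ynorm T (\<theta> - \<theta>b) + Xnorm T \<iota> (u - ub))"
      unfolding x(1) prod.case by (rule quasi[OF x(2,3)])
  qed
  have part2: "Xnorm T \<iota> (u - u\<delta>) \<le> 2 * C * (INF ub\<in>X \<delta>. Xnorm T \<iota> (u - ub))"
    if l: "l \<in> dual (Yspace T) (Ynorm T)" and fl: "restrict f (Yspace T) = restrict l (Yspace T)"
      and gl: "restrict g (Xspace T \<iota>) = restrict (- (l + trace_adj T \<iota> 0 u0)) (Xspace T \<iota>)"
      and XY: "X \<delta> \<subseteq> Y \<delta>" for l u0
  proof (rule le_mult_INF)
    note uL = Xspace_L2[OF u]
    \<comment> \<open>The first component \<open>\<theta>\<close> equals \<open>u\<close>, so \<open>ub\<close> may be used to approximate both components.\<close>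
    have eq: "Ynorm T (\<theta> - u) = 0"
    proof (rule parabolic_uniqueness[OF \<theta> u T opD[OF \<theta>] opD[OF uL] _ \<open>mA > 0\<close>])
      show "mA * (Ynorm T (\<theta> - u))\<^sup>2 \<le> op_A T A \<theta> (\<theta> - u) - op_A T A u (\<theta> - u)"
        using opM[OF \<theta> uL] by simp
      show "op_A T A \<theta> v + dt T \<iota> u v = l v" if "v \<in> Yspace T" for v
        using restrict_eqD[OF N(1) that] restrict_eqD[OF fl that] by simp
      show "dt T \<iota> z \<theta> - (op_A T A u z + time_trace T \<iota> T u \<bullet> time_trace T \<iota> T z)
          = - (l z + u0 \<bullet> time_trace T \<iota> 0 z)" if "z \<in> Xspace T \<iota>" for z
        using restrict_eqD[OF N(2) that] restrict_eqD[OF gl that] by (simp add: dt_adj_def trace_adj_def)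
    qed
    fix ub assume ub: "ub \<in> X \<delta>"
    then have ubY: "ub \<in> Y \<delta>" by (rule subsetD[OF XY])
    then have ubL: "ub \<in> Yspace T" by (rule subsetD[OF sub(4)])
    have "Ynorm T (\<theta> - ub) \<le> Xnorm T \<iota> (u - ub)"
      using L2_norm_triangle_diff[OF \<theta> uL ubL] eq L2_norm_le_Xnorm[of T "u - ub" \<iota>] by linarith
    then have "C * (Ynorm T (\<theta> - ub) + Xnorm T \<iota> (u - ub)) \<le> C * (2 * Xnorm T \<iota> (u - ub))"
      using C by (intro mult_left_mono) auto
    moreover have "0 \<le> Ynorm T (\<theta> - \<theta>\<delta>)" by simp
    ultimately show "Xnorm T \<iota> (u - u\<delta>) \<le> 2 * C * Xnorm T \<iota> (u - ub)"
      using quasi[OF ubY ub] by linarith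
  next
    show "0 < 2 * C" using C by simp
    show "X \<delta> \<noteq> {}" using ud by blast
  qed
  show ?thesis
    unfolding C_def[symmetric]
  proof (intro conjI impI part1)
    assume "(\<exists>l\<in>dual (Yspace T) (Ynorm T). \<exists>u0.
             restrict f (Yspace T) = restrict l (Yspace T) \<and>
             restrict g (Xspace T \<iota>) = restrict (- (l + trace_adj T \<iota> 0 u0)) (Xspace T \<iota>)) \<and>
          X \<delta> \<subseteq> Y \<delta>"
    then show "Xnorm T \<iota> (u - u\<delta>) \<le> 2 * C * (INF ub\<in>X \<delta>. Xnorm T \<iota> (u - ub))"
      by (elim conjE bexE exE) (rule part2)
  qed
qed

end
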